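(* Assume that the following three statements (conjectures) hold. (i) For every precubical set $K$, the canonical quotient morphisms of chain complexes $C^{gl}(F(K))\to CR^{gl}(F(K))$ and $C^{\pm}(F(K))\to CR^{\pm}(F(K))$ induce isomorphisms in homology. (ii) For every precubical set $K$, the canonical quotient morphisms of chain complexes $C^{gl}(\widehat{F(K)})\to CR^{gl}(\widehat{F(K)})$ and $C^{\pm}(\widehat{F(K)})\to CR^{\pm}(\widehat{F(K)})$ induce isomorphisms in homology. (iii) For every non-contracting $\omega$-category $\mathcal{C}$, the folding operators of the globular nerve and of the branching and merging semi-cubical nerves induce quasi-isomorphisms of chain complexes $CF^{gl}(\mathcal{C})\to CR^{gl}(\mathcal{C})$ and $CF^{\pm}(\mathcal{C})\to CR^{\pm}(\mathcal{C})$. Then for every precubical set $K$ the morphisms of chain complexes $$C^{gl}(F(K))\to C^{gl}(\widehat{F(K)}),\qquad C^{\pm}(F(K))\to C^{\pm}(\widehat{F(K)})$$ (induced by the canonical $\omega$-functor $F(K)\to\widehat{F(K)}$) induce isomorphisms in homology.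
   Context: **$\omega$-categories.** An $\omega$-category is a set $A$ with maps $s_n=d_n^-,\ t_n=d_n^+:A\to A$ ($n\ge 0$) and partial binary operations $*_n$, with $a*_n b$ defined exactly when $t_n a=s_n b$, such that for all $\alpha,\beta\in\{-,+\}$: (1) $d_m^\beta d_n^\alpha x=d_m^\beta x$ if $m<n$ and $=d_n^\alpha x$ if $m\ge n$; (2) $s_nx*_nx=x*_nt_nx=x$; (3) if $x*_ny$ is defined then $s_n(x*_ny)=s_nx$, $t_n(x*_ny)=t_ny$, and $d_m^\alpha(x*_ny)=d_m^\alpha x*_n d_m^\alpha y$ for $m\ne n$; (4) $(x*_ny)*_nz=x*_n(y*_nz)$ when both sides exist; (5) for $m\neq n$, $(x*_ny)*_m(z*_nw)=(x*_mz)*_n(y*_mw)$ when both sides make sense; (6) for each $x$ there is $n$ with $s_nx=t_nx=x$; the least such $n$ is $\dim(x)$. $\omega$-functors are the structure-preserving maps; $\omega Cat$ is the resulting category. $\mathcal{C}_n$ is the set of morphisms of dimension exactly $n$ and $tr^n\mathcal{C}$ the set of those of dimension at most $n$. $\mathcal{C}$ is non-contracting if $s_1x$ and $t_1x$ are $1$-dimensional for every $x$ with $\dim(x)\ge1$; an $\omega$-functor is non-contracting if it sends $1$-dimensional morphisms to $1$-dimensional ones; $\omega Cat_1$ is the category of non-contracting $\omega$-categories and non-contracting $\omega$-functors. The path $\omega$-category $\mathbb{P}\mathcal{C}$ has $(\mathbb{P}\mathcal{C})_i=\mathcal{C}_{i+1}$, $i\geq 0$, with the operations $s_{i+1},t_{i+1},*_{i+1}$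 of $\mathcal{C}$ as $i$-source, $i$-target, $i$-composition; these keep their names from $\mathcal{C}$. So $tr^n\mathbb{P}\mathcal{C}$ consists of the $x\in\mathcal{C}$ with $1\le\dim(x)\le n+1$. An $\omega$-category $\mathcal{D}$ is a strict globular $\omega$-groupoid if for every $p$-morphism $A$ with $p\ge1$ and every $r\ge0$ there is $A'$ with $A*_rA'=s_rA=t_rA'$ and $A'*_rA=s_rA'=t_rA$. $\omega Cat_1^{Kan}$ is the full subcategory of $\omega Cat_1$ of those $\mathcal{C}$ such that $\mathbb{P}\mathcal{C}$ is a strict globular $\omega$-groupoid; $\mathcal{C}\mapsto\widehat{\mathcal{C}}$ is the left adjoint of the inclusion $\omega Cat_1^{Kan}\to\omega Cat_1$, and $\mathcal{C}\to\widehat{\mathcal{C}}$ is the unit. **Cubes and simplices.** Faces of the $n$-cube are words of length $n$ in $\{-,0,+\}$, of dimension the number of $0$'s; subfaces are obtained by replacing some zeros by signs; $0_n=0\cdots0$, $\pm_n=\pm\cdots\pm$. Faces of the $n$-simplex are nonempty strictly increasing sequences in $\{0,\dots,n\}$, a sequence of length $p+1$ having dimension $p$; subfaces are nonempty subsequences. $R(x)$ is the set of subfaces of $x$ (including $x$), $R(X)=\bigcup_{x\in X}R(x)$. For a face $x$ of dimension $p\ge1$: for the cube, $s_x$ (resp. $t_x$) is the set of the $p$ words obtained by replacing, for one $i\in\{1,\dots,p\}$, the $i$-th zero by the sign $(-)^i$ (resp. $(-)^{i+1}$), with $(-)^i=-$ for $i$ odd and $+$ for $i$ even; for the simplex, $s_x$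 (resp. $t_x$) is the set of sequences obtained by deleting one entry in odd (resp. even) position, positions counted from $1$. $I^n$ (resp. $\Delta^n$) is the unique $\omega$-category, generated under composition by the $R(x)$ for $x$ a face of the cube (resp. simplex), with underlying set a subset of $\{R(X)\}$, with $s_{p-1}R(x)=R(s_x)$, $t_{p-1}R(x)=R(t_x)$ for $x$ of dimension $p\ge1$, and such that $t_p(X)=s_p(Y)$ implies that $X\cup Y$ is an element and $X*_pY=X\cup Y$. A monotone map $[m]\to[n]$ induces an $\omega$-functor $\Delta^m\to\Delta^n$ by taking images of vertex sets. **Precubical sets.** A precubical set $K$ is a family of sets $(K_n)_{n\ge0}$ with maps $\partial_i^\alpha:K_{n+1}\to K_n$ ($1\le i\le n+1$, $\alpha=\pm$) with $\partial_i^\alpha\partial_j^\beta=\partial_{j-1}^\beta\partial_i^\alpha$ for $i<j$, i.e. a presheaf on the category $\square^{pre}$ of the corresponding coface maps $\delta_i^\alpha$; $n\mapsto I^n$ is a functor on $\square^{pre}$, $\delta_i^\alpha:I^n\to I^{n+1}$ inserting $\alpha$ at position $i$. The $\omega$-category freely generated by $K$ is the coend $F(K)=\int^{n\in\square^{pre}}K_n\cdot I^n$ in $\omega Cat$; it is non-contracting. **Nerves** (augmented simplicial sets, functorial in $\mathcal{C}\in\omega Cat_1$), each with evaluation maps $ev$ from $n$-simplexes to $tr^n\mathbb{P}\mathcal{C}$. - Globular: $\mathcal{N}^{gl}_n(\mathcal{C})=\omega Cat(\Delta^n,\mathbb{P}\mathcal{C})$ for $n\ge0$, $\mathcal{N}^{gl}_{-1}(\mathcal{C})=\mathcal{C}_0\times\mathcal{C}_0$,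 $\partial_{-1}(x)=(s_0x,t_0x)$, $ev(x)=x((0<\dots<n))$. - Branching semi-cubical: $\mathcal{N}^-_n(\mathcal{C})$ is the set of $\omega$-functors $x:I^{n+1}\to\mathcal{C}$ such that $\dim x(u)=1$ whenever $\dim(u)=1$ and $d_0^-(u)=-_{n+1}$; $\mathcal{N}^-_{-1}(\mathcal{C})=\mathcal{C}_0$, $\partial_{-1}=s_0$; for $0\le i\le n$ the face map $\partial_i$ is precomposition with the $\omega$-functor inserting $-$ at position $i+1$, and the degeneracy $\epsilon_i$ is precomposition with the $\omega$-functor replacing the letters $k_{i+1},k_{i+2}$ by $\max(k_{i+1},k_{i+2})$ ($-<0<+$); $ev(x)=x(0_{n+1})$. - Merging semi-cubical $\mathcal{N}^+$: the symmetric construction ($d_0^+(u)=+_{n+1}$, insertion of $+$, $\min$ in place of $\max$, $\partial_{-1}=t_0$). **Complexes.** For $\epsilon\in\{gl,-,+\}$, $C^\epsilon_{n}(\mathcal{C})=\mathbb{Z}\mathcal{N}^\epsilon_{n-1}(\mathcal{C})$, $n\geq 0$, is the unnormalized augmented chain complex shifted by one. $M_n^\epsilon(\mathcal{C})\subset C_n^\epsilon(\mathcal{C})$ is generated by the (thin) $x\in\mathcal{N}^\epsilon_{n-1}(\mathcal{C})$ with $ev(x)\in tr^{n-2}\mathbb{P}\mathcal{C}$ for $n\ge2$, and $M_0^\epsilon=M_1^\epsilon=0$. The reduced complex is $CR_n^\epsilon=C_n^\epsilon/(M_n^\epsilon+\partial M_{n+1}^\epsilon)$. Formal complexes: $CF^{gl}_0(\mathcal{C})=\mathbb{Z}\mathcal{C}_0\otimes\mathbb{Z}\mathcal{C}_0$,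 $CF^{gl}_1=\mathbb{Z}\mathcal{C}_1$, and for $n\ge2$, $CF^{gl}_n(\mathcal{C})$ is the quotient of $\mathbb{Z}\mathcal{C}_n$ by the relations $x*_py=x+y$ ($1\le p\le n-1$) taken modulo $\mathbb{Z}\,tr^{n-1}\mathcal{C}$; the differential is $s_{n-1}-t_{n-1}$ for $n\ge2$ and $s_0\otimes t_0$ for $n=1$. $CF^-$ (resp. $CF^+$) has $CF_0^{\pm}=\mathbb{Z}\mathcal{C}_0$, $CF_1^\pm=\mathbb{Z}\mathcal{C}_1$, the same relations together with $x*_0y=x$ (resp. $x*_0y=y$) for $n\ge2$, and differential $s_{n-1}-t_{n-1}$ for $n\ge2$ and $s_0$ (resp. $t_0$) for $n=1$. Folding operators: natural maps $\square_n^\epsilon:tr^{n-1}\mathbb{P}\to\mathcal{N}^\epsilon_{n-1}$, $n\ge1$, with $\square_1^\epsilon=\mathrm{Id}$ (identifying $\mathcal{N}_0^\epsilon$ with $tr^0\mathbb{P}$) and, for $n\ge2$, $\square_n^\epsilon$ the unique natural transformation such that $ev\circ\square_n^\epsilon=\mathrm{Id}$ and whose restriction to $tr^{n-2}\mathbb{P}$ is $\epsilon_{n-2}\circ\square_{n-1}^\epsilon$; $\square_0^\epsilon=\mathrm{Id}$. It is known that they induce morphisms of chain complexes $CF^\epsilon(\mathcal{C})\to CR^\epsilon(\mathcal{C})$, $x\mapsto\square_n^\epsilon(x)$, for every non-contracting $\mathcal{C}$.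
   Formalization: In CF^- and CF^+ the relation x*_0 y = x (resp. y) is imposed also in degree 1, and only between factors of dimension at least 1; otherwise the differential from degree 2 is ill-defined, and s_0 y *_0 y = s_0 y would kill every y. *)

theory Defs
  imports "HOL-Algebra.Free_Abelian_Groups" "HOL-Algebra.Generated_Groups" "HOL-Library.Sublist"
begin

section \<open>Strict \<open>\<omega>\<close>-categories\<close>

datatype sign = Neg | Pos

text \<open>
  \<open>dd C Neg n\<close> is $s_n = d_n^-$ and \<open>dd C Pos n\<close> is $t_n = d_n^+$.  The composition \<open>cmp C n\<close> is a
  total function whose values are only meaningful on \<open>composable\<close> pairs.
\<close>

record 'a omegacat =
  mor :: "'a set"
  dd  :: "sign \<Rightarrow> nat \<Rightarrow> 'a \<Rightarrow> 'a"
  cmp :: "nat \<Rightarrow> 'a \<Rightarrow> 'a \<Rightarrow> 'a"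

definition composable :: "'a omegacat \<Rightarrow> nat \<Rightarrow> 'a \<Rightarrow> 'a \<Rightarrow> bool" where
  "composable C n x y \<longleftrightarrow> x \<in> mor C \<and> y \<in> mor C \<and> dd C Pos n x = dd C Neg n y"

definition omega_category :: "'a omegacat \<Rightarrow> bool" where
  "omega_category C \<longleftrightarrow>
     (\<forall>\<alpha> n. \<forall>x\<in>mor C. dd C \<alpha> n x \<in> mor C) \<and>
     (\<forall>n x y. composable C n x y \<longrightarrow> cmp C n x y \<in> mor C) \<and>
     (\<forall>\<alpha> \<beta> m n. \<forall>x\<in>mor C.
        dd C \<beta> m (dd C \<alpha> n x) = (if m < n then dd C \<beta> m x else dd C \<alpha> n x)) \<and>
     (\<forall>n. \<forall>x\<in>mor C. cmp C n (dd C Neg n x) x = x \<and> cmp C n x (dd C Pos n x) = x) \<and>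
     (\<forall>n x y. composable C n x y \<longrightarrow>
        dd C Neg n (cmp C n x y) = dd C Neg n x \<and>
        dd C Pos n (cmp C n x y) = dd C Pos n y \<and>
        (\<forall>\<alpha> m. m \<noteq> n \<longrightarrow>
           composable C n (dd C \<alpha> m x) (dd C \<alpha> m y) \<and>
           dd C \<alpha> m (cmp C n x y) = cmp C n (dd C \<alpha> m x) (dd C \<alpha> m y))) \<and>
     (\<forall>n x y z.
        composable C n x y \<and> composable C n (cmp C n x y) z \<and>
        composable C n y z \<and> composable C n x (cmp C n y z) \<longrightarrow>
        cmp C n (cmp C n x y) z = cmp C n x (cmp C n y z)) \<and>
     (\<forall>m n x y z w. m \<noteq> n \<and>
        composable C n x y \<and> composable C n z w \<and>
        composable C m (cmp C n x y) (cmp C n z w) \<and>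
        composable C m x z \<and> composable C m y w \<and>
        composable C n (cmp C m x z) (cmp C m y w) \<longrightarrow>
        cmp C m (cmp C n x y) (cmp C n z w) = cmp C n (cmp C m x z) (cmp C m y w)) \<and>
     (\<forall>x\<in>mor C. \<exists>n. dd C Neg n x = x \<and> dd C Pos n x = x)"

definition mdim :: "'a omegacat \<Rightarrow> 'a \<Rightarrow> nat" where
  "mdim C x = (LEAST n. dd C Neg n x = x \<and> dd C Pos n x = x)"

definition mor_dim :: "nat \<Rightarrow> 'a omegacat \<Rightarrow> 'a set" where
  "mor_dim n C = {x \<in> mor C. mdim C x = n}"

definition tr :: "nat \<Rightarrow> 'a omegacat \<Rightarrow> 'a set" where
  "tr n C = {x \<in> mor C. mdim C x \<le> n}"

definition omega_functor :: "'a omegacat \<Rightarrow> 'b omegacat \<Rightarrow> ('a \<Rightarrow> 'b) \<Rightarrow> bool" where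
  "omega_functor C D f \<longleftrightarrow>
     (\<forall>x\<in>mor C. f x \<in> mor D) \<and>
     (\<forall>\<alpha> n. \<forall>x\<in>mor C. f (dd C \<alpha> n x) = dd D \<alpha> n (f x)) \<and>
     (\<forall>n x y. composable C n x y \<longrightarrow> f (cmp C n x y) = cmp D n (f x) (f y))"

text \<open>Extensionality makes two \<open>\<omega>\<close>-functors that agree on all morphisms equal as elements.\<close>

definition omega_hom :: "'a omegacat \<Rightarrow> 'b omegacat \<Rightarrow> ('a \<Rightarrow> 'b) set" where
  "omega_hom C D = {f \<in> extensional (mor C). omega_functor C D f}"

definition non_contracting :: "'a omegacat \<Rightarrow> bool" where
  "non_contracting C \<longleftrightarrow> omega_category C \<and>
     (\<forall>x\<in>mor C. mdim C x \<ge> 1 \<longrightarrow> mdim C (dd C Neg 1 x) = 1 \<and> mdim C (dd C Pos 1 x) = 1)"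

definition non_contracting_functor :: "'a omegacat \<Rightarrow> 'b omegacat \<Rightarrow> ('a \<Rightarrow> 'b) \<Rightarrow> bool" where
  "non_contracting_functor C D f \<longleftrightarrow> omega_functor C D f \<and>
     (\<forall>x\<in>mor C. mdim C x = 1 \<longrightarrow> mdim D (f x) = 1)"

definition path :: "'a omegacat \<Rightarrow> 'a omegacat" where
  "path C = \<lparr> mor = {x \<in> mor C. mdim C x \<ge> 1},
              dd = (\<lambda>\<alpha> i. dd C \<alpha> (Suc i)),
              cmp = (\<lambda>i. cmp C (Suc i)) \<rparr>"

definition globular_groupoid :: "'a omegacat \<Rightarrow> bool" where
  "globular_groupoid D \<longleftrightarrow> omega_category D \<and>
     (\<forall>r. \<forall>A\<in>mor D. mdim D A \<ge> 1 \<longrightarrow>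
        (\<exists>A'. composable D r A A' \<and> composable D r A' A \<and>
              cmp D r A A' = dd D Neg r A \<and> dd D Neg r A = dd D Pos r A' \<and>
              cmp D r A' A = dd D Neg r A' \<and> dd D Neg r A' = dd D Pos r A))"

definition kan :: "'a omegacat \<Rightarrow> bool" where
  "kan C \<longleftrightarrow> non_contracting C \<and> globular_groupoid (path C)"

text \<open>
  \<open>\<eta> : C \<rightarrow> D\<close> is the unit at \<open>C\<close> of the reflection of non-contracting \<open>\<omega>\<close>-categories into those
  whose path \<open>\<omega>\<close>-category is a strict globular \<open>\<omega>\<close>-groupoid, so \<open>D\<close> is $\widehat{C}$.  The test
  objects live on the same type \<open>'u\<close>.  When \<open>'u\<close> is infinite this is no restriction: a functor from
  \<open>C\<close> lands in a sub-object of cardinality at most that of \<open>'u\<close>, and the completion itself has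
  cardinality at most that of \<open>'u\<close>.
\<close>

definition kan_completion :: "'u omegacat \<Rightarrow> 'u omegacat \<Rightarrow> ('u \<Rightarrow> 'u) \<Rightarrow> bool" where
  "kan_completion C D \<eta> \<longleftrightarrow>
     non_contracting C \<and> kan D \<and> non_contracting_functor C D \<eta> \<and>
     (\<forall>(E :: 'u omegacat) f. kan E \<and> non_contracting_functor C E f \<longrightarrow>
        (\<exists>!g. g \<in> extensional (mor D) \<and> non_contracting_functor D E g \<and>
              (\<forall>x\<in>mor C. g (\<eta> x) = f x)))"


section \<open>Cubes and simplices\<close>

text \<open>
  \<open>face_omegacat faces fdim R bd C\<close> characterises $I^n$ and $\Delta^n$: \<open>R\<close> is the set of subfaces of
  a face and \<open>bd Neg x\<close>, \<open>bd Pos x\<close> are $s_x$, $t_x$.  The clause that \<open>R x\<close> is unchanged by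
  \<open>dd C \<alpha> p\<close> for a \<open>p\<close>-dimensional face \<open>x\<close> spells out that a \<open>p\<close>-face is a morphism of dimension at
  most \<open>p\<close>.
\<close>

definition face_omegacat ::
    "'f set \<Rightarrow> ('f \<Rightarrow> nat) \<Rightarrow> ('f \<Rightarrow> 'f set) \<Rightarrow> (sign \<Rightarrow> 'f \<Rightarrow> 'f set) \<Rightarrow> 'f set omegacat \<Rightarrow> bool" where
  "face_omegacat faces fdim R bd C \<longleftrightarrow>
     omega_category C \<and>
     mor C \<subseteq> {\<Union>(R ` X) | X. X \<subseteq> faces} \<and>
     R ` faces \<subseteq> mor C \<and>
     (\<forall>S. R ` faces \<subseteq> S \<and>
          (\<forall>p X Y. X \<in> S \<and> Y \<in> S \<and> composable C p X Y \<longrightarrow> cmp C p X Y \<in> S) \<longrightarrow> mor C \<subseteq> S) \<and>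
     (\<forall>\<alpha>. \<forall>x\<in>faces. dd C \<alpha> (fdim x) (R x) = R x) \<and>
     (\<forall>\<alpha> p. \<forall>x\<in>faces. fdim x = Suc p \<longrightarrow> dd C \<alpha> p (R x) = \<Union>(R ` bd \<alpha> x)) \<and>
     (\<forall>p X Y. composable C p X Y \<longrightarrow> X \<union> Y \<in> mor C \<and> cmp C p X Y = X \<union> Y)"

text \<open>Words in the letters \<open>-1\<close>, \<open>0\<close>, \<open>1\<close> encode the words in $-$, $0$, $+$.\<close>

fun letter :: "sign \<Rightarrow> int" where
  "letter Neg = -1"
| "letter Pos = 1"

definition cube_faces :: "nat \<Rightarrow> int list set" where
  "cube_faces n = {u. length u = n \<and> set u \<subseteq> {-1, 0, 1}}"

definition cube_dim :: "int list \<Rightarrow> nat" where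
  "cube_dim u = count_list u 0"

definition cube_R :: "int list \<Rightarrow> int list set" where
  "cube_R u = {v \<in> cube_faces (length u). list_all2 (\<lambda>a b. a = 0 \<or> a = b) u v}"

text \<open>
  The zero at (0-based) index \<open>j\<close> is the \<open>i\<close>-th zero of \<open>u\<close> for
  \<open>i = count_list (take (Suc j) u) 0\<close>.
\<close>

definition cube_bd :: "sign \<Rightarrow> int list \<Rightarrow> int list set" where
  "cube_bd \<alpha> u =
     {u[j := (let i = count_list (take (Suc j) u) 0
              in case \<alpha> of Neg \<Rightarrow> (-1) ^ i | Pos \<Rightarrow> (-1) ^ (i + 1))] | j. j < length u \<and> u ! j = 0}"

definition is_cubes :: "(nat \<Rightarrow> int list set omegacat) \<Rightarrow> bool" where
  "is_cubes I \<longleftrightarrow> (\<forall>n. face_omegacat (cube_faces n) cube_dim cube_R cube_bd (I n))"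

definition simplex_faces :: "nat \<Rightarrow> nat list set" where
  "simplex_faces n = {l. l \<noteq> [] \<and> sorted_wrt (<) l \<and> set l \<subseteq> {0..n}}"

definition simplex_dim :: "nat list \<Rightarrow> nat" where
  "simplex_dim l = length l - 1"

definition simplex_R :: "nat list \<Rightarrow> nat list set" where
  "simplex_R l = {k. k \<noteq> [] \<and> subseq k l}"

text \<open>Index \<open>j\<close> is position \<open>j + 1\<close>, so odd positions have even index.\<close>

definition simplex_bd :: "sign \<Rightarrow> nat list \<Rightarrow> nat list set" where
  "simplex_bd \<alpha> l =
     {take j l @ drop (Suc j) l | j. j < length l \<and> (case \<alpha> of Neg \<Rightarrow> even j | Pos \<Rightarrow> odd j)}"

definition is_simplices :: "(nat \<Rightarrow> nat list set omegacat) \<Rightarrow> bool" where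
  "is_simplices \<Delta> \<longleftrightarrow>
     (\<forall>n. face_omegacat (simplex_faces n) simplex_dim simplex_R simplex_bd (\<Delta> n))"

text \<open>
  The operations on faces below act on morphisms of $I^n$ and $\Delta^n$, which are sets of faces, by
  direct image.
\<close>

definition insert_letter :: "sign \<Rightarrow> nat \<Rightarrow> int list \<Rightarrow> int list" where
  "insert_letter \<alpha> j u = take j u @ letter \<alpha> # drop j u"

definition merge_letters :: "sign \<Rightarrow> nat \<Rightarrow> int list \<Rightarrow> int list" where
  "merge_letters \<alpha> j u =
     take j u @ (case \<alpha> of Neg \<Rightarrow> max (u ! j) (u ! Suc j) | Pos \<Rightarrow> min (u ! j) (u ! Suc j))
       # drop (Suc (Suc j)) u"

definition vertex_image :: "(nat \<Rightarrow> nat) \<Rightarrow> nat list \<Rightarrow> nat list" where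
  "vertex_image h l = sorted_list_of_set (h ` set l)"

definition coface :: "nat \<Rightarrow> nat \<Rightarrow> nat" where
  "coface i v = (if v < i then v else Suc v)"

definition codegeneracy :: "nat \<Rightarrow> nat \<Rightarrow> nat" where
  "codegeneracy i v = (if v \<le> i then v else v - 1)"

definition precompose :: "'f set omegacat \<Rightarrow> ('f \<Rightarrow> 'g) \<Rightarrow> ('g set \<Rightarrow> 'u) \<Rightarrow> ('f set \<Rightarrow> 'u)" where
  "precompose A \<phi> x = restrict (\<lambda>X. x (\<phi> ` X)) (mor A)"

definition postcompose :: "'a omegacat \<Rightarrow> ('u \<Rightarrow> 'v) \<Rightarrow> ('a \<Rightarrow> 'u) \<Rightarrow> ('a \<Rightarrow> 'v)" where
  "postcompose A f x = restrict (\<lambda>X. f (x X)) (mor A)"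


section \<open>Precubical sets\<close>

text \<open>\<open>pface K n i \<alpha>\<close> is $\partial_i^\alpha : K_{n+1} \to K_n$, for $1 \le i \le n+1$.\<close>

record 'k precubical =
  pcells :: "nat \<Rightarrow> 'k set"
  pface  :: "nat \<Rightarrow> nat \<Rightarrow> sign \<Rightarrow> 'k \<Rightarrow> 'k"

definition precubical_set :: "'k precubical \<Rightarrow> bool" where
  "precubical_set K \<longleftrightarrow>
     (\<forall>n \<alpha>. \<forall>i\<in>{1..n + 1}. \<forall>x\<in>pcells K (n + 1). pface K n i \<alpha> x \<in> pcells K n) \<and>
     (\<forall>n \<alpha> \<beta> i j. \<forall>x\<in>pcells K (n + 2). 1 \<le> i \<and> i < j \<and> j \<le> n + 2 \<longrightarrow>
        pface K n i \<alpha> (pface K (n + 1) j \<beta> x) = pface K n (j - 1) \<beta> (pface K (n + 1) i \<alpha> x))"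

text \<open>
  A family of \<open>\<omega>\<close>-functors \<open>\<kappa> n k : I n \<rightarrow> C\<close> for \<open>k\<close> in $K_n$ that is dinatural in the object \<open>n\<close>;
  it suffices to require this for the cofaces, which generate the category of cubes.
\<close>

definition cowedge ::
    "(nat \<Rightarrow> int list set omegacat) \<Rightarrow> 'k precubical \<Rightarrow> 'u omegacat \<Rightarrow>
     (nat \<Rightarrow> 'k \<Rightarrow> int list set \<Rightarrow> 'u) \<Rightarrow> bool" where
  "cowedge I K C \<kappa> \<longleftrightarrow> omega_category C \<and>
     (\<forall>n. \<forall>k\<in>pcells K n. omega_functor (I n) C (\<kappa> n k)) \<and>
     (\<forall>n \<alpha>. \<forall>k\<in>pcells K (n + 1). \<forall>i\<in>{1..n + 1}. \<forall>X\<in>mor (I n).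
        \<kappa> n (pface K n i \<alpha> k) X = \<kappa> (n + 1) k (insert_letter \<alpha> (i - 1) ` X))"

text \<open>
  \<open>C\<close> with the cowedge \<open>\<kappa>\<close> is the coend $F(K)$ in all \<open>\<omega>\<close>-categories.  For infinite \<open>'u\<close>, testing
  on \<open>'u\<close> only is no restriction, as for \<open>kan_completion\<close>.
\<close>

definition freely_generated ::
    "(nat \<Rightarrow> int list set omegacat) \<Rightarrow> 'u precubical \<Rightarrow> 'u omegacat \<Rightarrow>
     (nat \<Rightarrow> 'u \<Rightarrow> int list set \<Rightarrow> 'u) \<Rightarrow> bool" where
  "freely_generated I K C \<kappa> \<longleftrightarrow> cowedge I K C \<kappa> \<and>
     (\<forall>(E :: 'u omegacat) \<mu>. cowedge I K E \<mu> \<longrightarrow>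
        (\<exists>!g. g \<in> omega_hom C E \<and>
              (\<forall>n. \<forall>k\<in>pcells K n. \<forall>X\<in>mor (I n). g (\<kappa> n k X) = \<mu> n k X)))"


section \<open>Chain complexes\<close>

text \<open>\<open>bdy X n\<close> is the differential from degree \<open>n + 1\<close> to degree \<open>n\<close>.\<close>

record 'a complex_data =
  grp :: "nat \<Rightarrow> 'a monoid"
  bdy :: "nat \<Rightarrow> 'a \<Rightarrow> 'a"

definition chain_complex :: "'a complex_data \<Rightarrow> bool" where
  "chain_complex X \<longleftrightarrow>
     (\<forall>n. comm_group (grp X n)) \<and>
     (\<forall>n. bdy X n \<in> hom (grp X (Suc n)) (grp X n)) \<and>
     (\<forall>n. \<forall>x\<in>carrier (grp X (Suc (Suc n))). bdy X n (bdy X (Suc n) x) = \<one>\<^bsub>grp X n\<^esub>)"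

definition chain_map :: "'a complex_data \<Rightarrow> 'b complex_data \<Rightarrow> (nat \<Rightarrow> 'a \<Rightarrow> 'b) \<Rightarrow> bool" where
  "chain_map X Y f \<longleftrightarrow>
     (\<forall>n. f n \<in> hom (grp X n) (grp Y n)) \<and>
     (\<forall>n. \<forall>x\<in>carrier (grp X (Suc n)). f n (bdy X n x) = bdy Y n (f (Suc n) x))"

text \<open>
  The map on cosets induced by \<open>f\<close>: when \<open>f\<close> respects the subgroups, all the cosets in the union
  coincide.
\<close>

definition coset_map :: "'b monoid \<Rightarrow> 'b set \<Rightarrow> ('a \<Rightarrow> 'b) \<Rightarrow> 'a set \<Rightarrow> 'b set" where
  "coset_map G B f c = (\<Union>x\<in>c. B #>\<^bsub>G\<^esub> f x)"

fun cycles :: "'a complex_data \<Rightarrow> nat \<Rightarrow> 'a set" where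
  "cycles X 0 = carrier (grp X 0)"
| "cycles X (Suc n) = kernel (grp X (Suc n)) (grp X n) (bdy X n)"

definition boundaries :: "'a complex_data \<Rightarrow> nat \<Rightarrow> 'a set" where
  "boundaries X n = bdy X n ` carrier (grp X (Suc n))"

definition homology :: "'a complex_data \<Rightarrow> nat \<Rightarrow> 'a set monoid" where
  "homology X n = (grp X n)\<lparr>carrier := cycles X n\<rparr> Mod boundaries X n"

definition quasi_iso :: "'a complex_data \<Rightarrow> 'b complex_data \<Rightarrow> (nat \<Rightarrow> 'a \<Rightarrow> 'b) \<Rightarrow> bool" where
  "quasi_iso X Y f \<longleftrightarrow> chain_complex X \<and> chain_complex Y \<and> chain_map X Y f \<and>
     (\<forall>n. coset_map (grp Y n) (boundaries Y n) (f n) \<in> iso (homology X n) (homology Y n))"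

definition quotient_complex :: "'a complex_data \<Rightarrow> (nat \<Rightarrow> 'a set) \<Rightarrow> 'a set complex_data" where
  "quotient_complex X B =
     \<lparr> grp = (\<lambda>n. grp X n Mod B n),
       bdy = (\<lambda>n. coset_map (grp X n) (B n) (bdy X n)) \<rparr>"

definition quotient_proj :: "'a complex_data \<Rightarrow> (nat \<Rightarrow> 'a set) \<Rightarrow> nat \<Rightarrow> 'a \<Rightarrow> 'a set" where
  "quotient_proj X B n x = B n #>\<^bsub>grp X n\<^esub> x"


section \<open>Nerves\<close>

text \<open>
  \<open>face N n i : N (n+1) \<rightarrow> N n\<close>, \<open>degen N n i : N n \<rightarrow> N (n+1)\<close>; \<open>aug_face N\<close> is $\partial_{-1}$ and
  \<open>aug_simplices N\<close> the set of $(-1)$-simplices.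
\<close>

record ('s, 'o, 'u) nerve =
  simplices     :: "nat \<Rightarrow> 's set"
  aug_simplices :: "'o set"
  face          :: "nat \<Rightarrow> nat \<Rightarrow> 's \<Rightarrow> 's"
  degen         :: "nat \<Rightarrow> nat \<Rightarrow> 's \<Rightarrow> 's"
  aug_face      :: "'s \<Rightarrow> 'o"
  ev            :: "nat \<Rightarrow> 's \<Rightarrow> 'u"

text \<open>The \<open>0\<close>-simplex \<open>x\<close> is identified with the \<open>1\<close>-morphism \<open>ev x\<close> in \<open>aug_face\<close>.\<close>

definition gl_ev :: "nat \<Rightarrow> (nat list set \<Rightarrow> 'u) \<Rightarrow> 'u" where
  "gl_ev n x = x (simplex_R [0..<Suc n])"

definition gl_nerve ::
    "(nat \<Rightarrow> nat list set omegacat) \<Rightarrow> 'u omegacat \<Rightarrow> (nat list set \<Rightarrow> 'u, 'u \<times> 'u, 'u) nerve" where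
  "gl_nerve \<Delta> C =
     \<lparr> simplices = (\<lambda>n. omega_hom (\<Delta> n) (path C)),
       aug_simplices = mor_dim 0 C \<times> mor_dim 0 C,
       face = (\<lambda>n i. precompose (\<Delta> n) (vertex_image (coface i))),
       degen = (\<lambda>n i. precompose (\<Delta> (n + 1)) (vertex_image (codegeneracy i))),
       aug_face = (\<lambda>x. (dd C Neg 0 (gl_ev 0 x), dd C Pos 0 (gl_ev 0 x))),
       ev = gl_ev \<rparr>"

definition gl_nerve_map ::
    "(nat \<Rightarrow> nat list set omegacat) \<Rightarrow> ('u \<Rightarrow> 'v) \<Rightarrow> nat \<Rightarrow> (nat list set \<Rightarrow> 'u) \<Rightarrow> (nat list set \<Rightarrow> 'v)" where
  "gl_nerve_map \<Delta> f n = postcompose (\<Delta> n) f"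

text \<open>The branching (\<open>Neg\<close>) and merging (\<open>Pos\<close>) semi-cubical nerves.\<close>

definition sc_ev :: "nat \<Rightarrow> (int list set \<Rightarrow> 'u) \<Rightarrow> 'u" where
  "sc_ev n x = x (cube_R (replicate (Suc n) 0))"

definition sc_nerve ::
    "(nat \<Rightarrow> int list set omegacat) \<Rightarrow> sign \<Rightarrow> 'u omegacat \<Rightarrow> (int list set \<Rightarrow> 'u, 'u, 'u) nerve" where
  "sc_nerve I \<alpha> C =
     \<lparr> simplices = (\<lambda>n. {x \<in> omega_hom (I (n + 1)) C.
          \<forall>u\<in>mor (I (n + 1)).
             mdim (I (n + 1)) u = 1 \<and>
             dd (I (n + 1)) \<alpha> 0 u = cube_R (replicate (n + 1) (letter \<alpha>)) \<longrightarrow>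
             mdim C (x u) = 1}),
       aug_simplices = mor_dim 0 C,
       face = (\<lambda>n i. precompose (I (n + 1)) (insert_letter \<alpha> i)),
       degen = (\<lambda>n i. precompose (I (n + 2)) (merge_letters \<alpha> i)),
       aug_face = (\<lambda>x. dd C \<alpha> 0 (sc_ev 0 x)),
       ev = sc_ev \<rparr>"

definition sc_nerve_map ::
    "(nat \<Rightarrow> int list set omegacat) \<Rightarrow> ('u \<Rightarrow> 'v) \<Rightarrow> nat \<Rightarrow> (int list set \<Rightarrow> 'u) \<Rightarrow> (int list set \<Rightarrow> 'v)" where
  "sc_nerve_map I f n = postcompose (I (n + 1)) f"


section \<open>The complexes of a nerve\<close>

text \<open>Degree \<open>n\<close> of a complex is generated by the \<open>(n-1)\<close>-simplices, with \<open>Aug\<close> in degree \<open>0\<close>.\<close>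

datatype ('s, 'o) gen = Aug 'o | Cell 's

fun nerve_gens :: "('s, 'o, 'u) nerve \<Rightarrow> nat \<Rightarrow> ('s, 'o) gen set" where
  "nerve_gens N 0 = Aug ` aug_simplices N"
| "nerve_gens N (Suc n) = Cell ` simplices N n"

fun nerve_bdy :: "('s, 'o, 'u) nerve \<Rightarrow> nat \<Rightarrow> ('s, 'o) gen \<Rightarrow> (('s, 'o) gen \<Rightarrow>\<^sub>0 int)" where
  "nerve_bdy N 0 (Cell x) = frag_of (Aug (aug_face N x))"
| "nerve_bdy N (Suc n) (Cell x) =
     (\<Sum>i\<le>Suc n. frag_cmul ((-1) ^ i) (frag_of (Cell (face N n i x))))"
| "nerve_bdy N _ (Aug _) = 0"

definition nerve_complex :: "('s, 'o, 'u) nerve \<Rightarrow> (('s, 'o) gen \<Rightarrow>\<^sub>0 int) complex_data" where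
  "nerve_complex N =
     \<lparr> grp = (\<lambda>n. free_Abelian_group (nerve_gens N n)),
       bdy = (\<lambda>n. frag_extend (nerve_bdy N n)) \<rparr>"

text \<open>\<open>thin C N n\<close> is $M_n$; a thin generator of degree \<open>n + 2\<close> is an \<open>(n+1)\<close>-simplex.\<close>

fun thin_gens :: "'u omegacat \<Rightarrow> ('s, 'o, 'u) nerve \<Rightarrow> nat \<Rightarrow> ('s, 'o) gen set" where
  "thin_gens C N (Suc (Suc n)) = Cell ` {x \<in> simplices N (n + 1). ev N (n + 1) x \<in> tr n (path C)}"
| "thin_gens C N _ = {}"

definition thin :: "'u omegacat \<Rightarrow> ('s, 'o, 'u) nerve \<Rightarrow> nat \<Rightarrow> (('s, 'o) gen \<Rightarrow>\<^sub>0 int) set" where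
  "thin C N n = carrier (free_Abelian_group (thin_gens C N n))"

definition reduced_rel :: "'u omegacat \<Rightarrow> ('s, 'o, 'u) nerve \<Rightarrow> nat \<Rightarrow> (('s, 'o) gen \<Rightarrow>\<^sub>0 int) set" where
  "reduced_rel C N n =
     thin C N n <#>\<^bsub>grp (nerve_complex N) n\<^esub> (bdy (nerve_complex N) n ` thin C N (Suc n))"

definition reduced_complex ::
    "'u omegacat \<Rightarrow> ('s, 'o, 'u) nerve \<Rightarrow> (('s, 'o) gen \<Rightarrow>\<^sub>0 int) set complex_data" where
  "reduced_complex C N = quotient_complex (nerve_complex N) (reduced_rel C N)"

definition reduction ::
    "'u omegacat \<Rightarrow> ('s, 'o, 'u) nerve \<Rightarrow> nat \<Rightarrow> (('s, 'o) gen \<Rightarrow>\<^sub>0 int) \<Rightarrow> (('s, 'o) gen \<Rightarrow>\<^sub>0 int) set" where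
  "reduction C N = quotient_proj (nerve_complex N) (reduced_rel C N)"

definition C_gl where "C_gl \<Delta> C = nerve_complex (gl_nerve \<Delta> C)"
definition CR_gl where "CR_gl \<Delta> C = reduced_complex C (gl_nerve \<Delta> C)"
definition C_sc where "C_sc I \<alpha> C = nerve_complex (sc_nerve I \<alpha> C)"
definition CR_sc where "CR_sc I \<alpha> C = reduced_complex C (sc_nerve I \<alpha> C)"

definition red_gl where "red_gl \<Delta> C = reduction C (gl_nerve \<Delta> C)"
definition red_sc where "red_sc I \<alpha> C = reduction C (sc_nerve I \<alpha> C)"

text \<open>The chain maps induced by an \<open>\<omega>\<close>-functor; degree \<open>n\<close> consists of \<open>(n-1)\<close>-simplices.\<close>

definition C_gl_map ::
    "(nat \<Rightarrow> nat list set omegacat) \<Rightarrow> ('u \<Rightarrow> 'v) \<Rightarrow> nat \<Rightarrow>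
     ((nat list set \<Rightarrow> 'u, 'u \<times> 'u) gen \<Rightarrow>\<^sub>0 int) \<Rightarrow> ((nat list set \<Rightarrow> 'v, 'v \<times> 'v) gen \<Rightarrow>\<^sub>0 int)" where
  "C_gl_map \<Delta> f n =
     frag_extend (\<lambda>g. frag_of (case g of Aug (a, b) \<Rightarrow> Aug (f a, f b)
                                       | Cell x \<Rightarrow> Cell (gl_nerve_map \<Delta> f (n - 1) x)))"

definition C_sc_map ::
    "(nat \<Rightarrow> int list set omegacat) \<Rightarrow> ('u \<Rightarrow> 'v) \<Rightarrow> nat \<Rightarrow>
     ((int list set \<Rightarrow> 'u, 'u) gen \<Rightarrow>\<^sub>0 int) \<Rightarrow> ((int list set \<Rightarrow> 'v, 'v) gen \<Rightarrow>\<^sub>0 int)" where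
  "C_sc_map I f n =
     frag_extend (\<lambda>g. frag_of (case g of Aug a \<Rightarrow> Aug (f a)
                                       | Cell x \<Rightarrow> Cell (sc_nerve_map I f (n - 1) x)))"


section \<open>Formal complexes\<close>

text \<open>The class of \<open>x\<close> in $\mathbb{Z}C_n$ modulo the morphisms of dimension less than \<open>n\<close>.\<close>

definition cls :: "'u omegacat \<Rightarrow> nat \<Rightarrow> 'u \<Rightarrow> (('u, 'o) gen \<Rightarrow>\<^sub>0 int)" where
  "cls C n x = (if mdim C x = n then frag_of (Cell x) else 0)"

fun formal_gens :: "'u omegacat \<Rightarrow> 'o set \<Rightarrow> nat \<Rightarrow> ('u, 'o) gen set" where
  "formal_gens C Ob 0 = Aug ` Ob"
| "formal_gens C Ob (Suc n) = Cell ` mor_dim (Suc n) C"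

fun formal_bdy :: "'u omegacat \<Rightarrow> ('u \<Rightarrow> 'o) \<Rightarrow> nat \<Rightarrow> ('u, 'o) gen \<Rightarrow> (('u, 'o) gen \<Rightarrow>\<^sub>0 int)" where
  "formal_bdy C a 0 (Cell x) = frag_of (Aug (a x))"
| "formal_bdy C a (Suc n) (Cell x) =
     cls C (Suc n) (dd C Neg (Suc n) x) - cls C (Suc n) (dd C Pos (Suc n) x)"
| "formal_bdy C a _ (Aug _) = 0"

definition formal_free ::
    "'u omegacat \<Rightarrow> 'o set \<Rightarrow> ('u \<Rightarrow> 'o) \<Rightarrow> (('u, 'o) gen \<Rightarrow>\<^sub>0 int) complex_data" where
  "formal_free C Ob a =
     \<lparr> grp = (\<lambda>n. free_Abelian_group (formal_gens C Ob n)),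
       bdy = (\<lambda>n. frag_extend (formal_bdy C a n)) \<rparr>"

text \<open>
  The factors \<open>x\<close>, \<open>y\<close> of a relation in degree \<open>n\<close> range over the morphisms of dimension between
  \<open>1\<close> and \<open>n\<close> (the domain of the folding operator of degree \<open>n\<close>); factors of dimension less than \<open>n\<close>
  count as \<open>0\<close>.  Factors of dimension \<open>0\<close> must be left out: \<open>x *\<^sub>0 y = x\<close> with
  \<open>x = s\<^sub>0 y\<close> would kill every \<open>y\<close>.
\<close>

definition formal_rel_gl :: "'u omegacat \<Rightarrow> nat \<Rightarrow> (('u, 'o) gen \<Rightarrow>\<^sub>0 int) set" where
  "formal_rel_gl C n = (if n < 2 then {} else
     {cls C n (cmp C p x y) - (cls C n x + cls C n y) | p x y.
        1 \<le> p \<and> p \<le> n - 1 \<and> x \<in> tr (n - 1) (path C) \<and> y \<in> tr (n - 1) (path C) \<and>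
        composable C p x y})"

text \<open>
  In degree \<open>1\<close> the relation \<open>x *\<^sub>0 y = x\<close> (resp. \<open>= y\<close>) is imposed between \<open>1\<close>-morphisms \<open>x\<close>, \<open>y\<close>
  and \<open>x *\<^sub>0 y\<close>.  Without it the differential from degree \<open>2\<close> to degree \<open>1\<close> is not well defined on
  the quotient: \<open>x\<close> and \<open>x *\<^sub>0 y\<close> have boundaries \<open>s\<^sub>1 x - t\<^sub>1 x\<close> and
  \<open>s\<^sub>1 x *\<^sub>0 s\<^sub>1 y - t\<^sub>1 x *\<^sub>0 t\<^sub>1 y\<close>.
\<close>

definition formal_rel_sc :: "sign \<Rightarrow> 'u omegacat \<Rightarrow> nat \<Rightarrow> (('u, 'o) gen \<Rightarrow>\<^sub>0 int) set" where
  "formal_rel_sc \<alpha> C n =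
     (if n = 0 then {}
      else if n = 1 then
        {frag_of (Cell (cmp C 0 x y)) - frag_of (Cell (case \<alpha> of Neg \<Rightarrow> x | Pos \<Rightarrow> y)) | x y.
           composable C 0 x y \<and> x \<in> mor_dim 1 C \<and> y \<in> mor_dim 1 C \<and> cmp C 0 x y \<in> mor_dim 1 C}
      else formal_rel_gl C n \<union>
        {cls C n (cmp C 0 x y) - cls C n (case \<alpha> of Neg \<Rightarrow> x | Pos \<Rightarrow> y) | x y.
           x \<in> tr (n - 1) (path C) \<and> y \<in> tr (n - 1) (path C) \<and> composable C 0 x y})"

definition formal_complex ::
    "'u omegacat \<Rightarrow> 'o set \<Rightarrow> ('u \<Rightarrow> 'o) \<Rightarrow> (nat \<Rightarrow> (('u, 'o) gen \<Rightarrow>\<^sub>0 int) set) \<Rightarrow>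
     (('u, 'o) gen \<Rightarrow>\<^sub>0 int) set complex_data" where
  "formal_complex C Ob a rel =
     quotient_complex (formal_free C Ob a)
       (\<lambda>n. generate (grp (formal_free C Ob a) n) (rel n))"

text \<open>$\mathbb{Z}C_0 \otimes \mathbb{Z}C_0$ is rendered as the free abelian group on $C_0 \times C_0$.\<close>

definition CF_gl :: "'u omegacat \<Rightarrow> (('u, 'u \<times> 'u) gen \<Rightarrow>\<^sub>0 int) set complex_data" where
  "CF_gl C = formal_complex C (mor_dim 0 C \<times> mor_dim 0 C)
     (\<lambda>x. (dd C Neg 0 x, dd C Pos 0 x)) (formal_rel_gl C)"

definition CF_sc :: "sign \<Rightarrow> 'u omegacat \<Rightarrow> (('u, 'u) gen \<Rightarrow>\<^sub>0 int) set complex_data" where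
  "CF_sc \<alpha> C = formal_complex C (mor_dim 0 C) (dd C \<alpha> 0) (formal_rel_sc \<alpha> C)"


section \<open>Folding operators\<close>

text \<open>
  \<open>box C (n+1)\<close> maps \<open>tr n (path C)\<close> to the \<open>n\<close>-simplices of the nerve, naturally in \<open>C\<close>.  In degree \<open>1\<close>
  the condition on \<open>ev\<close> says that \<open>box C 1\<close> is the identification of $tr^0\mathbb{P}C$ with the
  \<open>0\<close>-simplices.
\<close>

definition folding_operators ::
    "('u omegacat \<Rightarrow> ('s, 'o, 'u) nerve) \<Rightarrow> (('u \<Rightarrow> 'u) \<Rightarrow> nat \<Rightarrow> 's \<Rightarrow> 's) \<Rightarrow>
     ('u omegacat \<Rightarrow> nat \<Rightarrow> 'u \<Rightarrow> 's) \<Rightarrow> bool" where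
  "folding_operators N Nmap box \<longleftrightarrow>
     (\<forall>C n. non_contracting C \<longrightarrow> (\<forall>x\<in>tr n (path C).
        box C (n + 1) x \<in> simplices (N C) n \<and>
        ev (N C) n (box C (n + 1) x) = x \<and>
        box C (n + 2) x = degen (N C) n n (box C (n + 1) x))) \<and>
     (\<forall>C D f n. non_contracting C \<and> non_contracting D \<and> non_contracting_functor C D f \<longrightarrow>
        (\<forall>x\<in>tr n (path C). box D (n + 1) (f x) = Nmap f n (box C (n + 1) x)))"

definition fold_gen ::
    "(nat \<Rightarrow> 'u \<Rightarrow> 's) \<Rightarrow> nat \<Rightarrow> (('u, 'o) gen \<Rightarrow>\<^sub>0 int) \<Rightarrow> (('s, 'o) gen \<Rightarrow>\<^sub>0 int)" where
  "fold_gen b n =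
     frag_extend (\<lambda>g. frag_of (case g of Aug a \<Rightarrow> Aug a | Cell x \<Rightarrow> Cell (b n x)))"

definition fold_map ::
    "'u omegacat \<Rightarrow> ('s, 'o, 'u) nerve \<Rightarrow> (nat \<Rightarrow> 'u \<Rightarrow> 's) \<Rightarrow> nat \<Rightarrow>
     (('u, 'o) gen \<Rightarrow>\<^sub>0 int) set \<Rightarrow> (('s, 'o) gen \<Rightarrow>\<^sub>0 int) set" where
  "fold_map C N b n =
     coset_map (grp (nerve_complex N) n) (reduced_rel C N n) (fold_gen b n)"

definition fold_gl where "fold_gl \<Delta> box C = fold_map C (gl_nerve \<Delta> C) (box C)"
definition fold_sc where "fold_sc I \<alpha> box C = fold_map C (sc_nerve I \<alpha> C) (box C)"

end

theory Submission
  imports Defs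
begin

text \<open>
  The reductions and the folding operators give natural squares which connect the nerve complex of an
  \<open>\<omega>\<close>-category with its formal complex through the reduced complex.  The hypotheses say that the
  connecting maps for $F(K)$ and for its completion are isomorphisms in homology.  By two out of three
  (\<open>quasi_iso_cancel_left\<close>, \<open>quasi_iso_cancel_right\<close>) it suffices that the unit \<open>\<eta>\<close> induces an
  isomorphism in homology of formal complexes.  In fact it induces an isomorphism of complexes, for
  every non-contracting \<open>\<omega>\<close>-category \<open>C\<close> with completion \<open>H\<close> (\<open>lin_inj\<close>, \<open>lin_onto\<close>).

  The completion inverts cells of dimension at least 2 and does not change cells of dimension at most 1
  (\<open>unit_bij\<close>), which settles degrees 0 and 1.  In degree \<open>n \<ge> 2\<close> the relation $x *_p y = x + y$ already
  provides inverses: the class of an inverse has to be the opposite class.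

  For surjectivity, \<open>H\<close> is generated by the image of \<open>C\<close> under compositions and inverses
  (\<open>kan_completion_generated\<close>), and the class of a generated cell can be computed from the classes of
  its constituents (\<open>unit_cls_surj\<close>).  A horizontal composite $x *_0 y$ is first rewritten as a vertical
  composite of \<open>x\<close> and \<open>y\<close> whiskered by edges (\<open>cmp0_slide\<close>), and edges act additively on classes.

  For injectivity, one needs a functor on \<open>H\<close> that sees the classes of cells of \<open>C\<close>.  By the universal
  property it is enough to give an \<open>\<omega>\<close>-category whose path \<open>\<omega>\<close>-category is a groupoid, together with a
  functor from \<open>C\<close>.  This is the linear model: its cells are pairs of parallel edges of \<open>C\<close> with two classes
  of degree \<open>n\<close>, and a cell \<open>x\<close> is sent to $(s_1 x, t_1 x, [s_n x], [t_n x])$ (\<open>kan_model\<close>,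
  \<open>classify_functor\<close>).  The resulting functor on \<open>H\<close> yields a left inverse of the unit on classes
  (\<open>unit_retraction\<close>).  It also respects the relations $x *_0 y = x$ and $x *_0 y = y$ of the branching and
  merging theories, because these only say how edges act (\<open>act_sc\<close>).

  On the way, the nerve complexes have to be natural, which amounts to the functoriality of the cofaces
  of cubes and simplices (\<open>face_map\<close>).
\<close>


section \<open>Quotients and isomorphisms in homology\<close>

lemma coset_map_rcos:
  assumes "group G" "group G'" "subgroup B G" "subgroup B' G'"
    and f: "f \<in> hom G G'" and fB: "f ` B \<subseteq> B'" and x: "x \<in> carrier G"
  shows "coset_map G' B' f (B #>\<^bsub>G\<^esub> x) = B' #>\<^bsub>G'\<^esub> f x"
proof -
  interpret G: group G by fact
  interpret G': group G' by fact
  interpret B: subgroup B G by fact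
  interpret B': subgroup B' G' by fact
  have *: "B' #>\<^bsub>G'\<^esub> f y = B' #>\<^bsub>G'\<^esub> f x" if y: "y \<in> B #>\<^bsub>G\<^esub> x" for y
  proof -
    obtain b where b: "b \<in> B" "y = b \<otimes>\<^bsub>G\<^esub> x" using y by (auto simp: r_coset_def)
    have "f y = f b \<otimes>\<^bsub>G'\<^esub> f x" using b x f by (auto simp: hom_mult)
    then have "f y \<in> B' #>\<^bsub>G'\<^esub> f x" using fB b by (auto simp: r_coset_def)
    then show ?thesis
      using G'.repr_independence[OF _ _ B'.subgroup_axioms] hom_in_carrier[OF f x] by metis
  qed
  show ?thesis
  proof -
    have "(\<Union>y\<in>B #>\<^bsub>G\<^esub> x. B' #>\<^bsub>G'\<^esub> f y) = (\<Union>y\<in>B #>\<^bsub>G\<^esub> x. B' #>\<^bsub>G'\<^esub> f x)"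
      using * by (rule SUP_cong[OF refl])
    then show ?thesis
      using G.rcos_self[OF x B.subgroup_axioms] unfolding coset_map_def by (simp add: ex_in_conv[symmetric]) blast
  qed
qed

lemma rcos_eq_iff:
  assumes "group G" "subgroup B G" "x \<in> carrier G" "y \<in> carrier G"
  shows "B #>\<^bsub>G\<^esub> x = B #>\<^bsub>G\<^esub> y \<longleftrightarrow> (\<exists>b\<in>B. x = b \<otimes>\<^bsub>G\<^esub> y)"
proof -
  interpret G: group G by fact
  have mem: "x \<in> B #>\<^bsub>G\<^esub> y \<longleftrightarrow> (\<exists>b\<in>B. x = b \<otimes>\<^bsub>G\<^esub> y)"
    by (auto simp: r_coset_def)
  show ?thesis
    using G.repr_independence[OF _ assms(4,2), of x] G.rcos_self[OF assms(3,2)] mem by auto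
qed

lemma rcos_eq_subgroup_iff:
  assumes "group G" "subgroup B G" "x \<in> carrier G"
  shows "B #>\<^bsub>G\<^esub> x = B \<longleftrightarrow> x \<in> B"
  using assms group.coset_join1 group.coset_join2 by metis

lemma coset_map_hom:
  assumes "comm_group G" "comm_group G'" "subgroup B G" "subgroup B' G'"
    and f: "f \<in> hom G G'" and fB: "f ` B \<subseteq> B'"
  shows "coset_map G' B' f \<in> hom (G Mod B) (G' Mod B')"
proof -
  interpret G: comm_group G by fact
  interpret G': comm_group G' by fact
  interpret B: normal B G by (rule G.subgroup_imp_normal) fact
  interpret B': normal B' G' by (rule G'.subgroup_imp_normal) fact
  note cm = coset_map_rcos[OF G.group_axioms G'.group_axioms assms(3,4) f fB]
  show ?thesis
    using f by (auto simp: hom_def FactGroup_def RCOSETS_def cm B.rcos_sum B'.rcos_sum Pi_def)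
qed

text \<open>
  Bijectivity on cosets is a statement about representatives: this is what lets all later arguments
  stay with elements and never handle cosets of cosets.
\<close>

lemma coset_map_iso_iff:
  assumes "comm_group G" "comm_group G'" "subgroup B G" "subgroup B' G'"
    and f: "f \<in> hom G G'" and fB: "f ` B \<subseteq> B'"
  shows "coset_map G' B' f \<in> iso (G Mod B) (G' Mod B') \<longleftrightarrow>
    (\<forall>x\<in>carrier G. f x \<in> B' \<longrightarrow> x \<in> B) \<and>
    (\<forall>y\<in>carrier G'. \<exists>x\<in>carrier G. \<exists>b\<in>B'. y = b \<otimes>\<^bsub>G'\<^esub> f x)"
proof -
  interpret G: comm_group G by fact
  interpret G': comm_group G' by fact
  interpret B: normal B G by (rule G.subgroup_imp_normal) fact
  interpret B': normal B' G' by (rule G'.subgroup_imp_normal) fact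
  let ?h = "coset_map G' B' f"
  note cm = coset_map_rcos[OF G.group_axioms G'.group_axioms assms(3,4) f fB]
  have hom: "?h \<in> hom (G Mod B) (G' Mod B')" by (rule coset_map_hom) fact+
  then interpret h: group_hom "G Mod B" "G' Mod B'" ?h
    by (simp add: group_hom_def group_hom_axioms_def B.factorgroup_is_group B'.factorgroup_is_group)
  have car: "carrier (G Mod B) = (\<lambda>x. B #>\<^bsub>G\<^esub> x) ` carrier G"
      "carrier (G' Mod B') = (\<lambda>x. B' #>\<^bsub>G'\<^esub> x) ` carrier G'"
    by (auto simp: FactGroup_def RCOSETS_def)
  have fc: "x \<in> carrier G \<Longrightarrow> f x \<in> carrier G'" for x using f by (rule hom_in_carrier)
  have inj: "inj_on ?h (carrier (G Mod B)) \<longleftrightarrow> (\<forall>x\<in>carrier G. f x \<in> B' \<longrightarrow> x \<in> B)"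
  proof -
    have "inj_on ?h (carrier (G Mod B)) \<longleftrightarrow>
        (\<forall>x\<in>carrier G. ?h (B #>\<^bsub>G\<^esub> x) = B' \<longrightarrow> B #>\<^bsub>G\<^esub> x = B)"
      unfolding h.inj_on_one_iff by (auto simp: FactGroup_def RCOSETS_def)
    then show ?thesis
      using fc by (simp add: cm rcos_eq_subgroup_iff B.subgroup_axioms B'.subgroup_axioms)
  qed
  have "?h ` carrier (G Mod B) = carrier (G' Mod B') \<longleftrightarrow>
      (\<forall>y\<in>carrier G'. \<exists>x\<in>carrier G. B' #>\<^bsub>G'\<^esub> y = B' #>\<^bsub>G'\<^esub> f x)"
  proof -
    have "?h ` carrier (G Mod B) = (\<lambda>x. B' #>\<^bsub>G'\<^esub> f x) ` carrier G"
      unfolding car image_image by (rule image_cong) (simp_all add: cm)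
    moreover have "(\<lambda>x. B' #>\<^bsub>G'\<^esub> f x) ` carrier G \<subseteq> carrier (G' Mod B')"
      unfolding car using fc by blast
    ultimately have "?h ` carrier (G Mod B) = carrier (G' Mod B') \<longleftrightarrow>
        (\<lambda>x. B' #>\<^bsub>G'\<^esub> x) ` carrier G' \<subseteq> (\<lambda>x. B' #>\<^bsub>G'\<^esub> f x) ` carrier G"
      using car(2) by auto
    then show ?thesis by (simp only: image_subset_iff) (auto simp: image_iff)
  qed
  also have "\<dots> \<longleftrightarrow> (\<forall>y\<in>carrier G'. \<exists>x\<in>carrier G. \<exists>b\<in>B'. y = b \<otimes>\<^bsub>G'\<^esub> f x)"
    using fc by (simp add: rcos_eq_iff B'.subgroup_axioms)
  finally have surj: "?h ` carrier (G Mod B) = carrier (G' Mod B') \<longleftrightarrow>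
      (\<forall>y\<in>carrier G'. \<exists>x\<in>carrier G. \<exists>b\<in>B'. y = b \<otimes>\<^bsub>G'\<^esub> f x)" .
  show ?thesis
    unfolding iso_def bij_betw_def using hom inj surj by auto
qed

lemma chain_complexD:
  assumes "chain_complex X"
  shows "comm_group (grp X n)" "group (grp X n)" "bdy X n \<in> hom (grp X (Suc n)) (grp X n)"
    "x \<in> carrier (grp X (Suc (Suc n))) \<Longrightarrow> bdy X n (bdy X (Suc n) x) = \<one>\<^bsub>grp X n\<^esub>"
  using assms by (auto simp: chain_complex_def comm_group_def)

lemma chain_mapD:
  assumes "chain_map X Y f"
  shows "f n \<in> hom (grp X n) (grp Y n)"
    "x \<in> carrier (grp X n) \<Longrightarrow> f n x \<in> carrier (grp Y n)"
    "x \<in> carrier (grp X (Suc n)) \<Longrightarrow> f n (bdy X n x) = bdy Y n (f (Suc n) x)"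
  using assms by (auto simp: chain_map_def intro: hom_in_carrier)

lemma comm_group_subgroup:
  assumes "comm_group G" "subgroup H G" shows "comm_group (G\<lparr>carrier := H\<rparr>)"
proof -
  interpret G: comm_group G by fact
  interpret H: subgroup H G by fact
  interpret K: group "G\<lparr>carrier := H\<rparr>" by (rule G.subgroup_imp_group) fact
  show ?thesis by (rule K.group_comm_groupI) (simp add: G.m_comm)
qed

lemma cycles_subgroup:
  assumes "chain_complex X" shows "subgroup (cycles X n) (grp X n)"
proof (cases n)
  case 0
  then show ?thesis using chain_complexD[OF assms] by (simp add: group.subgroup_self)
next
  case (Suc m)
  interpret h: group_hom "grp X (Suc m)" "grp X m" "bdy X m"
    using chain_complexD[OF assms] by (simp add: group_hom_def group_hom_axioms_def)
  show ?thesis using h.subgroup_kernel by (simp add: Suc)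
qed

lemma cycles_carrier: "chain_complex X \<Longrightarrow> x \<in> cycles X n \<Longrightarrow> x \<in> carrier (grp X n)"
  by (rule subgroup.mem_carrier[OF cycles_subgroup])

lemma boundaries_subgroup:
  assumes "chain_complex X" shows "subgroup (boundaries X n) (grp X n)"
proof -
  interpret h: group_hom "grp X (Suc n)" "grp X n" "bdy X n"
    using chain_complexD[OF assms] by (simp add: group_hom_def group_hom_axioms_def)
  show ?thesis unfolding boundaries_def using h.img_is_subgroup .
qed

lemma boundaries_subset_cycles:
  assumes "chain_complex X" shows "boundaries X n \<subseteq> cycles X n"
  using chain_complexD[OF assms]
  by (cases n) (auto simp: boundaries_def kernel_def intro: hom_in_carrier)

lemma cycles_group:
  assumes "chain_complex X"
  shows "comm_group ((grp X n)\<lparr>carrier := cycles X n\<rparr>)"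
    "subgroup (boundaries X n) ((grp X n)\<lparr>carrier := cycles X n\<rparr>)"
  using comm_group_subgroup[OF chain_complexD(1)[OF assms] cycles_subgroup[OF assms]]
    group.subgroup_incl[OF chain_complexD(2)[OF assms] boundaries_subgroup[OF assms]
      cycles_subgroup[OF assms] boundaries_subset_cycles[OF assms]]
  by auto

lemma chain_map_cycles:
  assumes "chain_complex X" "chain_complex Y" "chain_map X Y f" "x \<in> cycles X n"
  shows "f n x \<in> cycles Y n"
proof (cases n)
  case 0
  then show ?thesis using assms chain_mapD(2)[OF assms(3)] by auto
next
  case (Suc m)
  interpret h: group_hom "grp X m" "grp Y m" "f m"
    using chain_complexD[OF assms(1)] chain_complexD[OF assms(2)] chain_mapD[OF assms(3)]
    by (simp add: group_hom_def group_hom_axioms_def)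
  have x: "x \<in> carrier (grp X (Suc m))" "bdy X m x = \<one>\<^bsub>grp X m\<^esub>"
    using assms(4) by (auto simp: Suc kernel_def)
  then have "bdy Y m (f (Suc m) x) = \<one>\<^bsub>grp Y m\<^esub>"
    using chain_mapD(3)[OF assms(3) x(1)] h.hom_one by simp
  then show ?thesis using x chain_mapD(2)[OF assms(3) x(1)] by (simp add: Suc kernel_def)
qed

lemma chain_map_boundaries:
  assumes "chain_complex X" "chain_map X Y f" "x \<in> boundaries X n"
  shows "f n x \<in> boundaries Y n"
  using assms chain_mapD(2,3)[OF assms(2)] by (auto simp: boundaries_def)

text \<open>
  Isomorphisms in homology without cosets: in this form composition and cancellation are diagram
  chases with cycles and boundaries.
\<close>

lemma quasi_iso_iff:
  "quasi_iso X Y f \<longleftrightarrow> chain_complex X \<and> chain_complex Y \<and> chain_map X Y f \<and>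
     (\<forall>n. \<forall>x\<in>cycles X n. f n x \<in> boundaries Y n \<longrightarrow> x \<in> boundaries X n) \<and>
     (\<forall>n. \<forall>y\<in>cycles Y n. \<exists>x\<in>cycles X n. \<exists>b\<in>boundaries Y n. y = b \<otimes>\<^bsub>grp Y n\<^esub> f n x)"
proof -
  have "coset_map (grp Y n) (boundaries Y n) (f n) \<in> iso (homology X n) (homology Y n) \<longleftrightarrow>
     (\<forall>x\<in>cycles X n. f n x \<in> boundaries Y n \<longrightarrow> x \<in> boundaries X n) \<and>
     (\<forall>y\<in>cycles Y n. \<exists>x\<in>cycles X n. \<exists>b\<in>boundaries Y n. y = b \<otimes>\<^bsub>grp Y n\<^esub> f n x)"
    if *: "chain_complex X" "chain_complex Y" "chain_map X Y f" for n
  proof -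
    let ?Z = "(grp X n)\<lparr>carrier := cycles X n\<rparr>" and ?Z' = "(grp Y n)\<lparr>carrier := cycles Y n\<rparr>"
    have "f n \<in> hom ?Z ?Z'"
      using chain_mapD(1)[OF *(3)] chain_map_cycles[OF *] cycles_carrier[OF *(1)]
      by (auto simp: hom_def Pi_def)
    moreover have "f n ` boundaries X n \<subseteq> boundaries Y n"
      using chain_map_boundaries[OF *(1,3)] by blast
    moreover have "coset_map ?Z' (boundaries Y n) (f n) = coset_map (grp Y n) (boundaries Y n) (f n)"
      by (simp add: coset_map_def r_coset_def fun_eq_iff)
    ultimately show ?thesis
      using coset_map_iso_iff[OF cycles_group(1)[OF *(1), of n] cycles_group(1)[OF *(2), of n]
          cycles_group(2)[OF *(1), of n] cycles_group(2)[OF *(2), of n], of "f n"]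
      by (simp add: homology_def)
  qed
  then show ?thesis unfolding quasi_iso_def by blast
qed

lemma chain_map_compose:
  assumes "chain_map X Y f" "chain_map Y Z g"
  shows "chain_map X Z (\<lambda>n x. g n (f n x))"
proof -
  have "(\<lambda>x. g n (f n x)) \<in> hom (grp X n) (grp Z n)" for n
    using hom_compose[OF chain_mapD(1)[OF assms(1)] chain_mapD(1)[OF assms(2)]] by (simp add: o_def)
  then show ?thesis
    using chain_mapD(2,3)[OF assms(1)] chain_mapD(3)[OF assms(2)] by (simp add: chain_map_def)
qed

lemma quasi_iso_compose:
  assumes "quasi_iso X Y f" "quasi_iso Y Z g"
  shows "quasi_iso X Z (\<lambda>n x. g n (f n x))"
proof -
  have X: "chain_complex X" and Y: "chain_complex Y" and Z: "chain_complex Z"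
    and f: "chain_map X Y f" and g: "chain_map Y Z g"
    using assms by (auto simp: quasi_iso_iff)
  have inj: "x \<in> boundaries X n" if "x \<in> cycles X n" "g n (f n x) \<in> boundaries Z n" for n x
    using that assms chain_map_cycles[OF X Y f] by (auto simp: quasi_iso_iff)
  have surj: "\<exists>x\<in>cycles X n. \<exists>b\<in>boundaries Z n. z = b \<otimes>\<^bsub>grp Z n\<^esub> g n (f n x)"
    if z: "z \<in> cycles Z n" for n z
  proof -
    interpret Z: comm_group "grp Z n" using Z by (rule chain_complexD)
    obtain y b where y: "y \<in> cycles Y n" "b \<in> boundaries Z n" "z = b \<otimes>\<^bsub>grp Z n\<^esub> g n y"
      using z assms(2) unfolding quasi_iso_iff by meson
    obtain x c where x: "x \<in> cycles X n" "c \<in> boundaries Y n" "y = c \<otimes>\<^bsub>grp Y n\<^esub> f n x"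
      using y assms(1) unfolding quasi_iso_iff by meson
    have c: "g n c \<in> boundaries Z n" using chain_map_boundaries[OF Y g] x by blast
    have car: "c \<in> carrier (grp Y n)" "f n x \<in> carrier (grp Y n)"
      using x boundaries_subset_cycles[OF Y] cycles_carrier[OF Y] chain_map_cycles[OF X Y f] by blast+
    then have "g n y = g n c \<otimes>\<^bsub>grp Z n\<^esub> g n (f n x)"
      using x hom_mult[OF chain_mapD(1)[OF g]] by blast
    moreover have "b \<in> carrier (grp Z n)" "g n c \<in> carrier (grp Z n)" "g n (f n x) \<in> carrier (grp Z n)"
      using y c car chain_mapD(2)[OF g] boundaries_subset_cycles[OF Z] cycles_carrier[OF Z] by blast+
    ultimately have "z = (b \<otimes>\<^bsub>grp Z n\<^esub> g n c) \<otimes>\<^bsub>grp Z n\<^esub> g n (f n x)"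
      using y by (simp add: Z.m_assoc)
    moreover have "b \<otimes>\<^bsub>grp Z n\<^esub> g n c \<in> boundaries Z n"
      using y(2) c subgroup.m_closed[OF boundaries_subgroup[OF Z]] by blast
    ultimately show ?thesis using x(1) by blast
  qed
  show ?thesis
    unfolding quasi_iso_iff using X Z chain_map_compose[OF f g] inj surj by blast
qed

lemma quasi_iso_cong:
  assumes "quasi_iso X Y f" "\<And>n x. x \<in> carrier (grp X n) \<Longrightarrow> g n x = f n x"
  shows "quasi_iso X Y g"
proof -
  have X: "chain_complex X" using assms(1) by (simp add: quasi_iso_iff)
  have "g n \<in> hom (grp X n) (grp Y n)" for n
    using assms chain_mapD(1)[of X Y f n] group.is_monoid[OF chain_complexD(2)[OF X, of n]]
    by (auto simp: quasi_iso_iff hom_def Pi_def monoid.m_closed)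
  moreover have "bdy X n x \<in> carrier (grp X n)" if "x \<in> carrier (grp X (Suc n))" for n x
    using hom_in_carrier[OF chain_complexD(3)[OF X] that] .
  ultimately have "chain_map X Y g"
    using assms by (simp add: quasi_iso_iff chain_map_def)
  then show ?thesis
    using assms(1) cycles_carrier[OF X] assms(2) unfolding quasi_iso_iff by metis
qed

text \<open>
  Two out of three for isomorphisms in homology, where the third map is merely a chain map to begin with.
  This is how a naturality square transfers an isomorphism from one side to the opposite one.
\<close>

lemma quasi_iso_cancel_left:
  assumes gf: "quasi_iso X Z (\<lambda>n x. g n (f n x))" and g: "quasi_iso Y Z g"
    and f: "chain_map X Y f"
  shows "quasi_iso X Y f"
proof -
  have X: "chain_complex X" and Y: "chain_complex Y" and Z: "chain_complex Z"
    and gm: "chain_map Y Z g"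
    using assms by (auto simp: quasi_iso_iff)
  have inj: "x \<in> boundaries X n" if "x \<in> cycles X n" "f n x \<in> boundaries Y n" for n x
    using that gf chain_map_boundaries[OF Y gm] by (auto simp: quasi_iso_iff)
  have surj: "\<exists>x\<in>cycles X n. \<exists>b\<in>boundaries Y n. y = b \<otimes>\<^bsub>grp Y n\<^esub> f n x"
    if y: "y \<in> cycles Y n" for n y
  proof -
    interpret Y: comm_group "grp Y n" using Y by (rule chain_complexD)
    interpret Z: comm_group "grp Z n" using Z by (rule chain_complexD)
    interpret ZY: subgroup "cycles Y n" "grp Y n" by (rule cycles_subgroup[OF Y])
    interpret g: group_hom "grp Y n" "grp Z n" "g n"
      using chain_mapD(1)[OF gm] by unfold_locales
    have "g n y \<in> cycles Z n" using chain_map_cycles[OF Y Z gm y] .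
    then obtain x b where x: "x \<in> cycles X n" "b \<in> boundaries Z n"
        "g n y = b \<otimes>\<^bsub>grp Z n\<^esub> g n (f n x)"
      using gf unfolding quasi_iso_iff by blast
    have fx: "f n x \<in> cycles Y n" using chain_map_cycles[OF X Y f] x by blast
    let ?d = "y \<otimes>\<^bsub>grp Y n\<^esub> inv\<^bsub>grp Y n\<^esub> f n x"
    have d: "?d \<in> cycles Y n" using y fx by simp
    have bc: "b \<in> carrier (grp Z n)"
      using x boundaries_subset_cycles[OF Z] cycles_carrier[OF Z] by blast
    have "g n ?d = b" using x y fx bc by (simp add: Z.m_assoc)
    then have "?d \<in> boundaries Y n" using d x g unfolding quasi_iso_iff by metis
    moreover have "y = ?d \<otimes>\<^bsub>grp Y n\<^esub> f n x" using y fx by (simp add: Y.m_assoc)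
    ultimately show ?thesis using x by blast
  qed
  show ?thesis unfolding quasi_iso_iff using X Y f inj surj by blast
qed

lemma quasi_iso_cancel_right:
  assumes gf: "quasi_iso X Z (\<lambda>n x. g n (f n x))" and f: "quasi_iso X Y f"
    and g: "chain_map Y Z g"
  shows "quasi_iso Y Z g"
proof -
  have X: "chain_complex X" and Y: "chain_complex Y" and Z: "chain_complex Z"
    and fm: "chain_map X Y f"
    using assms by (auto simp: quasi_iso_iff)
  have surj: "\<exists>y\<in>cycles Y n. \<exists>b\<in>boundaries Z n. z = b \<otimes>\<^bsub>grp Z n\<^esub> g n y"
    if "z \<in> cycles Z n" for n z
    using that gf chain_map_cycles[OF X Y fm] unfolding quasi_iso_iff by meson
  have inj: "y \<in> boundaries Y n" if y: "y \<in> cycles Y n" "g n y \<in> boundaries Z n" for n y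
  proof -
    interpret Y: comm_group "grp Y n" using Y by (rule chain_complexD)
    interpret Z: comm_group "grp Z n" using Z by (rule chain_complexD)
    interpret BY: subgroup "boundaries Y n" "grp Y n" by (rule boundaries_subgroup[OF Y])
    interpret BZ: subgroup "boundaries Z n" "grp Z n" by (rule boundaries_subgroup[OF Z])
    interpret g: group_hom "grp Y n" "grp Z n" "g n"
      using chain_mapD(1)[OF g] by unfold_locales
    obtain x b where x: "x \<in> cycles X n" "b \<in> boundaries Y n" "y = b \<otimes>\<^bsub>grp Y n\<^esub> f n x"
      using f y unfolding quasi_iso_iff by blast
    have fx: "f n x \<in> carrier (grp Y n)" using x chain_mapD(2)[OF fm] cycles_carrier[OF X] by blast
    have gb: "g n b \<in> boundaries Z n" using chain_map_boundaries[OF Y g x(2)] .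
    have "g n (f n x) = inv\<^bsub>grp Z n\<^esub> g n b \<otimes>\<^bsub>grp Z n\<^esub> g n y"
      using x fx by (simp add: Z.m_assoc[symmetric])
    then have "g n (f n x) \<in> boundaries Z n" using gb y by simp
    then have "x \<in> boundaries X n" using x gf unfolding quasi_iso_iff by metis
    then show ?thesis using x chain_map_boundaries[OF X fm] by simp
  qed
  show ?thesis unfolding quasi_iso_iff using Y Z g inj surj by blast
qed

lemma quasi_iso_of_isos:
  assumes X: "chain_complex X" and Y: "chain_complex Y" and f: "chain_map X Y f"
    and iso: "\<And>n. f n \<in> iso (grp X n) (grp Y n)"
  shows "quasi_iso X Y f"
proof -
  have bij: "bij_betw (f n) (carrier (grp X n)) (carrier (grp Y n))" for n
    using iso by (simp add: iso_def)
  have inj: "x \<in> boundaries X n" if x: "x \<in> cycles X n" "f n x \<in> boundaries Y n" for n x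
  proof -
    obtain y where y: "y \<in> carrier (grp Y (Suc n))" "f n x = bdy Y n y"
      using x by (auto simp: boundaries_def)
    then obtain z where z0: "z \<in> carrier (grp X (Suc n))" "y = f (Suc n) z"
      using bij_betw_imp_surj_on[OF bij[of "Suc n"]] by blast
    then have z: "z \<in> carrier (grp X (Suc n))" "f n x = bdy Y n (f (Suc n) z)"
      using y by auto
    then have "f n x = f n (bdy X n z)" using chain_mapD(3)[OF f] by simp
    then have "x = bdy X n z"
      using inj_onD[OF bij_betw_imp_inj_on[OF bij[of n]] _ cycles_carrier[OF X x(1)]
          hom_in_carrier[OF chain_complexD(3)[OF X] z(1)]] by blast
    then show ?thesis using z by (simp add: boundaries_def)
  qed
  have surj: "\<exists>x\<in>cycles X n. \<exists>b\<in>boundaries Y n. y = b \<otimes>\<^bsub>grp Y n\<^esub> f n x"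
    if y: "y \<in> cycles Y n" for n y
  proof -
    interpret Y: comm_group "grp Y n" using Y by (rule chain_complexD)
    have yc: "y \<in> carrier (grp Y n)" using y cycles_carrier[OF Y] by blast
    then obtain x where x: "x \<in> carrier (grp X n)" "y = f n x"
      using bij_betw_imp_surj_on[OF bij[of n]] by blast
    have "x \<in> cycles X n"
    proof (cases n)
      case (Suc m)
      interpret h: group_hom "grp X m" "grp Y m" "f m"
        using chain_complexD[OF X] chain_complexD[OF Y] chain_mapD[OF f]
        by (simp add: group_hom_def group_hom_axioms_def)
      have b: "bdy X m x \<in> carrier (grp X m)"
        using x Suc hom_in_carrier[OF chain_complexD(3)[OF X]] by blast
      have "f m (bdy X m x) = f m \<one>\<^bsub>grp X m\<^esub>"
        using y x Suc chain_mapD(3)[OF f] by (simp add: kernel_def)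
      then have "bdy X m x = \<one>\<^bsub>grp X m\<^esub>"
        using inj_onD[OF bij_betw_imp_inj_on[OF bij[of m]] _ b h.G.one_closed] by blast
      then show ?thesis using x Suc by (simp add: kernel_def)
    qed (use x in auto)
    moreover have "\<one>\<^bsub>grp Y n\<^esub> \<in> boundaries Y n"
      by (rule subgroup.one_closed[OF boundaries_subgroup[OF Y]])
    ultimately show ?thesis using x yc by (metis Y.l_one)
  qed
  show ?thesis unfolding quasi_iso_iff using X Y f inj surj by blast
qed

text \<open>
  The induced map sends a coset to a union of cosets.  Since distinct cosets are disjoint, such a union is
  a coset only if all its members coincide.  So if the induced map is a homomorphism, then the
  underlying map respects the subgroups; the compatibility of differentials and foldings with the relations is
  recovered in this way from the hypotheses of the theorem.
\<close>

lemma coset_map_hom_imp_subset: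
  assumes "group G" "group G'" "subgroup B G" "subgroup B' G'" and f: "f \<in> hom G G'"
    and h: "coset_map G' B' f \<in> hom (G Mod B) (G' Mod B')"
  shows "f ` B \<subseteq> B'"
proof -
  interpret G: group G by fact
  interpret G': group G' by fact
  interpret B: subgroup B G by fact
  interpret B': subgroup B' G' by fact
  interpret f: group_hom G G' f using f by unfold_locales
  \<comment> \<open>The coset of the unit element shows which coset the union is.\<close>
  have "B = B #>\<^bsub>G\<^esub> \<one>\<^bsub>G\<^esub>" by (simp add: B.subset)
  then have "B \<in> carrier (G Mod B)" by (auto simp: FactGroup_def RCOSETS_def)
  then have "coset_map G' B' f B \<in> carrier (G' Mod B')" using h by (auto simp: hom_def)
  then obtain y where y: "y \<in> carrier G'" "coset_map G' B' f B = B' #>\<^bsub>G'\<^esub> y"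
    by (auto simp: FactGroup_def RCOSETS_def)
  have *: "f b \<in> B' #>\<^bsub>G'\<^esub> y" if b: "b \<in> B" for b
    unfolding y(2)[symmetric] coset_map_def
    by (rule UN_I[OF b], rule G'.rcos_self[OF _ B'.subgroup_axioms], use b B.mem_carrier in simp)
  have "B' #>\<^bsub>G'\<^esub> y = B'"
    using *[OF B.one_closed] G'.repr_independence[OF _ y(1) B'.subgroup_axioms, of "\<one>\<^bsub>G'\<^esub>"]
      G'.coset_mult_one[OF B'.subset] by simp
  then show ?thesis using * by auto
qed

text \<open>
  Maps between quotients of graded groups with a differential.  The formal complexes arise as such
  quotients, and it is for the quotients that the hypotheses of the theorem provide chain complexes.
\<close>

locale quotient_map =
  fixes X :: "'a complex_data" and B :: "nat \<Rightarrow> 'a set"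
    and Y :: "'b complex_data" and B' :: "nat \<Rightarrow> 'b set" and f :: "nat \<Rightarrow> 'a \<Rightarrow> 'b"
  assumes X: "\<And>n. comm_group (grp X n)" and Y: "\<And>n. comm_group (grp Y n)"
    and B: "\<And>n. subgroup (B n) (grp X n)" and B': "\<And>n. subgroup (B' n) (grp Y n)"
    and bX: "\<And>n. bdy X n \<in> hom (grp X (Suc n)) (grp X n)"
    and bY: "\<And>n. bdy Y n \<in> hom (grp Y (Suc n)) (grp Y n)"
    and XB: "chain_complex (quotient_complex X B)" and YB: "chain_complex (quotient_complex Y B')"
    and f: "chain_map X Y f" and fB: "\<And>n. f n ` B n \<subseteq> B' n"
begin

lemma Xg: "group (grp X n)" and Yg: "group (grp Y n)"
  using X Y by (simp_all add: comm_group_def)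

lemma bdy_X_rel: "bdy X n ` B (Suc n) \<subseteq> B n"
  using chain_complexD(3)[OF XB, of n]
  by (intro coset_map_hom_imp_subset[OF Xg Xg B B bX]) (simp add: quotient_complex_def)

lemma bdy_Y_rel: "bdy Y n ` B' (Suc n) \<subseteq> B' n"
  using chain_complexD(3)[OF YB, of n]
  by (intro coset_map_hom_imp_subset[OF Yg Yg B' B' bY]) (simp add: quotient_complex_def)

lemma chain_map_quotient:
  "chain_map (quotient_complex X B) (quotient_complex Y B') (\<lambda>n. coset_map (grp Y n) (B' n) (f n))"
proof -
  have "coset_map (grp Y n) (B' n) (f n) \<in> hom (grp X n Mod B n) (grp Y n Mod B' n)" for n
    by (rule coset_map_hom[OF X Y B B' chain_mapD(1)[OF f] fB])
  moreover have "coset_map (grp Y n) (B' n) (f n) (coset_map (grp X n) (B n) (bdy X n) c)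
      = coset_map (grp Y n) (B' n) (bdy Y n) (coset_map (grp Y (Suc n)) (B' (Suc n)) (f (Suc n)) c)"
    if c: "c \<in> carrier (grp X (Suc n) Mod B (Suc n))" for n c
  proof -
    obtain x where x: "x \<in> carrier (grp X (Suc n))" "c = B (Suc n) #>\<^bsub>grp X (Suc n)\<^esub> x"
      using c by (auto simp: FactGroup_def RCOSETS_def)
    show ?thesis
      using x hom_in_carrier[OF bX] chain_mapD(2,3)[OF f]
      by (simp add: coset_map_rcos[OF Xg Xg B B bX bdy_X_rel] coset_map_rcos[OF Yg Yg B' B' bY bdy_Y_rel]
          coset_map_rcos[OF Xg Yg B B' chain_mapD(1)[OF f] fB])
  qed
  ultimately show ?thesis by (simp add: chain_map_def quotient_complex_def)
qed

lemma quasi_iso_quotient: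
  assumes inj: "\<And>n x. x \<in> carrier (grp X n) \<Longrightarrow> f n x \<in> B' n \<Longrightarrow> x \<in> B n"
    and surj: "\<And>n y. y \<in> carrier (grp Y n) \<Longrightarrow>
      \<exists>x\<in>carrier (grp X n). \<exists>b\<in>B' n. y = b \<otimes>\<^bsub>grp Y n\<^esub> f n x"
  shows "quasi_iso (quotient_complex X B) (quotient_complex Y B')
    (\<lambda>n. coset_map (grp Y n) (B' n) (f n))"
proof (rule quasi_iso_of_isos[OF XB YB chain_map_quotient])
  fix n
  show "coset_map (grp Y n) (B' n) (f n) \<in> iso (grp (quotient_complex X B) n) (grp (quotient_complex Y B') n)"
    using inj surj coset_map_iso_iff[OF X Y B B' chain_mapD(1)[OF f] fB]
    by (simp add: quotient_complex_def)
qed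

end

section \<open>Strict \<open>\<omega>\<close>-categories\<close>

locale omega_cat =
  fixes C :: "'a omegacat"
  assumes omega_category: "omega_category C"
begin

lemma dd_closed [simp, intro]: "x \<in> mor C \<Longrightarrow> dd C \<alpha> n x \<in> mor C"
  using omega_category by (simp add: omega_category_def)

lemma cmp_closed [intro]: "composable C n x y \<Longrightarrow> cmp C n x y \<in> mor C"
  using omega_category by (simp add: omega_category_def)

lemma dd_dd: "x \<in> mor C \<Longrightarrow> dd C \<beta> m (dd C \<alpha> n x) = (if m < n then dd C \<beta> m x else dd C \<alpha> n x)"
  by (rule omega_category[unfolded omega_category_def, THEN conjunct2, THEN conjunct2, THEN conjunct1,
        rule_format])

lemma dd_dd_less [simp]: "x \<in> mor C \<Longrightarrow> m < n \<Longrightarrow> dd C \<beta> m (dd C \<alpha> n x) = dd C \<beta> m x"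
  by (simp add: dd_dd)

lemma dd_dd_ge [simp]: "x \<in> mor C \<Longrightarrow> n \<le> m \<Longrightarrow> dd C \<beta> m (dd C \<alpha> n x) = dd C \<alpha> n x"
  by (simp add: dd_dd)

lemma cmp_units [simp]:
  "x \<in> mor C \<Longrightarrow> cmp C n (dd C Neg n x) x = x" "x \<in> mor C \<Longrightarrow> cmp C n x (dd C Pos n x) = x"
  using omega_category by (simp_all add: omega_category_def)

lemma dd_cmp_same:
  assumes "composable C n x y"
  shows "dd C Neg n (cmp C n x y) = dd C Neg n x" "dd C Pos n (cmp C n x y) = dd C Pos n y"
  using omega_category assms by (simp_all add: omega_category_def)

lemma dd_cmp:
  assumes "composable C n x y" "m \<noteq> n"
  shows "composable C n (dd C \<alpha> m x) (dd C \<alpha> m y)"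
    "dd C \<alpha> m (cmp C n x y) = cmp C n (dd C \<alpha> m x) (dd C \<alpha> m y)"
  using omega_category assms by (simp_all add: omega_category_def)

lemma interchange:
  assumes "m \<noteq> n" "composable C n x y" "composable C n z w"
    "composable C m (cmp C n x y) (cmp C n z w)"
    "composable C m x z" "composable C m y w"
    "composable C n (cmp C m x z) (cmp C m y w)"
  shows "cmp C m (cmp C n x y) (cmp C n z w) = cmp C n (cmp C m x z) (cmp C m y w)"
  using omega_category[unfolded omega_category_def, THEN conjunct2, THEN conjunct2, THEN conjunct2,
      THEN conjunct2, THEN conjunct2, THEN conjunct2, THEN conjunct1] assms by blast

lemma assoc:
  assumes "composable C n x y" "composable C n (cmp C n x y) z"
    "composable C n y z" "composable C n x (cmp C n y z)"
  shows "cmp C n (cmp C n x y) z = cmp C n x (cmp C n y z)"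
  using omega_category[unfolded omega_category_def, THEN conjunct2, THEN conjunct2, THEN conjunct2,
      THEN conjunct2, THEN conjunct2, THEN conjunct1] assms by blast

lemma assoc':
  assumes "composable C n x y" "composable C n y z"
  shows "composable C n (cmp C n x y) z" "composable C n x (cmp C n y z)"
    "cmp C n (cmp C n x y) z = cmp C n x (cmp C n y z)"
proof -
  show *: "composable C n (cmp C n x y) z" "composable C n x (cmp C n y z)"
    using assms dd_cmp_same[OF assms(1)] dd_cmp_same[OF assms(2)] cmp_closed
    by (auto simp: composable_def)
  show "cmp C n (cmp C n x y) z = cmp C n x (cmp C n y z)" by (rule assoc[OF assms(1) *(1) assms(2) *(2)])
qed

lemma composableD:
  assumes "composable C n x y"
  shows "x \<in> mor C" "y \<in> mor C" "dd C Pos n x = dd C Neg n y"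
  using assms by (auto simp: composable_def)

lemma dd_fixed_mono: "x \<in> mor C \<Longrightarrow> dd C \<alpha> n x = x \<Longrightarrow> n \<le> m \<Longrightarrow> dd C \<beta> m x = x"
  by (metis dd_dd_ge)

text \<open>
  The axiom $d_m^\beta d_n^\alpha = d_n^\alpha$ for \<open>m \<ge> n\<close> makes the condition for one sign imply the one
  for the other, so the dimension can be read off from either source or target.
\<close>

lemma mdim_le_iff: "x \<in> mor C \<Longrightarrow> mdim C x \<le> n \<longleftrightarrow> dd C \<alpha> n x = x"
proof -
  assume x: "x \<in> mor C"
  obtain k where "dd C Neg k x = x \<and> dd C Pos k x = x"
    using omega_category[unfolded omega_category_def] x by meson
  then have *: "dd C Neg (mdim C x) x = x \<and> dd C Pos (mdim C x) x = x"
    unfolding mdim_def by (rule LeastI)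
  show ?thesis
  proof
    assume "dd C \<alpha> n x = x"
    then have "dd C Neg n x = x \<and> dd C Pos n x = x" using dd_fixed_mono[OF x] by blast
    then show "mdim C x \<le> n" unfolding mdim_def by (rule Least_le)
  next
    assume "mdim C x \<le> n"
    then show "dd C \<alpha> n x = x" using * dd_fixed_mono[OF x] by blast
  qed
qed

lemma mdim_0_iff: "x \<in> mor C \<Longrightarrow> mdim C x = 0 \<longleftrightarrow> dd C \<alpha> 0 x = x"
  using mdim_le_iff[of x 0 \<alpha>] by simp

lemma dd_mdim [simp]: "x \<in> mor C \<Longrightarrow> mdim C x \<le> n \<Longrightarrow> dd C \<alpha> n x = x"
  using mdim_le_iff by blast

lemma mdim_dd: "x \<in> mor C \<Longrightarrow> mdim C (dd C \<alpha> n x) \<le> n"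
  using mdim_le_iff[of "dd C \<alpha> n x" n \<alpha>] by simp

lemma cmp_id_left:
  assumes "composable C p x y" "mdim C x \<le> p" shows "x = dd C Neg p y" "cmp C p x y = y"
  using assms by (auto simp: composable_def)

lemma mdim_cmp:
  assumes xy: "composable C p x y" and "mdim C x \<le> n" "mdim C y \<le> n"
  shows "mdim C (cmp C p x y) \<le> n"
proof (cases "n \<le> p")
  case True
  then show ?thesis using cmp_id_left[OF xy] assms by simp
next
  case False
  then have "dd C Neg n (cmp C p x y) = cmp C p x y"
    using dd_cmp[OF xy, of n Neg] assms composableD[OF xy] by simp
  then show ?thesis using mdim_le_iff cmp_closed[OF xy] by blast
qed

lemma composable_low:
  assumes "composable C p x y" "q < p" shows "dd C \<alpha> q x = dd C \<alpha> q y"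
  using assms dd_dd_less[of x q p \<alpha> Pos] dd_dd_less[of y q p \<alpha> Neg] by (auto simp: composable_def)

lemma dd_cmp_low:
  assumes "composable C p x y" "q < p"
  shows "dd C \<alpha> q (cmp C p x y) = dd C \<alpha> q x"
proof -
  have "composable C p (dd C \<alpha> q x) (dd C \<alpha> q y)"
    "dd C \<alpha> q (cmp C p x y) = cmp C p (dd C \<alpha> q x) (dd C \<alpha> q y)"
    using dd_cmp[OF assms(1)] assms(2) by auto
  moreover have "mdim C (dd C \<alpha> q x) \<le> p"
    using mdim_dd[of x \<alpha> q] assms composableD[OF assms(1)] by simp
  ultimately show ?thesis using cmp_id_left composable_low[OF assms] by metis
qed

lemma cmp_self: "x \<in> mor C \<Longrightarrow> mdim C x \<le> p \<Longrightarrow> composable C p x x \<and> cmp C p x x = x"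
  by (metis cmp_units(1) composable_def dd_mdim)

text \<open>
  Apply the interchange law to $(x *_1 t_1 x) *_0 (s_1 y *_1 y)$, respectively to
  $(s_1 x *_1 x) *_0 (y *_1 t_1 y)$: a horizontal composite is a vertical one of cells whiskered by
  edges, in two ways.
\<close>

lemma cmp0_slide:
  assumes xy: "composable C 0 x y"
  shows "composable C 0 x (dd C Neg 1 y)" "composable C 0 (dd C Pos 1 x) y"
    "composable C 1 (cmp C 0 x (dd C Neg 1 y)) (cmp C 0 (dd C Pos 1 x) y)"
    "cmp C 0 x y = cmp C 1 (cmp C 0 x (dd C Neg 1 y)) (cmp C 0 (dd C Pos 1 x) y)"
    "composable C 0 (dd C Neg 1 x) y" "composable C 0 x (dd C Pos 1 y)"
    "composable C 1 (cmp C 0 (dd C Neg 1 x) y) (cmp C 0 x (dd C Pos 1 y))"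
    "cmp C 0 x y = cmp C 1 (cmp C 0 (dd C Neg 1 x) y) (cmp C 0 x (dd C Pos 1 y))"
proof -
  have m: "x \<in> mor C" "y \<in> mor C" "dd C Pos 0 x = dd C Neg 0 y" using xy by (auto simp: composable_def)
  show c: "composable C 0 x (dd C Neg 1 y)" "composable C 0 (dd C Pos 1 x) y"
     "composable C 0 (dd C Neg 1 x) y" "composable C 0 x (dd C Pos 1 y)"
    using m by (auto simp: composable_def)
  show d: "composable C 1 (cmp C 0 x (dd C Neg 1 y)) (cmp C 0 (dd C Pos 1 x) y)"
    "composable C 1 (cmp C 0 (dd C Neg 1 x) y) (cmp C 0 x (dd C Pos 1 y))"
    using m c cmp_closed
      dd_cmp(2)[OF c(1), of 1 Pos] dd_cmp(2)[OF c(2), of 1 Neg]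
      dd_cmp(2)[OF c(3), of 1 Pos] dd_cmp(2)[OF c(4), of 1 Neg] by (auto simp: composable_def)
  have e: "composable C 1 x (dd C Pos 1 x)" "composable C 1 (dd C Neg 1 y) y"
      "composable C 1 (dd C Neg 1 x) x" "composable C 1 y (dd C Pos 1 y)"
    using m by (auto simp: composable_def)
  show "cmp C 0 x y = cmp C 1 (cmp C 0 x (dd C Neg 1 y)) (cmp C 0 (dd C Pos 1 x) y)"
    using interchange[of 0 1, OF _ e(1,2) _ c(1,2) d(1)] xy m by simp
  show "cmp C 0 x y = cmp C 1 (cmp C 0 (dd C Neg 1 x) y) (cmp C 0 x (dd C Pos 1 y))"
    using interchange[of 0 1, OF _ e(3,4) _ c(3,4) d(2)] xy m by simp
qed

lemma whisker_right_cmp: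
  assumes xy: "composable C p x y" "p \<ge> 1" and w: "mdim C w \<le> 1" "composable C 0 (cmp C p x y) w"
  shows "composable C 0 x w" "composable C 0 y w" "composable C p (cmp C 0 x w) (cmp C 0 y w)"
    "cmp C 0 (cmp C p x y) w = cmp C p (cmp C 0 x w) (cmp C 0 y w)"
proof -
  have m: "x \<in> mor C" "y \<in> mor C" "w \<in> mor C" "dd C Pos p x = dd C Neg p y"
    using xy w by (auto simp: composable_def)
  have l: "dd C Pos 0 (cmp C p x y) = dd C Pos 0 x" "dd C Pos 0 x = dd C Pos 0 y"
    using dd_cmp_low[OF xy(1)] composable_low[OF xy(1)] xy(2) by auto
  show c: "composable C 0 x w" "composable C 0 y w"
    using m l w by (auto simp: composable_def)
  have wp: "dd C \<alpha> p w = w" for \<alpha> using w m xy by simp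
  show d: "composable C p (cmp C 0 x w) (cmp C 0 y w)"
    using m c cmp_closed dd_cmp(2)[OF c(1), of p Pos] dd_cmp(2)[OF c(2), of p Neg] xy wp
    by (auto simp: composable_def)
  have ww: "composable C p w w" "cmp C p w w = w" using cmp_self m w xy by auto
  show "cmp C 0 (cmp C p x y) w = cmp C p (cmp C 0 x w) (cmp C 0 y w)"
    using interchange[OF _ xy(1) ww(1) _ c d] w ww xy by simp
qed

lemma whisker_left_cmp:
  assumes xy: "composable C p x y" "p \<ge> 1" and w: "mdim C w \<le> 1" "composable C 0 w (cmp C p x y)"
  shows "composable C 0 w x" "composable C 0 w y" "composable C p (cmp C 0 w x) (cmp C 0 w y)"
    "cmp C 0 w (cmp C p x y) = cmp C p (cmp C 0 w x) (cmp C 0 w y)"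
proof -
  have m: "x \<in> mor C" "y \<in> mor C" "w \<in> mor C" "dd C Pos p x = dd C Neg p y"
    using xy w by (auto simp: composable_def)
  have l: "dd C Neg 0 (cmp C p x y) = dd C Neg 0 x" "dd C Neg 0 x = dd C Neg 0 y"
    using dd_cmp_low[OF xy(1)] composable_low[OF xy(1)] xy(2) by auto
  show c: "composable C 0 w x" "composable C 0 w y"
    using m l w by (auto simp: composable_def)
  have wp: "dd C \<alpha> p w = w" for \<alpha> using w m xy by simp
  show d: "composable C p (cmp C 0 w x) (cmp C 0 w y)"
    using m c cmp_closed dd_cmp(2)[OF c(1), of p Pos] dd_cmp(2)[OF c(2), of p Neg] xy wp
    by (auto simp: composable_def)
  have ww: "composable C p w w" "cmp C p w w = w" using cmp_self m w xy by auto
  show "cmp C 0 w (cmp C p x y) = cmp C p (cmp C 0 w x) (cmp C 0 w y)"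
    using interchange[OF _ ww(1) xy(1) _ c d] w ww xy by simp
qed

end

lemma omega_functorD:
  assumes "omega_functor C D f"
  shows "x \<in> mor C \<Longrightarrow> f x \<in> mor D" "x \<in> mor C \<Longrightarrow> f (dd C \<alpha> n x) = dd D \<alpha> n (f x)"
    "composable C n x y \<Longrightarrow> f (cmp C n x y) = cmp D n (f x) (f y)"
    "composable C n x y \<Longrightarrow> composable D n (f x) (f y)"
proof -
  show a: "x \<in> mor C \<Longrightarrow> f x \<in> mor D" "\<And>\<alpha> n x. x \<in> mor C \<Longrightarrow> f (dd C \<alpha> n x) = dd D \<alpha> n (f x)"
    "composable C n x y \<Longrightarrow> f (cmp C n x y) = cmp D n (f x) (f y)" for x
    using assms by (simp_all add: omega_functor_def)
  show "composable C n x y \<Longrightarrow> composable D n (f x) (f y)"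
    using a unfolding composable_def by metis
qed

lemma omega_functor_mdim:
  assumes "omega_category C" "omega_category D" "omega_functor C D f" "x \<in> mor C"
  shows "mdim C x \<le> n \<Longrightarrow> mdim D (f x) \<le> n"
  using omega_functorD[OF assms(3)] assms omega_cat.mdim_le_iff[OF omega_cat.intro] by metis

lemma path_simps:
  "mor (path C) = {x \<in> mor C. mdim C x \<ge> 1}" "dd (path C) \<alpha> i = dd C \<alpha> (Suc i)"
  "cmp (path C) i = cmp C (Suc i)"
  by (simp_all add: path_def)

lemma composable_path:
  "composable (path C) i x y \<longleftrightarrow> composable C (Suc i) x y \<and> mdim C x \<ge> 1 \<and> mdim C y \<ge> 1"
  by (auto simp: composable_def path_simps)

locale non_contracting_cat =
  fixes C :: "'a omegacat"
  assumes non_contracting: "non_contracting C"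

sublocale non_contracting_cat \<subseteq> omega_cat C
  using non_contracting by unfold_locales (simp add: non_contracting_def)

context non_contracting_cat
begin

lemma mdim_dd1: "x \<in> mor C \<Longrightarrow> mdim C x \<ge> 1 \<Longrightarrow> mdim C (dd C \<alpha> 1 x) = 1"
  using non_contracting by (cases \<alpha>) (auto simp: non_contracting_def)

lemma dd1_dim_0: "x \<in> mor C \<Longrightarrow> mdim C (dd C \<alpha> 1 x) = 0 \<Longrightarrow> mdim C x = 0"
  using mdim_dd1[of x \<alpha>] by linarith

text \<open>
  If $s_{n+1} x$ had dimension 0, it would agree with $s_0 x$, and then so would $s_1 x$.
\<close>

lemma mdim_dd_Suc:
  assumes x: "x \<in> mor C" "mdim C x \<ge> 1" shows "mdim C (dd C \<alpha> (Suc n) x) \<ge> 1"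
proof (rule ccontr)
  assume "\<not> mdim C (dd C \<alpha> (Suc n) x) \<ge> 1"
  then have "dd C \<alpha> 0 (dd C \<alpha> (Suc n) x) = dd C \<alpha> (Suc n) x" using x by simp
  then have "dd C \<alpha> 0 x = dd C \<alpha> (Suc n) x" using x by simp
  then have "dd C \<alpha> 1 (dd C \<alpha> 0 x) = dd C \<alpha> 1 (dd C \<alpha> (Suc n) x)" by simp
  then have "dd C \<alpha> 0 x = dd C \<alpha> 1 x" using x by (cases n) simp_all
  moreover have "mdim C (dd C \<alpha> 0 x) = 0" using mdim_dd[of x \<alpha> 0] x by simp
  ultimately show False using mdim_dd1[OF x, of \<alpha>] by simp
qed

lemma mdim_cmp_Suc:
  assumes xy: "composable C (Suc n) x y" and "mdim C x \<ge> 1"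
  shows "mdim C (cmp C (Suc n) x y) \<ge> 1" "mdim C y \<ge> 1"
proof -
  have m: "x \<in> mor C" "y \<in> mor C" "cmp C (Suc n) x y \<in> mor C" using xy by auto (auto simp: composable_def)
  have "mdim C (dd C Neg (Suc n) (cmp C (Suc n) x y)) \<ge> 1"
    using dd_cmp_same[OF xy] mdim_dd_Suc[OF m(1) assms(2)] by simp
  then show "mdim C (cmp C (Suc n) x y) \<ge> 1"
    using mdim_0_iff[OF m(3), of Neg] m
    by (metis dd_fixed_mono less_one linorder_not_le zero_le)
  have "mdim C (dd C Neg (Suc n) y) \<ge> 1"
    using xy mdim_dd_Suc[OF m(1) assms(2), of Pos n] by (simp add: composable_def)
  then show "mdim C y \<ge> 1"
    using mdim_0_iff[OF m(2), of Neg] m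
    by (metis dd_fixed_mono less_one linorder_not_le zero_le)
qed

lemma composable_mdim_Suc:
  assumes xy: "composable C (Suc n) x y" shows "mdim C x = 0 \<longleftrightarrow> mdim C y = 0"
proof
  assume "mdim C y = 0"
  then show "mdim C x = 0" using mdim_cmp_Suc(2)[OF xy] by linarith
next
  assume "mdim C x = 0"
  then have "dd C Neg 0 x = x" "dd C Neg (Suc n) y = x"
    using mdim_0_iff cmp_id_left[OF xy] xy by (auto simp: composable_def)
  then have "mdim C (dd C Neg (Suc n) y) = 0" using \<open>mdim C x = 0\<close> by simp
  then show "mdim C y = 0"
    using mdim_dd_Suc[of y Neg n] xy by (fastforce simp: composable_def)
qed

lemma omega_category_path: "omega_category (path C)"
  unfolding omega_category_def composable_path path_simps
proof (intro conjI allI ballI impI)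
  fix x assume x: "x \<in> {x \<in> mor C. 1 \<le> mdim C x}"
  have "dd C Neg (Suc (mdim C x)) x = x \<and> dd C Pos (Suc (mdim C x)) x = x"
    using x by simp
  then show "\<exists>n. dd C Neg (Suc n) x = x \<and> dd C Pos (Suc n) x = x" by blast
qed (auto simp: dd_dd dd_cmp_same dd_cmp(2) simp del: dd_dd_less dd_dd_ge
     intro: dd_cmp(1) mdim_dd_Suc[simplified] mdim_cmp_Suc(1)[simplified] assoc interchange
     dest: composableD)

lemma mdim_path_le_iff:
  assumes x: "x \<in> mor (path C)"
  shows "mdim (path C) x \<le> n \<longleftrightarrow> mdim C x \<le> Suc n"
proof -
  have "mdim (path C) x \<le> n \<longleftrightarrow> dd (path C) Neg n x = x"
    by (rule omega_cat.mdim_le_iff[OF omega_cat.intro[OF omega_category_path] x])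
  moreover have "mdim C x \<le> Suc n \<longleftrightarrow> dd C Neg (Suc n) x = x"
    using x by (intro mdim_le_iff) (simp add: path_simps)
  ultimately show ?thesis by (simp only: path_simps)
qed

lemma tr_path: "tr n (path C) = {x \<in> mor C. 1 \<le> mdim C x \<and> mdim C x \<le> Suc n}"
  using mdim_path_le_iff by (auto simp: tr_def path_simps)

end

lemma non_contracting_functor_mdim:
  assumes "non_contracting C" "non_contracting D" "non_contracting_functor C D f" "x \<in> mor C"
    "mdim C x \<ge> 1"
  shows "mdim D (f x) \<ge> 1"
proof (rule ccontr)
  interpret C: non_contracting_cat C by unfold_locales fact
  interpret D: non_contracting_cat D by unfold_locales fact
  have f: "omega_functor C D f" using assms by (simp add: non_contracting_functor_def)
  assume "\<not> mdim D (f x) \<ge> 1"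
  then have "dd D Neg 1 (f x) = f x" using omega_functorD(1)[OF f assms(4)] by simp
  moreover have "mdim D (f (dd C Neg 1 x)) = 1"
    using assms C.mdim_dd1 by (simp add: non_contracting_functor_def)
  ultimately show False using \<open>\<not> mdim D (f x) \<ge> 1\<close> omega_functorD(2)[OF f assms(4)] by simp
qed

lemma omega_functor_path:
  assumes "non_contracting C" "non_contracting D" "non_contracting_functor C D f"
  shows "omega_functor (path C) (path D) f"
  using assms non_contracting_functor_mdim[OF assms]
  by (auto simp: omega_functor_def path_simps composable_path non_contracting_functor_def)

lemma omega_functor_compose:
  assumes "omega_functor A B f" "omega_functor B C g"
  shows "omega_functor A C (\<lambda>x. g (f x))"
  using omega_functorD[OF assms(1)] omega_functorD[OF assms(2)] by (simp add: omega_functor_def)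

section \<open>Functors induced by maps of faces\<close>

lemma face_omegacat_facts:
  assumes H: "face_omegacat faces fdim R bd C"
  shows "omega_category C" "X \<in> mor C \<Longrightarrow> \<exists>Z\<subseteq>faces. X = \<Union>(R ` Z)"
    "x \<in> faces \<Longrightarrow> R x \<in> mor C"
    "\<lbrakk>R ` faces \<subseteq> S; \<And>p X Y. X \<in> S \<Longrightarrow> Y \<in> S \<Longrightarrow> composable C p X Y \<Longrightarrow> cmp C p X Y \<in> S\<rbrakk>
      \<Longrightarrow> mor C \<subseteq> S"
    "x \<in> faces \<Longrightarrow> dd C \<alpha> (fdim x) (R x) = R x"
    "x \<in> faces \<Longrightarrow> fdim x = Suc p \<Longrightarrow> dd C \<alpha> p (R x) = \<Union>(R ` bd \<alpha> x)"
    "composable C p X Y \<Longrightarrow> X \<union> Y \<in> mor C" "composable C p X Y \<Longrightarrow> cmp C p X Y = X \<union> Y"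
proof -
  note * = H[unfolded face_omegacat_def]
  note ** = *[THEN conjunct2, THEN conjunct2]
  note *** = **[THEN conjunct2, THEN conjunct2]
  show "omega_category C" by (rule *[THEN conjunct1])
  show "X \<in> mor C \<Longrightarrow> \<exists>Z\<subseteq>faces. X = \<Union>(R ` Z)" using *[THEN conjunct2, THEN conjunct1] by blast
  show "x \<in> faces \<Longrightarrow> R x \<in> mor C" using **[THEN conjunct1] by blast
  show "\<lbrakk>R ` faces \<subseteq> S; \<And>p X Y. X \<in> S \<Longrightarrow> Y \<in> S \<Longrightarrow> composable C p X Y \<Longrightarrow> cmp C p X Y \<in> S\<rbrakk>
      \<Longrightarrow> mor C \<subseteq> S"
    by (rule **[THEN conjunct2, THEN conjunct1, THEN spec[of _ S], THEN mp]) blast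
  show "x \<in> faces \<Longrightarrow> dd C \<alpha> (fdim x) (R x) = R x" by (rule ***[THEN conjunct1, rule_format])
  show "x \<in> faces \<Longrightarrow> fdim x = Suc p \<Longrightarrow> dd C \<alpha> p (R x) = \<Union>(R ` bd \<alpha> x)"
    by (rule ***[THEN conjunct2, THEN conjunct1, rule_format])
  show "composable C p X Y \<Longrightarrow> X \<union> Y \<in> mor C" "composable C p X Y \<Longrightarrow> cmp C p X Y = X \<union> Y"
    using ***[THEN conjunct2, THEN conjunct2, rule_format] by blast+
qed

text \<open>
  A map of faces that preserves boundaries induces an \<open>\<omega>\<close>-functor by direct image.  The axioms describe
  only the top boundary of a face; its sources and targets of lower index are those of this
  boundary, which is a composite of faces of smaller dimension.  Hence the induction on the dimension
  of the faces involved.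
\<close>

locale face_map =
  fixes faces :: "'f set" and fdim R bd C
    and faces' :: "'g set" and fdim' R' bd' C' and \<phi> :: "'f \<Rightarrow> 'g" and N :: nat
  assumes C: "face_omegacat faces fdim R bd C" and C': "face_omegacat faces' fdim' R' bd' C'"
    and phi: "x \<in> faces \<Longrightarrow> \<phi> x \<in> faces'" "x \<in> faces \<Longrightarrow> fdim' (\<phi> x) = fdim x"
      "x \<in> faces \<Longrightarrow> \<phi> ` R x = R' (\<phi> x)"
      "x \<in> faces \<Longrightarrow> fdim x = Suc p \<Longrightarrow> \<phi> ` bd \<alpha> x = bd' \<alpha> (\<phi> x)"
    and R_self: "x \<in> faces \<Longrightarrow> x \<in> R x"
    and R_faces: "x \<in> faces \<Longrightarrow> R x \<subseteq> faces"
    and bd_faces: "x \<in> faces \<Longrightarrow> fdim x = Suc p \<Longrightarrow> bd \<alpha> x \<subseteq> faces"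
    and bd_dim: "x \<in> faces \<Longrightarrow> fdim x = Suc p \<Longrightarrow> y \<in> bd \<alpha> x \<Longrightarrow> z \<in> R y \<Longrightarrow> fdim z < fdim x"
    and bounded: "x \<in> faces \<Longrightarrow> fdim x < N"
begin

sublocale C: omega_cat C
  by (rule omega_cat.intro) (rule face_omegacat_facts(1)[OF C])

sublocale C': omega_cat C'
  by (rule omega_cat.intro) (rule face_omegacat_facts(1)[OF C'])

lemma mor_faces: "X \<in> mor C \<Longrightarrow> X \<subseteq> faces"
  using face_omegacat_facts(2)[OF C, of X] R_faces by blast

lemmas face_omegacatD = face_omegacat_facts(3)[OF C] face_omegacat_facts(6)[OF C]
  face_omegacat_facts(5)[OF C] face_omegacat_facts(8)[OF C] mor_faces

lemmas face_omegacatD' = face_omegacat_facts(3)[OF C'] face_omegacat_facts(6)[OF C']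
  face_omegacat_facts(5)[OF C'] face_omegacat_facts(8)[OF C'] face_omegacat_facts(7)[OF C']

lemma generation:
  assumes "X \<in> mor C" "\<And>x. x \<in> faces \<Longrightarrow> P (R x)"
    "\<And>p X Y. composable C p X Y \<Longrightarrow> P X \<Longrightarrow> P Y \<Longrightarrow> P (X \<union> Y)"
  shows "P X"
proof -
  have "mor C \<subseteq> {X. P X}"
    by (rule face_omegacat_facts(4)[OF C]) (use assms(2,3) face_omegacatD(4) in auto)
  then show ?thesis using assms(1) by blast
qed

definition compat :: "'f set \<Rightarrow> bool" where
  "compat X \<longleftrightarrow> \<phi> ` X \<in> mor C' \<and> (\<forall>\<alpha> p. dd C' \<alpha> p (\<phi> ` X) = \<phi> ` dd C \<alpha> p X)"

lemma compat_union:
  assumes XY: "composable C p X Y" and X: "compat X" and Y: "compat Y"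
  shows "compat (X \<union> Y)"
proof -
  have c: "composable C' p (\<phi> ` X) (\<phi> ` Y)"
    using XY X Y by (simp add: composable_def compat_def)
  have u: "cmp C' p (\<phi> ` X) (\<phi> ` Y) = \<phi> ` (X \<union> Y)" "cmp C p X Y = X \<union> Y"
    using face_omegacatD'(4)[OF c] face_omegacatD(4)[OF XY] by auto
  have "dd C' \<alpha> m (\<phi> ` (X \<union> Y)) = \<phi> ` dd C \<alpha> m (X \<union> Y)" for \<alpha> m
  proof (cases "m = p")
    case True
    then show ?thesis
      using C'.dd_cmp_same[OF c] C.dd_cmp_same[OF XY] X Y unfolding u compat_def by (cases \<alpha>) auto
  next
    case False
    then have "dd C' \<alpha> m (\<phi> ` (X \<union> Y)) = dd C' \<alpha> m (\<phi> ` X) \<union> dd C' \<alpha> m (\<phi> ` Y)"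
      using C'.dd_cmp[OF c, of m \<alpha>] face_omegacatD'(4) unfolding u by simp
    moreover have "dd C \<alpha> m (X \<union> Y) = dd C \<alpha> m X \<union> dd C \<alpha> m Y"
      using False C.dd_cmp[OF XY, of m \<alpha>] face_omegacatD(4) unfolding u by simp
    ultimately show ?thesis using X Y by (simp add: compat_def image_Un)
  qed
  moreover have "\<phi> ` (X \<union> Y) \<in> mor C'" using face_omegacatD'(5)[OF c] by (simp add: image_Un)
  ultimately show ?thesis by (simp add: compat_def)
qed

lemma compat_bounded: "X \<in> mor C \<Longrightarrow> \<forall>x\<in>X. fdim x < k \<Longrightarrow> compat X"
proof (induction k arbitrary: X)
  case 0
  then have "X = {}" by simp
  have "X \<noteq> {} \<longrightarrow> \<not> (\<forall>x\<in>X. fdim x < 0)" by auto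
  moreover have "X \<noteq> {}"
    using \<open>X \<in> mor C\<close> by (rule generation) (use R_self in auto)
  ultimately show ?case using 0 by blast
next
  case (Suc k)
  have "(\<forall>x\<in>X. fdim x < Suc k) \<longrightarrow> compat X"
    using Suc.prems(1)
  proof (rule generation)
    fix x assume x: "x \<in> faces"
    have mem: "R x \<in> mor C" "R' (\<phi> x) \<in> mor C'" "\<phi> ` R x = R' (\<phi> x)"
      using face_omegacatD face_omegacatD' phi x by auto
    have hi: "dd C' \<alpha> p (\<phi> ` R x) = \<phi> ` dd C \<alpha> p (R x)" if "fdim x \<le> p" for \<alpha> p
    proof -
      have "dd C' \<alpha> p (R' (\<phi> x)) = R' (\<phi> x)"
        by (rule C'.dd_fixed_mono[OF mem(2) face_omegacatD'(3)[of "\<phi> x" \<alpha>]]) (use x phi that in auto)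
      moreover have "dd C \<alpha> p (R x) = R x"
        by (rule C.dd_fixed_mono[OF mem(1) face_omegacatD(3)[of x \<alpha>]]) (use x phi that in auto)
      ultimately show ?thesis using mem by simp
    qed
    show "(\<forall>x\<in>R x. fdim x < Suc k) \<longrightarrow> compat (R x)"
    proof
      assume b: "\<forall>x\<in>R x. fdim x < Suc k"
      have "dd C' \<alpha> p (\<phi> ` R x) = \<phi> ` dd C \<alpha> p (R x)" for \<alpha> p
      proof (cases "fdim x \<le> p")
        case False
        then obtain q where q: "fdim x = Suc q" "p \<le> q" by (cases "fdim x") auto
        have top: "dd C' \<beta> q (R' (\<phi> x)) = \<phi> ` dd C \<beta> q (R x)" for \<beta>
        proof -
          have "dd C' \<beta> q (R' (\<phi> x)) = \<Union>(R' ` \<phi> ` bd \<beta> x)"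
            using face_omegacatD'(2)[OF phi(1)[OF x]] phi(2,4) x q by simp
          also have "\<dots> = \<Union>((\<lambda>y. \<phi> ` R y) ` bd \<beta> x)"
            unfolding image_image
            by (intro arg_cong[where f = Union] image_cong refl phi(3)[symmetric] subsetD[OF bd_faces[OF x q(1)]])
          also have "\<dots> = \<phi> ` \<Union>(R ` bd \<beta> x)" by blast
          finally show ?thesis using face_omegacatD(2)[OF x q(1)] by simp
        qed
        show ?thesis
        proof (cases "p = q")
          case True
          then show ?thesis using top mem by simp
        next
          case False
          let ?Y = "dd C Neg q (R x)"
          have "fdim z < fdim x" if "z \<in> ?Y" for z
            using bd_dim[OF x q(1)] that face_omegacatD(2)[OF x q(1)] by auto
          moreover have "fdim x \<le> k" using b R_self[OF x] by auto
          ultimately have "compat ?Y" using mem by (intro Suc.IH) force+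
          \<comment> \<open>The boundary of lower index of a face is that of its top boundary, whose faces are smaller.\<close>
          then have "dd C' \<alpha> p (\<phi> ` ?Y) = \<phi> ` dd C \<alpha> p ?Y" by (simp add: compat_def)
          then show ?thesis
            using mem False q by (simp add: top[symmetric])
        qed
      qed (rule hi)
      then show "compat (R x)" using mem by (simp add: compat_def)
    qed
  next
    fix p X Y
    assume "composable C p X Y" "(\<forall>x\<in>X. fdim x < Suc k) \<longrightarrow> compat X" "(\<forall>x\<in>Y. fdim x < Suc k) \<longrightarrow> compat Y"
    then show "(\<forall>x\<in>X \<union> Y. fdim x < Suc k) \<longrightarrow> compat (X \<union> Y)"
      using compat_union by blast
  qed
  then show ?case using Suc.prems by blast
qed

lemma image_closed: "X \<in> mor C \<Longrightarrow> \<phi> ` X \<in> mor C'"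
  using compat_bounded[of X N] bounded face_omegacatD(5)[of X] by (auto simp: compat_def)

end

lemma cube_R_dim: "z \<in> cube_R y \<Longrightarrow> count_list z 0 \<le> count_list y 0"
proof -
  have "list_all2 (\<lambda>a b. a = 0 \<or> a = b) y z \<Longrightarrow> count_list z 0 \<le> count_list y (0::int)" for y z
    by (induction rule: list_all2_induct) auto
  then show "z \<in> cube_R y \<Longrightarrow> count_list z 0 \<le> count_list y 0" by (simp add: cube_R_def)
qed

lemma count_list_update_zero:
  "j < length u \<Longrightarrow> u ! j = 0 \<Longrightarrow> c \<noteq> (0::int) \<Longrightarrow> Suc (count_list (u[j := c]) 0) = count_list u 0"
  by (induction u arbitrary: j) (auto split: nat.split simp: less_Suc_eq_0_disj)

lemma insert_letter_append:
  "j = length a \<Longrightarrow> insert_letter \<alpha> j (a @ b) = a @ letter \<alpha> # b"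
  by (simp add: insert_letter_def)

lemma letter_nonzero [simp]: "letter \<alpha> \<noteq> 0" "letter \<alpha> \<in> {-1, 0, 1}"
  by (cases \<alpha>; simp)+

text \<open>
  The letter that replaces the \<open>i\<close>-th zero of a word in \<open>cube_bd\<close>.
\<close>

definition bd_sign :: "sign \<Rightarrow> nat \<Rightarrow> int" where
  "bd_sign \<alpha> i = (case \<alpha> of Neg \<Rightarrow> (-1) ^ i | Pos \<Rightarrow> (-1) ^ (i + 1))"

lemma bd_sign_mem: "bd_sign \<alpha> i \<in> {-1, 1}"
  by (cases \<alpha>; cases "even i") (auto simp: bd_sign_def)

text \<open>
  Inserting a letter splits a word into a prefix and a suffix, so the boundary is split accordingly: in
  the suffix, zeros are counted starting after those of the prefix.
\<close>

lemma cube_bd_append: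
  "cube_bd \<beta> (a @ b) =
     {a[j := bd_sign \<beta> (count_list (take (Suc j) a) 0)] @ b | j. j < length a \<and> a ! j = 0} \<union>
     {a @ b[j := bd_sign \<beta> (count_list a 0 + count_list (take (Suc j) b) 0)] | j. j < length b \<and> b ! j = 0}"
  (is "?L = ?A \<union> ?B")
proof -
  have L: "?L = {(a @ b)[j := bd_sign \<beta> (count_list (take (Suc j) (a @ b)) 0)] | j.
      j < length (a @ b) \<and> (a @ b) ! j = 0}"
    by (simp add: cube_bd_def bd_sign_def Let_def)
  have "?L = {(a @ b)[j := bd_sign \<beta> (count_list (take (Suc j) (a @ b)) 0)] | j.
      j < length a \<and> (a @ b) ! j = 0} \<union>
     {(a @ b)[j := bd_sign \<beta> (count_list (take (Suc j) (a @ b)) 0)] | j.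
      length a \<le> j \<and> j < length (a @ b) \<and> (a @ b) ! j = 0}" (is "_ = ?A' \<union> ?B'")
    unfolding L by (auto simp: not_less[symmetric])
  moreover have "?A' = ?A" by (intro Collect_cong ex_cong) (auto simp: nth_append list_update_append)
  moreover have "?B' = ?B"
  proof
    show "?B' \<subseteq> ?B"
    proof clarify
      fix j assume j: "length a \<le> j" "j < length (a @ b)" "(a @ b) ! j = 0"
      then show "\<exists>i. (a @ b)[j := bd_sign \<beta> (count_list (take (Suc j) (a @ b)) 0)] =
          a @ b[i := bd_sign \<beta> (count_list a 0 + count_list (take (Suc i) b) 0)] \<and> i < length b \<and> b ! i = 0"
        by (intro exI[of _ "j - length a"]) (auto simp: nth_append list_update_append count_list_append Suc_diff_le)
    qed
    show "?B \<subseteq> ?B'"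
    proof clarify
      fix j assume j: "j < length b" "b ! j = 0"
      then show "\<exists>i. a @ b[j := bd_sign \<beta> (count_list a 0 + count_list (take (Suc j) b) 0)] =
         (a @ b)[i := bd_sign \<beta> (count_list (take (Suc i) (a @ b)) 0)] \<and>
            length a \<le> i \<and> i < length (a @ b) \<and> (a @ b) ! i = 0"
        by (intro exI[of _ "j + length a"]) (auto simp: nth_append list_update_append count_list_append Suc_diff_le)
    qed
  qed
  ultimately show ?thesis by simp
qed

lemma cube_bd_insert:
  assumes "length a = j"
  shows "insert_letter \<alpha> j ` cube_bd \<beta> (a @ b) = cube_bd \<beta> (a @ letter \<alpha> # b)"
proof -
  have eq: "cube_bd \<beta> (a @ letter \<alpha> # b) =
     {a[i := bd_sign \<beta> (count_list (take (Suc i) a) 0)] @ letter \<alpha> # b | i. i < length a \<and> a ! i = 0} \<union>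
     {a @ letter \<alpha> # b[i := bd_sign \<beta> (count_list a 0 + count_list (take (Suc i) b) 0)] | i. i < length b \<and> b ! i = 0}"
  proof -
    have "{a @ (letter \<alpha> # b)[i := bd_sign \<beta> (count_list a 0 + count_list (take (Suc i) (letter \<alpha> # b)) 0)] | i.
         i < length (letter \<alpha> # b) \<and> (letter \<alpha> # b) ! i = 0} =
      {a @ letter \<alpha> # b[i := bd_sign \<beta> (count_list a 0 + count_list (take (Suc i) b) 0)] | i. i < length b \<and> b ! i = 0}"
      (is "?A = ?B")
    proof
      show "?A \<subseteq> ?B"
      proof clarify
        fix i assume "i < length (letter \<alpha> # b)" "(letter \<alpha> # b) ! i = 0"
        then show "\<exists>k. a @ (letter \<alpha> # b)[i := bd_sign \<beta> (count_list a 0 + count_list (take (Suc i) (letter \<alpha> # b)) 0)] =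
           a @ letter \<alpha> # b[k := bd_sign \<beta> (count_list a 0 + count_list (take (Suc k) b) 0)] \<and> k < length b \<and> b ! k = 0"
          by (cases i) auto
      qed
      show "?B \<subseteq> ?A"
      proof clarify
        fix i assume "i < length b" "b ! i = 0"
        then show "\<exists>k. a @ letter \<alpha> # b[i := bd_sign \<beta> (count_list a 0 + count_list (take (Suc i) b) 0)] =
           a @ (letter \<alpha> # b)[k := bd_sign \<beta> (count_list a 0 + count_list (take (Suc k) (letter \<alpha> # b)) 0)] \<and>
            k < length (letter \<alpha> # b) \<and> (letter \<alpha> # b) ! k = 0"
          by (intro exI[of _ "Suc i"]) auto
      qed
    qed
    then show ?thesis unfolding cube_bd_append by simp
  qed
  have img: "insert_letter \<alpha> j ` {f i @ g i | i. P i} = {f i @ letter \<alpha> # g i | i. P i}"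
    if "\<And>i. length (f i) = j" for f g :: "nat \<Rightarrow> int list" and P :: "nat \<Rightarrow> bool"
  proof -
    have "insert_letter \<alpha> j (f i @ g i) = f i @ letter \<alpha> # g i" for i
      using insert_letter_append that by metis
    then show ?thesis by (auto simp: image_iff) metis
  qed
  show ?thesis
    using assms by (subst eq, subst cube_bd_append, subst image_Un, intro arg_cong2[where f = "(\<union>)"] img) auto
qed

lemma cube_R_insert:
  assumes "length a = j" "a @ b \<in> cube_faces n"
  shows "insert_letter \<alpha> j ` cube_R (a @ b) = cube_R (a @ letter \<alpha> # b)"
proof
  show "insert_letter \<alpha> j ` cube_R (a @ b) \<subseteq> cube_R (a @ letter \<alpha> # b)"
  proof clarify
    fix v assume v: "v \<in> cube_R (a @ b)"
    then obtain a' b' where ab: "v = a' @ b'" "length a' = length a"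
        "list_all2 (\<lambda>a b. a = 0 \<or> a = b) a a'" "list_all2 (\<lambda>a b. a = 0 \<or> a = b) b b'"
      unfolding cube_R_def by (auto simp: list_all2_append1)
    have i: "insert_letter \<alpha> j v = a' @ letter \<alpha> # b'" using ab assms by (simp add: insert_letter_append)
    have "set (a' @ letter \<alpha> # b') \<subseteq> {-1, 0, 1}" "length (a' @ letter \<alpha> # b') = length (a @ letter \<alpha> # b)"
      using v ab list_all2_lengthD[OF ab(4)] letter_nonzero(2)[of \<alpha>] unfolding cube_R_def cube_faces_def by auto
    then show "insert_letter \<alpha> j v \<in> cube_R (a @ letter \<alpha> # b)"
      using ab unfolding i cube_R_def cube_faces_def by (auto simp: list_all2_appendI)
  qed
  show "cube_R (a @ letter \<alpha> # b) \<subseteq> insert_letter \<alpha> j ` cube_R (a @ b)"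
  proof
    fix v assume v: "v \<in> cube_R (a @ letter \<alpha> # b)"
    then obtain a' b' where ab: "v = a' @ letter \<alpha> # b'" "length a' = length a"
        "list_all2 (\<lambda>a b. a = 0 \<or> a = b) a a'" "list_all2 (\<lambda>a b. a = 0 \<or> a = b) b b'"
      unfolding cube_R_def by (auto simp: list_all2_append1 list_all2_Cons1)
    have "a' @ b' \<in> cube_R (a @ b)"
      using v ab unfolding cube_R_def cube_faces_def by (auto simp: list_all2_appendI)
    moreover have "v = insert_letter \<alpha> j (a' @ b')" using ab assms by (simp add: insert_letter_append)
    ultimately show "v \<in> insert_letter \<alpha> j ` cube_R (a @ b)" by blast
  qed
qed

lemma cube_bd_mem:
  assumes "x \<in> cube_faces n" "y \<in> cube_bd \<alpha> x"
  shows "y \<in> cube_faces n" "Suc (cube_dim y) = cube_dim x"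
proof -
  obtain j where j: "j < length x" "x ! j = 0" "y = x[j := bd_sign \<alpha> (count_list (take (Suc j) x) 0)]"
    using assms(2) by (auto simp: cube_bd_def bd_sign_def Let_def)
  show "y \<in> cube_faces n"
    using assms(1) j bd_sign_mem[of \<alpha> "count_list (take (Suc j) x) 0"] set_update_subset_insert
    by (fastforce simp: cube_faces_def)
  have "bd_sign \<alpha> (count_list (take (Suc j) x) 0) \<noteq> 0"
    using bd_sign_mem[of \<alpha> "count_list (take (Suc j) x) 0"] by auto
  then show "Suc (cube_dim y) = cube_dim x"
    using count_list_update_zero[OF j(1,2)] j(3) by (simp add: cube_dim_def)
qed

lemma face_map_insert_letter:
  assumes I: "is_cubes I" and j: "j \<le> n"
  shows "face_map (cube_faces n) cube_dim cube_R cube_bd (I n)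
     (cube_faces (Suc n)) cube_dim cube_R cube_bd (I (Suc n)) (insert_letter \<alpha> j) (Suc n)"
proof unfold_locales
  show "face_omegacat (cube_faces n) cube_dim cube_R cube_bd (I n)"
    "face_omegacat (cube_faces (Suc n)) cube_dim cube_R cube_bd (I (Suc n))"
    using I by (auto simp: is_cubes_def)
next
  fix x assume x: "x \<in> cube_faces n"
  then obtain a b where ab: "x = a @ b" "length a = j"
    using j by (intro that[of "take j x" "drop j x"]) (auto simp: cube_faces_def)
  have i: "insert_letter \<alpha> j x = a @ letter \<alpha> # b" using insert_letter_append[OF ab(2)[symmetric]] ab(1) by simp
  show "insert_letter \<alpha> j x \<in> cube_faces (Suc n)"
    using x ab letter_nonzero(2)[of \<alpha>] unfolding i by (auto simp: cube_faces_def)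
  show "cube_dim (insert_letter \<alpha> j x) = cube_dim x"
    unfolding i cube_dim_def by (simp add: ab count_list_append)
  show "insert_letter \<alpha> j ` cube_R x = cube_R (insert_letter \<alpha> j x)"
    unfolding i using ab cube_R_insert x by simp
  show "insert_letter \<alpha> j ` cube_bd \<beta> x = cube_bd \<beta> (insert_letter \<alpha> j x)" for \<beta>
    unfolding i using ab cube_bd_insert by simp
  show "x \<in> cube_R x" using x by (auto simp: cube_R_def cube_faces_def list.rel_refl)
  show "cube_R x \<subseteq> cube_faces n" using x by (auto simp: cube_R_def cube_faces_def)
  show "cube_bd \<beta> x \<subseteq> cube_faces n" for \<beta> using cube_bd_mem[OF x] by blast
  show "cube_dim z < cube_dim x" if "y \<in> cube_bd \<beta> x" "z \<in> cube_R y" for \<beta> y z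
    using cube_bd_mem(2)[OF x that(1)] cube_R_dim[OF that(2)] by (simp add: cube_dim_def)
  show "cube_dim x < Suc n" using x count_le_length[of x 0] by (auto simp: cube_dim_def cube_faces_def)
qed

lemma vertex_image_map:
  assumes "sorted_wrt (<) l" "strict_mono h" shows "vertex_image h l = map h l"
proof -
  have "sorted_wrt (<) (map h l)"
    using assms by (auto simp: sorted_wrt_map strict_mono_less elim: sorted_wrt_mono_rel[rotated])
  then show ?thesis
    unfolding vertex_image_def using sorted_list_of_set.idem_if_sorted_distinct[of "map h l"]
    by (simp add: strict_sorted_iff)
qed

lemma strict_mono_coface: "strict_mono (coface i)"
  by (rule strict_monoI) (auto simp: coface_def)

lemma subseq_sorted:
  assumes "subseq k l" "sorted_wrt (<) l" shows "sorted_wrt (<) (k :: nat list)"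
  using assms by (induction rule: list_emb.induct) (auto dest: list_emb_set)

lemma simplex_bd_mem:
  assumes "x \<in> simplex_faces n" "simplex_dim x = Suc p" "y \<in> simplex_bd \<alpha> x"
  shows "y \<in> simplex_faces n" "length y < length x"
proof -
  obtain j where j: "j < length x" "y = take j x @ drop (Suc j) x"
    using assms(3) by (auto simp: simplex_bd_def)
  have "subseq y x"
    using j id_take_nth_drop[OF j(1)]
      list_emb_append_mono[of "(=)" "take j x" "take j x" "drop (Suc j) x" "x ! j # drop (Suc j) x"]
    by (simp add: list_emb_Cons)
  show "length y < length x" using j by simp
  have "y \<noteq> []" using j assms(2) by (auto simp: simplex_dim_def)
  moreover have "set y \<subseteq> {0..n}"
    using assms(1) \<open>subseq y x\<close> by (auto simp: simplex_faces_def dest: list_emb_set)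
  ultimately show "y \<in> simplex_faces n"
    using subseq_sorted[OF \<open>subseq y x\<close>] assms(1) by (auto simp: simplex_faces_def)
qed

lemma simplex_R_faces: "x \<in> simplex_faces n \<Longrightarrow> simplex_R x \<subseteq> simplex_faces n"
  using subseq_sorted by (auto simp: simplex_R_def simplex_faces_def dest: list_emb_set)

lemma face_map_coface:
  assumes I: "is_simplices \<Delta>"
  shows "face_map (simplex_faces n) simplex_dim simplex_R simplex_bd (\<Delta> n)
     (simplex_faces (Suc n)) simplex_dim simplex_R simplex_bd (\<Delta> (Suc n)) (vertex_image (coface i)) (Suc n)"
proof unfold_locales
  show "face_omegacat (simplex_faces n) simplex_dim simplex_R simplex_bd (\<Delta> n)"
    "face_omegacat (simplex_faces (Suc n)) simplex_dim simplex_R simplex_bd (\<Delta> (Suc n))"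
    using I by (auto simp: is_simplices_def)
next
  have vi: "vertex_image (coface i) x = map (coface i) x" if "x \<in> simplex_faces n" for x
    using that vertex_image_map strict_mono_coface by (auto simp: simplex_faces_def)
  fix x assume x: "x \<in> simplex_faces n"
  have sorted: "sorted_wrt (<) (map (coface i) x)"
    using x strict_mono_coface
    by (auto simp: simplex_faces_def sorted_wrt_map strict_mono_less elim: sorted_wrt_mono_rel[rotated])
  show "vertex_image (coface i) x \<in> simplex_faces (Suc n)"
    using x sorted unfolding vi[OF x] by (auto simp: simplex_faces_def coface_def)
  show "simplex_dim (vertex_image (coface i) x) = simplex_dim x"
    unfolding vi[OF x] by (simp add: simplex_dim_def)
  have "vertex_image (coface i) ` simplex_R x = map (coface i) ` simplex_R x"
    using simplex_R_faces[OF x] vi by (intro image_cong) auto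
  also have "\<dots> = simplex_R (map (coface i) x)"
    by (auto simp: simplex_R_def subseq_conv_nths nths_map image_iff)
  finally show "vertex_image (coface i) ` simplex_R x = simplex_R (vertex_image (coface i) x)"
    using vi[OF x] by simp
  show "x \<in> simplex_R x" using x by (auto simp: simplex_R_def simplex_faces_def)
  show "simplex_R x \<subseteq> simplex_faces n" using simplex_R_faces[OF x] .
  show "simplex_dim x < Suc n"
  proof -
    have "card (set x) \<le> card {0..n}" using x by (intro card_mono) (auto simp: simplex_faces_def)
    moreover have "card (set x) = length x"
      using x by (auto simp: simplex_faces_def strict_sorted_iff distinct_card)
    ultimately show ?thesis by (auto simp: simplex_dim_def)
  qed
  fix p \<beta> assume p: "simplex_dim x = Suc p"
  show "simplex_bd \<beta> x \<subseteq> simplex_faces n" using simplex_bd_mem[OF x p] by blast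
  have "vertex_image (coface i) ` simplex_bd \<beta> x = map (coface i) ` simplex_bd \<beta> x"
    using simplex_bd_mem[OF x p] vi by (intro image_cong) auto
  also have "\<dots> = simplex_bd \<beta> (map (coface i) x)"
    by (force simp: simplex_bd_def image_iff take_map drop_map)
  finally show "vertex_image (coface i) ` simplex_bd \<beta> x = simplex_bd \<beta> (vertex_image (coface i) x)"
    using vi[OF x] by simp
  show "simplex_dim z < simplex_dim x" if "y \<in> simplex_bd \<beta> x" "z \<in> simplex_R y" for y z
  proof -
    have "length z \<le> length y" "z \<noteq> []" using that(2) by (auto simp: simplex_R_def list_emb_length)
    then show ?thesis
      using simplex_bd_mem(2)[OF x p that(1)] p by (cases z) (auto simp: simplex_dim_def)
  qed
qed

lemma coface_image_closed:
  assumes "is_simplices \<Delta>" "X \<in> mor (\<Delta> n)"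
  shows "vertex_image (coface i) ` X \<in> mor (\<Delta> (Suc n))"
proof -
  interpret face_map "simplex_faces n" simplex_dim simplex_R simplex_bd "\<Delta> n"
     "simplex_faces (Suc n)" simplex_dim simplex_R simplex_bd "\<Delta> (Suc n)" "vertex_image (coface i)" "Suc n"
    by (rule face_map_coface) fact
  show ?thesis using image_closed assms by blast
qed

lemma insert_letter_image_closed:
  assumes "is_cubes I" "X \<in> mor (I n)" "j \<le> n"
  shows "insert_letter \<alpha> j ` X \<in> mor (I (Suc n))"
proof -
  interpret face_map "cube_faces n" cube_dim cube_R cube_bd "I n"
     "cube_faces (Suc n)" cube_dim cube_R cube_bd "I (Suc n)" "insert_letter \<alpha> j" "Suc n"
    by (rule face_map_insert_letter) fact+
  show ?thesis using image_closed assms by blast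
qed

section \<open>Functoriality of the nerve complexes\<close>

lemma frag_extend_hom:
  assumes "\<And>g. g \<in> S \<Longrightarrow> F g \<in> carrier (free_Abelian_group T)"
  shows "frag_extend F \<in> hom (free_Abelian_group S) (free_Abelian_group T)"
  using assms keys_frag_extend[of F] by (fastforce simp: hom_def frag_extend_add)

text \<open>
  Two composites of additive maps agree once they agree on generators; this is how the chain map conditions
  on complexes of free groups are checked.
\<close>

lemma frag_extend_comp_eq:
  assumes "x \<in> carrier (free_Abelian_group S)"
    and "\<And>g. g \<in> S \<Longrightarrow> frag_extend F (G g) = frag_extend F' (G' g)"
  shows "frag_extend F (frag_extend G x) = frag_extend F' (frag_extend G' x)"
proof -
  have "Poly_Mapping.keys x \<subseteq> S" using assms(1) by simp
  then show ?thesis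
    by (induction x rule: frag_induction) (simp_all add: assms(2) frag_extend_diff)
qed

lemma subgroup_free_Abelian_group:
  assumes "S \<subseteq> T" shows "subgroup (carrier (free_Abelian_group S)) (free_Abelian_group T)"
proof (rule group.subgroupI)
  show "carrier (free_Abelian_group S) \<noteq> {}" by (metis group.is_monoid group_free_Abelian_group empty_iff monoid.one_closed)
  show "inv\<^bsub>free_Abelian_group T\<^esub> a \<in> carrier (free_Abelian_group S)"
    if "a \<in> carrier (free_Abelian_group S)" for a
    using that assms by (subst inv_free_Abelian_group) auto
  show "a \<otimes>\<^bsub>free_Abelian_group T\<^esub> b \<in> carrier (free_Abelian_group S)"
    if "a \<in> carrier (free_Abelian_group S)" "b \<in> carrier (free_Abelian_group S)" for a b
    using that keys_add[of a b] by auto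
qed (use assms in auto)

lemma nerve_complex_simps:
  "grp (nerve_complex N) n = free_Abelian_group (nerve_gens N n)"
  "bdy (nerve_complex N) n = frag_extend (nerve_bdy N n)"
  by (simp_all add: nerve_complex_def)

lemma thin_gens_subset: "thin_gens C N n \<subseteq> nerve_gens N n"
  by (induction C N n rule: thin_gens.induct) auto

text \<open>
  The thin chains form a subgroup and so does their image under the differential, as the nerve complex
  is a chain complex.
\<close>

lemma reduced_rel_subgroup:
  assumes "chain_complex (nerve_complex N)"
  shows "subgroup (reduced_rel C N n) (grp (nerve_complex N) n)"
proof -
  interpret G: comm_group "grp (nerve_complex N) n" using assms by (rule chain_complexD)
  interpret h: group_hom "grp (nerve_complex N) (Suc n)" "grp (nerve_complex N) n" "bdy (nerve_complex N) n"
    using chain_complexD[OF assms] by (simp add: group_hom_def group_hom_axioms_def)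
  have t: "subgroup (thin C N k) (grp (nerve_complex N) k)" for k
    unfolding thin_def nerve_complex_simps
    by (rule subgroup_free_Abelian_group) (rule thin_gens_subset)
  show ?thesis
    unfolding reduced_rel_def
    by (rule G.mult_subgroups[OF t h.subgroup_img_is_subgroup[OF t]])
qed

fun gen_map :: "('s \<Rightarrow> 't) \<Rightarrow> ('o \<Rightarrow> 'p) \<Rightarrow> ('s, 'o) gen \<Rightarrow> ('t, 'p) gen" where
  "gen_map m a (Aug x) = Aug (a x)"
| "gen_map m a (Cell x) = Cell (m x)"

text \<open>
  A map of nerves, with the compatibility with evaluation that makes it preserve thin simplices.
\<close>

locale nerve_map =
  fixes C :: "'u omegacat" and N :: "('s, 'o, 'u) nerve" and D :: "'v omegacat"
    and N' :: "('t, 'p, 'v) nerve" and m :: "nat \<Rightarrow> 's \<Rightarrow> 't" and a :: "'o \<Rightarrow> 'p"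
  assumes N: "chain_complex (nerve_complex N)" and N': "chain_complex (nerve_complex N')"
    and simplex: "x \<in> simplices N n \<Longrightarrow> m n x \<in> simplices N' n"
    and aug: "y \<in> aug_simplices N \<Longrightarrow> a y \<in> aug_simplices N'"
    and face: "x \<in> simplices N (Suc n) \<Longrightarrow> i \<le> Suc n \<Longrightarrow> face N' n i (m (Suc n) x) = m n (face N n i x)"
    and aug_face: "x \<in> simplices N 0 \<Longrightarrow> aug_face N' (m 0 x) = a (aug_face N x)"
    and ev_tr: "x \<in> simplices N n \<Longrightarrow> ev N n x \<in> tr k (path C) \<Longrightarrow> ev N' n (m n x) \<in> tr k (path D)"
begin

definition chain :: "nat \<Rightarrow> (('s, 'o) gen \<Rightarrow>\<^sub>0 int) \<Rightarrow> (('t, 'p) gen \<Rightarrow>\<^sub>0 int)" where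
  "chain n = frag_extend (\<lambda>g. frag_of (gen_map (m (n - 1)) a g))"

lemma chain_map: "chain_map (nerve_complex N) (nerve_complex N') chain"
  unfolding chain_map_def nerve_complex_simps
proof (intro conjI allI ballI)
  fix n
  show "chain n \<in> hom (free_Abelian_group (nerve_gens N n)) (free_Abelian_group (nerve_gens N' n))"
    unfolding chain_def using simplex aug by (intro frag_extend_hom) (cases n; auto simp: keys_frag_of)
  fix x assume "x \<in> carrier (free_Abelian_group (nerve_gens N (Suc n)))"
  then show "chain n (frag_extend (nerve_bdy N n) x) = frag_extend (nerve_bdy N' n) (chain (Suc n) x)"
    unfolding chain_def
  proof (rule frag_extend_comp_eq)
    fix g assume "g \<in> nerve_gens N (Suc n)"
    then obtain s where s: "g = Cell s" "s \<in> simplices N n" by auto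
    show "frag_extend (\<lambda>g. frag_of (gen_map (m (n - 1)) a g)) (nerve_bdy N n g) =
        frag_extend (nerve_bdy N' n) (frag_of (gen_map (m (Suc n - 1)) a g))"
      using s by (cases n) (simp_all add: frag_extend_sum frag_extend_add frag_extend_cmul o_def face aug_face del: minus_frag_cmul)
  qed
qed

lemma chain_thin: "x \<in> thin C N n \<Longrightarrow> chain n x \<in> thin D N' n"
proof -
  have "chain n \<in> hom (free_Abelian_group (thin_gens C N n)) (free_Abelian_group (thin_gens D N' n))"
    unfolding chain_def
  proof (rule frag_extend_hom)
    fix g assume g: "g \<in> thin_gens C N n"
    then obtain k where "n = Suc (Suc k)" by (cases "(C, N, n)" rule: thin_gens.cases) auto
    with g show "frag_of (gen_map (m (n - 1)) a g) \<in> carrier (free_Abelian_group (thin_gens D N' n))"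
      using simplex ev_tr by (auto simp: keys_frag_of)
  qed
  then show "x \<in> thin C N n \<Longrightarrow> chain n x \<in> thin D N' n"
    unfolding thin_def by (rule hom_in_carrier)
qed

lemma chain_reduced_rel: "chain n ` reduced_rel C N n \<subseteq> reduced_rel D N' n"
proof clarify
  fix x assume "x \<in> reduced_rel C N n"
  then obtain t b where tb: "t \<in> thin C N n" "b \<in> thin C N (Suc n)" "x = t + bdy (nerve_complex N) n b"
    unfolding reduced_rel_def set_mult_def by (auto simp: nerve_complex_simps)
  have "b \<in> carrier (grp (nerve_complex N) (Suc n))"
    using tb(2) thin_gens_subset[of C N "Suc n"] by (auto simp: thin_def nerve_complex_simps)
  then have "chain n (bdy (nerve_complex N) n b) = bdy (nerve_complex N') n (chain (Suc n) b)"
    using chain_mapD(3)[OF chain_map] by blast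
  then have "chain n x = chain n t + bdy (nerve_complex N') n (chain (Suc n) b)"
    using tb(3) by (simp add: chain_def frag_extend_add)
  then show "chain n x \<in> reduced_rel D N' n"
    using chain_thin[OF tb(1)] chain_thin[OF tb(2)]
    unfolding reduced_rel_def set_mult_def by (auto simp: nerve_complex_simps)
qed

lemma chain_map_reduced:
  assumes "chain_complex (reduced_complex C N)" "chain_complex (reduced_complex D N')"
  shows "chain_map (reduced_complex C N) (reduced_complex D N')
     (\<lambda>n. coset_map (grp (nerve_complex N') n) (reduced_rel D N' n) (chain n))"
proof -
  interpret quotient_map "nerve_complex N" "reduced_rel C N" "nerve_complex N'" "reduced_rel D N'" chain
    by (intro quotient_map.intro chain_complexD N N' reduced_rel_subgroup chain_map chain_reduced_rel
        assms[unfolded reduced_complex_def])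
  show ?thesis using chain_map_quotient by (simp add: reduced_complex_def)
qed

text \<open>
  Cancel the reduction of \<open>N'\<close> in the naturality square of the reductions.
\<close>

lemma quasi_iso_of_reduced:
  assumes redN: "quasi_iso (nerve_complex N) (reduced_complex C N) (reduction C N)"
    and redN': "quasi_iso (nerve_complex N') (reduced_complex D N') (reduction D N')"
    and q: "quasi_iso (reduced_complex C N) (reduced_complex D N')
       (\<lambda>n. coset_map (grp (nerve_complex N') n) (reduced_rel D N' n) (chain n))"
  shows "quasi_iso (nerve_complex N) (nerve_complex N') chain"
proof (rule quasi_iso_cancel_left[OF _ redN' chain_map])
  show "quasi_iso (nerve_complex N) (reduced_complex D N') (\<lambda>n x. reduction D N' n (chain n x))"
  proof (rule quasi_iso_cong[OF quasi_iso_compose[OF redN q]])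
    fix n x assume "x \<in> carrier (grp (nerve_complex N) n)"
    then show "reduction D N' n (chain n x) = coset_map (grp (nerve_complex N') n) (reduced_rel D N' n)
        (chain n) (reduction C N n x)"
      unfolding reduction_def quotient_proj_def
      by (intro coset_map_rcos[symmetric] chain_complexD[OF N] chain_complexD[OF N']
          reduced_rel_subgroup N N' chain_mapD[OF chain_map] chain_reduced_rel)
  qed
qed

end

text \<open>
  The values at cells outside the domain are \<open>undefined\<close>, so faces of simplices are natural only because
  the direct image of a cell under a coface is a cell.
\<close>

lemma postcompose_precompose:
  assumes "\<And>X. X \<in> mor A \<Longrightarrow> \<phi> ` X \<in> mor B"
  shows "precompose A \<phi> (postcompose B f x) = postcompose A f (precompose A \<phi> x)"
  using assms by (auto simp: precompose_def postcompose_def restrict_def fun_eq_iff)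

lemma postcompose_omega_hom:
  assumes "x \<in> omega_hom A C" "omega_category A" "omega_functor C D f"
  shows "postcompose A f x \<in> omega_hom A D"
proof -
  interpret A: omega_cat A by (rule omega_cat.intro) fact
  have "omega_functor A C x" using assms(1) by (simp add: omega_hom_def)
  then have "omega_functor A D (\<lambda>X. f (x X))" using assms(3) by (rule omega_functor_compose)
  then have "omega_functor A D (postcompose A f x)"
    using A.dd_closed A.cmp_closed by (auto simp: omega_functor_def postcompose_def composable_def)
  then show ?thesis by (simp add: omega_hom_def postcompose_def)
qed

lemma tr_functor:
  assumes "omega_category C" "omega_category D" "omega_functor C D f" "x \<in> tr k C"
  shows "f x \<in> tr k D"
  using assms omega_functor_mdim[OF assms(1-3)] omega_functorD(1)[OF assms(3)] by (auto simp: tr_def)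

locale nc_functor =
  fixes C D :: "'u omegacat" and f :: "'u \<Rightarrow> 'u"
  assumes nc: "non_contracting C" "non_contracting D" and f_nc: "non_contracting_functor C D f"
begin

sublocale C: non_contracting_cat C by unfold_locales (rule nc)
sublocale D: non_contracting_cat D by unfold_locales (rule nc)

lemma f: "omega_functor C D f"
  using f_nc by (simp add: non_contracting_functor_def)

lemmas f_mor = omega_functorD(1)[OF f] and f_dd = omega_functorD(2)[OF f]
  and f_cmp = omega_functorD(3)[OF f] and f_composable = omega_functorD(4)[OF f]

lemma f_path: "omega_functor (path C) (path D) f"
  by (rule omega_functor_path[OF nc f_nc])

lemma f_mdim_0: "x \<in> mor C \<Longrightarrow> mdim C x = 0 \<Longrightarrow> mdim D (f x) = 0"
  using omega_functor_mdim[OF C.omega_category D.omega_category f, of x 0] by simp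

lemma nerve_map_gl:
  assumes \<Delta>: "is_simplices \<Delta>" and "chain_complex (C_gl \<Delta> C)" "chain_complex (C_gl \<Delta> D)"
  shows "nerve_map C (gl_nerve \<Delta> C) D (gl_nerve \<Delta> D) (gl_nerve_map \<Delta> f) (map_prod f f)"
proof
  have Dl: "face_omegacat (simplex_faces n) simplex_dim simplex_R simplex_bd (\<Delta> n)" for n
    using \<Delta> by (simp add: is_simplices_def)
  note om = face_omegacat_facts(1)[OF Dl]
  have top: "simplex_R [0..<Suc n] \<in> mor (\<Delta> n)" for n
    by (rule face_omegacat_facts(3)[OF Dl]) (auto simp: simplex_faces_def simp del: upt_Suc)
  have ev: "gl_ev n (postcompose (\<Delta> n) f x) = f (gl_ev n x)" for n x
    using top[of n] by (simp add: gl_ev_def postcompose_def)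
  have mem: "gl_ev n x \<in> mor (path C)" if "x \<in> omega_hom (\<Delta> n) (path C)" for n x
    using that top by (simp add: gl_ev_def omega_hom_def omega_functor_def)
  show "chain_complex (nerve_complex (gl_nerve \<Delta> C))" "chain_complex (nerve_complex (gl_nerve \<Delta> D))"
    using assms by (auto simp: C_gl_def)
  show "gl_nerve_map \<Delta> f n x \<in> simplices (gl_nerve \<Delta> D) n" if "x \<in> simplices (gl_nerve \<Delta> C) n" for n x
    using that postcompose_omega_hom[OF _ om f_path] by (simp add: gl_nerve_def gl_nerve_map_def)
  show "map_prod f f y \<in> aug_simplices (gl_nerve \<Delta> D)" if "y \<in> aug_simplices (gl_nerve \<Delta> C)" for y
    using that f_mor f_mdim_0 by (auto simp: gl_nerve_def mor_dim_def)
  show "face (gl_nerve \<Delta> D) n i (gl_nerve_map \<Delta> f (Suc n) x) = gl_nerve_map \<Delta> f n (face (gl_nerve \<Delta> C) n i x)"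
    for n i x
    using postcompose_precompose[OF coface_image_closed[OF \<Delta>]]
    by (simp add: gl_nerve_def gl_nerve_map_def)
  show "aug_face (gl_nerve \<Delta> D) (gl_nerve_map \<Delta> f 0 x) = map_prod f f (aug_face (gl_nerve \<Delta> C) x)"
    if "x \<in> simplices (gl_nerve \<Delta> C) 0" for x
    using mem[of x 0] that by (simp add: gl_nerve_def gl_nerve_map_def ev f_dd path_simps)
  show "ev (gl_nerve \<Delta> D) n (gl_nerve_map \<Delta> f n x) \<in> tr k (path D)"
    if "ev (gl_nerve \<Delta> C) n x \<in> tr k (path C)" for n x k
    using that tr_functor[OF C.omega_category_path D.omega_category_path f_path]
    by (simp add: gl_nerve_def gl_nerve_map_def ev)
qed

lemma nerve_map_sc:
  assumes I: "is_cubes I" and "chain_complex (C_sc I \<alpha> C)" "chain_complex (C_sc I \<alpha> D)"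
  shows "nerve_map C (sc_nerve I \<alpha> C) D (sc_nerve I \<alpha> D) (sc_nerve_map I f) f"
proof
  have Dl: "face_omegacat (cube_faces n) cube_dim cube_R cube_bd (I n)" for n
    using I by (simp add: is_cubes_def)
  note om = face_omegacat_facts(1)[OF Dl]
  have top: "cube_R (replicate (Suc n) 0) \<in> mor (I (Suc n))" for n
    by (rule face_omegacat_facts(3)[OF Dl]) (auto simp: cube_faces_def)
  have ev: "sc_ev n (postcompose (I (Suc n)) f x) = f (sc_ev n x)" for n x
    using top[of n] by (simp add: sc_ev_def postcompose_def)
  have mem: "sc_ev n x \<in> mor C" if "x \<in> omega_hom (I (Suc n)) C" for n x
    using that top[of n] unfolding sc_ev_def omega_hom_def omega_functor_def by blast
  show "chain_complex (nerve_complex (sc_nerve I \<alpha> C))" "chain_complex (nerve_complex (sc_nerve I \<alpha> D))"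
    using assms by (auto simp: C_sc_def)
  show "sc_nerve_map I f n x \<in> simplices (sc_nerve I \<alpha> D) n" if x: "x \<in> simplices (sc_nerve I \<alpha> C) n" for n x
  proof -
    have h: "x \<in> omega_hom (I (Suc n)) C" using x by (simp add: sc_nerve_def)
    then have xm: "x u \<in> mor C" if "u \<in> mor (I (Suc n))" for u
      using that by (simp add: omega_hom_def omega_functor_def)
    show ?thesis
      using x postcompose_omega_hom[OF h om f] f_nc xm
      by (auto simp: sc_nerve_def sc_nerve_map_def non_contracting_functor_def postcompose_def)
  qed
  show "f y \<in> aug_simplices (sc_nerve I \<alpha> D)" if "y \<in> aug_simplices (sc_nerve I \<alpha> C)" for y
    using that f_mor f_mdim_0 by (auto simp: sc_nerve_def mor_dim_def)
  show "face (sc_nerve I \<alpha> D) n i (sc_nerve_map I f (Suc n) x) = sc_nerve_map I f n (face (sc_nerve I \<alpha> C) n i x)"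
    if "i \<le> Suc n" for n i x
    using postcompose_precompose[OF insert_letter_image_closed[OF I _ that]]
    by (simp add: sc_nerve_def sc_nerve_map_def)
  show "aug_face (sc_nerve I \<alpha> D) (sc_nerve_map I f 0 x) = f (aug_face (sc_nerve I \<alpha> C) x)"
    if "x \<in> simplices (sc_nerve I \<alpha> C) 0" for x
    using mem[of x 0] that by (simp add: sc_nerve_def sc_nerve_map_def ev f_dd)
  show "ev (sc_nerve I \<alpha> D) n (sc_nerve_map I f n x) \<in> tr k (path D)"
    if "ev (sc_nerve I \<alpha> C) n x \<in> tr k (path C)" for n x k
    using that tr_functor[OF C.omega_category_path D.omega_category_path f_path]
    by (simp add: sc_nerve_def sc_nerve_map_def ev)
qed

end

section \<open>Generation of the completion\<close>

text \<open>
  An inverse for one composition of \<open>C\<close> itself; \<open>kan_iff\<close> expresses the groupoid condition on the path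
  \<open>\<omega>\<close>-category by it, with indices shifted by one.
\<close>

definition inverse_at :: "'a omegacat \<Rightarrow> nat \<Rightarrow> 'a \<Rightarrow> 'a \<Rightarrow> bool" where
  "inverse_at C r x x' \<longleftrightarrow> composable C r x x' \<and> composable C r x' x \<and>
     cmp C r x x' = dd C Neg r x \<and> cmp C r x' x = dd C Pos r x"

lemma (in non_contracting_cat) kan_iff:
  "kan C \<longleftrightarrow> (\<forall>r\<ge>1. \<forall>x\<in>mor C. mdim C x \<ge> 2 \<longrightarrow> (\<exists>x'. inverse_at C r x x'))"
proof -
  have pos: "mdim C x' \<ge> 1" if "composable C (Suc r) x x'" "mdim C x \<ge> 2" for r x x'
    using composable_mdim_Suc[OF that(1)] that(2) by linarith
  have dim: "mdim (path C) x \<ge> 1 \<longleftrightarrow> mdim C x \<ge> 2" if "x \<in> mor C" "mdim C x \<ge> 1" for x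
    using mdim_path_le_iff[of x 0] that by (auto simp: path_simps not_le)
  have "kan C \<longleftrightarrow> (\<forall>r. \<forall>x\<in>mor (path C). mdim (path C) x \<ge> 1 \<longrightarrow>
      (\<exists>x'. composable (path C) r x x' \<and> composable (path C) r x' x \<and>
          cmp (path C) r x x' = dd (path C) Neg r x \<and> dd (path C) Neg r x = dd (path C) Pos r x' \<and>
          cmp (path C) r x' x = dd (path C) Neg r x' \<and> dd (path C) Neg r x' = dd (path C) Pos r x))"
    using non_contracting omega_category_path by (simp add: kan_def globular_groupoid_def)
  also have "\<dots> \<longleftrightarrow> (\<forall>r. \<forall>x\<in>mor C. mdim C x \<ge> 2 \<longrightarrow> (\<exists>x'. inverse_at C (Suc r) x x'))"
  proof (intro all_cong1 iffI ballI impI)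
    fix r x
    assume a: "\<forall>x\<in>mor (path C). mdim (path C) x \<ge> 1 \<longrightarrow>
      (\<exists>x'. composable (path C) r x x' \<and> composable (path C) r x' x \<and>
          cmp (path C) r x x' = dd (path C) Neg r x \<and> dd (path C) Neg r x = dd (path C) Pos r x' \<and>
          cmp (path C) r x' x = dd (path C) Neg r x' \<and> dd (path C) Neg r x' = dd (path C) Pos r x)"
      and x: "x \<in> mor C" "mdim C x \<ge> 2"
    have "x \<in> mor (path C)" "mdim (path C) x \<ge> 1" using x dim[of x] by (auto simp: path_simps)
    then obtain x' where "composable (path C) r x x' \<and> composable (path C) r x' x \<and>
          cmp (path C) r x x' = dd (path C) Neg r x \<and> dd (path C) Neg r x = dd (path C) Pos r x' \<and>
          cmp (path C) r x' x = dd (path C) Neg r x' \<and> dd (path C) Neg r x' = dd (path C) Pos r x"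
      using a by blast
    then have "inverse_at C (Suc r) x x'"
      by (auto simp: inverse_at_def composable_path path_simps)
    then show "\<exists>x'. inverse_at C (Suc r) x x'" ..
  next
    fix r x
    assume a: "\<forall>x\<in>mor C. mdim C x \<ge> 2 \<longrightarrow> (\<exists>x'. inverse_at C (Suc r) x x')"
      and x: "x \<in> mor (path C)" "mdim (path C) x \<ge> 1"
    then have x': "x \<in> mor C" "mdim C x \<ge> 2" using dim[of x] by (auto simp: path_simps)
    then obtain x' where i: "inverse_at C (Suc r) x x'" using a by blast
    then have "mdim C x' \<ge> 1" using pos x' by (auto simp: inverse_at_def)
    then show "\<exists>x'. composable (path C) r x x' \<and> composable (path C) r x' x \<and>
          cmp (path C) r x x' = dd (path C) Neg r x \<and> dd (path C) Neg r x = dd (path C) Pos r x' \<and>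
          cmp (path C) r x' x = dd (path C) Neg r x' \<and> dd (path C) Neg r x' = dd (path C) Pos r x"
      using i x' by (intro exI[of _ x']) (auto simp: inverse_at_def composable_path path_simps composable_def)
  qed
  also have "\<dots> \<longleftrightarrow> (\<forall>r\<ge>1. \<forall>x\<in>mor C. mdim C x \<ge> 2 \<longrightarrow> (\<exists>x'. inverse_at C r x x'))"
    by (metis One_nat_def Suc_le_D le_add1 plus_1_eq_Suc)
  finally show ?thesis .
qed

text \<open>
  Inverses are taken along compositions of positive index only, since it is the path \<open>\<omega>\<close>-category that
  becomes a groupoid.
\<close>

inductive_set groupoid_span :: "'a omegacat \<Rightarrow> 'a set \<Rightarrow> 'a set" for H S where
  base: "x \<in> S \<Longrightarrow> x \<in> groupoid_span H S"
| cmp: "x \<in> groupoid_span H S \<Longrightarrow> y \<in> groupoid_span H S \<Longrightarrow> composable H p x y \<Longrightarrow> cmp H p x y \<in> groupoid_span H S"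
| inv: "x \<in> groupoid_span H S \<Longrightarrow> r \<ge> 1 \<Longrightarrow> inverse_at H r x x' \<Longrightarrow> x' \<in> groupoid_span H S"

lemma (in omega_cat) inverse_at_dd:
  assumes i: "inverse_at C r x x'"
  shows "m < r \<Longrightarrow> dd C \<alpha> m x' = dd C \<alpha> m x" "dd C Neg r x' = dd C Pos r x" "dd C Pos r x' = dd C Neg r x"
    "r < m \<Longrightarrow> inverse_at C r (dd C \<alpha> m x) (dd C \<alpha> m x')"
proof -
  have c: "composable C r x x'" "composable C r x' x" "x \<in> mor C" "x' \<in> mor C"
    using i by (auto simp: inverse_at_def composable_def)
  show "m < r \<Longrightarrow> dd C \<alpha> m x' = dd C \<alpha> m x" using composable_low[OF c(1)] by simp
  show "dd C Neg r x' = dd C Pos r x" "dd C Pos r x' = dd C Neg r x" using c by (auto simp: composable_def)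
  show "inverse_at C r (dd C \<alpha> m x) (dd C \<alpha> m x')" if m: "r < m"
    using i m c dd_cmp[OF c(1), of m \<alpha>] dd_cmp[OF c(2), of m \<alpha>] by (auto simp: inverse_at_def)
qed

text \<open>
  The boundary of an inverse is a boundary of the given cell, or an inverse of one.
\<close>

lemma (in omega_cat) groupoid_span_dd:
  assumes S: "S \<subseteq> mor C" "\<And>\<alpha> m x. x \<in> S \<Longrightarrow> dd C \<alpha> m x \<in> S" and x: "x \<in> groupoid_span C S"
  shows "x \<in> mor C \<and> (\<forall>\<alpha> m. dd C \<alpha> m x \<in> groupoid_span C S)"
  using x
proof induction
  case (base x)
  then show ?case using subsetD[OF S(1)] groupoid_span.base[OF S(2)] by simp
next
  case (cmp x y p)
  have "dd C \<alpha> m (cmp C p x y) \<in> groupoid_span C S" for \<alpha> m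
  proof (cases "m = p")
    case True
    then show ?thesis using cmp.IH dd_cmp_same[OF cmp.hyps(3)] by (cases \<alpha>) auto
  next
    case False
    show ?thesis
      unfolding dd_cmp(2)[OF cmp.hyps(3) False]
      by (rule groupoid_span.cmp[OF _ _ dd_cmp(1)[OF cmp.hyps(3) False]]) (use cmp.IH in auto)
  qed
  then show ?case using cmp_closed[OF cmp.hyps(3)] by simp
next
  case (inv x r x')
  have "dd C \<alpha> m x' \<in> groupoid_span C S" for \<alpha> m
  proof -
    consider "m < r" | "m = r" | "r < m" by linarith
    then show ?thesis
    proof cases
      case 1
      then show ?thesis using inverse_at_dd(1)[OF inv.hyps(3)] inv.IH by simp
    next
      case 2
      then show ?thesis using inverse_at_dd(2,3)[OF inv.hyps(3)] inv.IH by (cases \<alpha>) auto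
    next
      case 3
      show ?thesis
        by (rule groupoid_span.inv[OF _ inv.hyps(2) inverse_at_dd(4)[OF inv.hyps(3) 3]]) (use inv.IH in auto)
    qed
  qed
  then show ?case using inv.hyps(3) by (auto simp: inverse_at_def composable_def)
qed

lemma composable_restrict:
  "S \<subseteq> mor C \<Longrightarrow> composable (C\<lparr>mor := S\<rparr>) n x y \<longleftrightarrow> x \<in> S \<and> y \<in> S \<and> composable C n x y"
  by (auto simp: composable_def)

lemma mdim_restrict [simp]: "mdim (C\<lparr>mor := S\<rparr>) x = mdim C x"
  by (simp add: mdim_def)

lemma (in omega_cat) omega_category_restrict:
  assumes S: "S \<subseteq> mor C" "\<And>\<alpha> m x. x \<in> S \<Longrightarrow> dd C \<alpha> m x \<in> S"
    "\<And>p x y. x \<in> S \<Longrightarrow> y \<in> S \<Longrightarrow> composable C p x y \<Longrightarrow> cmp C p x y \<in> S"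
  shows "omega_category (C\<lparr>mor := S\<rparr>)"
  unfolding omega_category_def composable_restrict[OF S(1)]
proof (intro conjI allI ballI impI)
  fix x assume x: "x \<in> mor (C\<lparr>mor := S\<rparr>)"
  then have "x \<in> mor C" using S by auto
  then have "dd (C\<lparr>mor := S\<rparr>) Neg (mdim C x) x = x \<and> dd (C\<lparr>mor := S\<rparr>) Pos (mdim C x) x = x"
    by simp
  then show "\<exists>n. dd (C\<lparr>mor := S\<rparr>) Neg n x = x \<and> dd (C\<lparr>mor := S\<rparr>) Pos n x = x" by blast
qed (use S in \<open>auto simp: dd_dd dd_cmp_same dd_cmp(2) subset_iff simp del: dd_dd_less dd_dd_ge
     intro: dd_cmp(1) assoc interchange dest: composableD\<close>)

lemma ex1_unique: "\<exists>!x. P x \<Longrightarrow> P x \<Longrightarrow> P y \<Longrightarrow> x = y"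
  by blast

lemma kan_completion_universal:
  fixes C H E :: "'u omegacat"
  assumes "kan_completion C H \<eta>" "kan E" "non_contracting_functor C E f"
  shows "\<exists>!g. g \<in> extensional (mor H) \<and> non_contracting_functor H E g \<and> (\<forall>x\<in>mor C. g (\<eta> x) = f x)"
  using assms(1)[unfolded kan_completion_def, THEN conjunct2, THEN conjunct2, THEN conjunct2,
      THEN spec, THEN spec, THEN mp, OF conjI[OF assms(2,3)]] .

text \<open>
  The cells generated by the image of the unit form a Kan object.  The universal property gives a functor
  from the completion to it, and by uniqueness that functor followed by the inclusion is the identity.
\<close>

lemma kan_completion_generated:
  assumes K: "kan_completion C H \<eta>"
  shows "mor H = groupoid_span H (\<eta> ` mor C)"
proof -
  have kanH: "kan H" and nc0: "non_contracting C" "non_contracting H" "non_contracting_functor C H \<eta>"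
    using K by (auto simp: kan_completion_def kan_def)
  interpret nc_functor C H \<eta> by unfold_locales fact+
  let ?S = "groupoid_span H (\<eta> ` mor C)" and ?K = "H\<lparr>mor := groupoid_span H (\<eta> ` mor C)\<rparr>"
  have img: "\<eta> ` mor C \<subseteq> mor H" "\<And>\<alpha> m x. x \<in> \<eta> ` mor C \<Longrightarrow> dd H \<alpha> m x \<in> \<eta> ` mor C"
    using f_mor f_dd by (auto simp: image_iff) (metis C.dd_closed)
  have S: "?S \<subseteq> mor H" "\<And>\<alpha> m x. x \<in> ?S \<Longrightarrow> dd H \<alpha> m x \<in> ?S"
    using D.groupoid_span_dd[OF img] by blast+
  have oK: "omega_category ?K"
    by (rule D.omega_category_restrict[OF S]) (auto intro: groupoid_span.cmp)
  have ncK: "non_contracting ?K"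
    using oK nc0(2) S(1) by (auto simp: non_contracting_def)
  interpret K: non_contracting_cat ?K by unfold_locales (rule ncK)
  have kanK: "kan ?K"
    unfolding K.kan_iff
  proof (intro allI ballI impI)
    fix r :: nat and x assume r: "r \<ge> 1" and x: "x \<in> mor ?K" "mdim ?K x \<ge> 2"
    then have "x \<in> mor H" "mdim H x \<ge> 2" using S(1) by auto
    then obtain x' where i: "inverse_at H r x x'" using kanH[unfolded D.kan_iff] r by blast
    then have "x' \<in> ?S" using groupoid_span.inv[of x] x r by auto
    then have "inverse_at ?K r x x'"
      using i x S(1) by (simp add: inverse_at_def composable_restrict)
    then show "\<exists>x'. inverse_at ?K r x x'" ..
  qed
  have ncf: "non_contracting_functor C ?K \<eta>"
    using f_nc by (auto simp: non_contracting_functor_def omega_functor_def intro: groupoid_span.base)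
  obtain g where g: "g \<in> extensional (mor H)" "non_contracting_functor H ?K g" "\<forall>x\<in>mor C. g (\<eta> x) = \<eta> x"
    using ex1_implies_ex[OF kan_completion_universal[OF K kanK ncf]] by blast
  have g': "non_contracting_functor H H g"
    using g(2) S(1) by (auto simp: non_contracting_functor_def omega_functor_def)
  have id: "non_contracting_functor H H (restrict id (mor H))"
    using D.cmp_closed by (auto simp: non_contracting_functor_def omega_functor_def composable_def)
  have "g = restrict id (mor H)"
    using g(1,3) g' id f_mor by (intro ex1_unique[OF kan_completion_universal[OF K kanH nc0(3)]]) auto
  then have "x \<in> ?S" if "x \<in> mor H" for x
    using that g(2) by (auto simp: non_contracting_functor_def omega_functor_def)
  then show ?thesis using S(1) by blast
qed


section \<open>Testing the universal property on other types\<close>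

text \<open>
  The copy of an \<open>\<omega>\<close>-category along an injection of its set of cells.
\<close>

definition transport :: "('a \<Rightarrow> 'b) \<Rightarrow> 'a omegacat \<Rightarrow> 'b omegacat" where
  "transport h E = (let k = inv_into (mor E) h in
     \<lparr>mor = h ` mor E, dd = (\<lambda>\<alpha> n x. h (dd E \<alpha> n (k x))), cmp = (\<lambda>n x y. h (cmp E n (k x) (k y)))\<rparr>)"

context
  fixes E :: "'a omegacat" and h :: "'a \<Rightarrow> 'b"
  assumes h: "inj_on h (mor E)"
begin

lemma transport_simps:
  "mor (transport h E) = h ` mor E"
  "x \<in> mor E \<Longrightarrow> dd (transport h E) \<alpha> n (h x) = h (dd E \<alpha> n x)"
  "x \<in> mor E \<Longrightarrow> y \<in> mor E \<Longrightarrow> cmp (transport h E) n (h x) (h y) = h (cmp E n x y)"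
  using h by (simp_all add: transport_def Let_def)

lemma h_eq: "x \<in> mor E \<Longrightarrow> y \<in> mor E \<Longrightarrow> h x = h y \<longleftrightarrow> x = y"
  using h by (auto dest: inj_onD)

lemma composable_transport:
  assumes "omega_category E" "x \<in> mor E" "y \<in> mor E"
  shows "composable (transport h E) n (h x) (h y) \<longleftrightarrow> composable E n x y"
  using assms omega_cat.dd_closed[OF omega_cat.intro[OF assms(1)]]
  by (simp add: composable_def transport_simps h_eq)

lemma composable_transportE:
  assumes "composable (transport h E) n x' y'"
  obtains x y where "x' = h x" "y' = h y" "x \<in> mor E" "y \<in> mor E"
  using assms by (auto simp: composable_def transport_simps)

lemma omega_category_transport:
  assumes E: "omega_category E" shows "omega_category (transport h E)"
proof -
  interpret E: omega_cat E by unfold_locales fact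
  note ct = composable_transport[OF E] and cE = E.composableD
  show ?thesis
    unfolding omega_category_def
  proof (intro conjI allI ballI impI)
    fix \<alpha> n x assume "x \<in> mor (transport h E)"
    then show "dd (transport h E) \<alpha> n x \<in> mor (transport h E)" by (auto simp: transport_simps)
  next
    fix n x y assume c: "composable (transport h E) n x y"
    then obtain a b where ab: "x = h a" "y = h b" "a \<in> mor E" "b \<in> mor E" by (rule composable_transportE)
    then have cab: "composable E n a b" using c ct by simp
    show "cmp (transport h E) n x y \<in> mor (transport h E)"
      using ab E.cmp_closed[OF cab] by (simp add: transport_simps)
    show "dd (transport h E) Neg n (cmp (transport h E) n x y) = dd (transport h E) Neg n x"
      "dd (transport h E) Pos n (cmp (transport h E) n x y) = dd (transport h E) Pos n y"
      using ab E.cmp_closed[OF cab] E.dd_cmp_same[OF cab] by (simp_all add: transport_simps)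
    fix \<alpha> m assume m: "m \<noteq> n"
    show "composable (transport h E) n (dd (transport h E) \<alpha> m x) (dd (transport h E) \<alpha> m y)"
      "dd (transport h E) \<alpha> m (cmp (transport h E) n x y) =
          cmp (transport h E) n (dd (transport h E) \<alpha> m x) (dd (transport h E) \<alpha> m y)"
      using ab E.cmp_closed[OF cab] E.dd_cmp[OF cab m, of \<alpha>] ct by (simp_all add: transport_simps)
  next
    fix \<alpha> \<beta> m n x assume "x \<in> mor (transport h E)"
    then show "dd (transport h E) \<beta> m (dd (transport h E) \<alpha> n x) =
        (if m < n then dd (transport h E) \<beta> m x else dd (transport h E) \<alpha> n x)"
      by (auto simp: transport_simps)
  next
    fix n x assume "x \<in> mor (transport h E)"
    then show "cmp (transport h E) n (dd (transport h E) Neg n x) x = x"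
      "cmp (transport h E) n x (dd (transport h E) Pos n x) = x"
      by (auto simp: transport_simps)
  next
    fix n x y z
    assume a: "composable (transport h E) n x y \<and> composable (transport h E) n (cmp (transport h E) n x y) z \<and>
       composable (transport h E) n y z \<and> composable (transport h E) n x (cmp (transport h E) n y z)"
    then obtain a b c where abc: "x = h a" "y = h b" "z = h c" "a \<in> mor E" "b \<in> mor E" "c \<in> mor E"
      by (metis composable_transportE h_eq)
    then have "composable E n a b" "composable E n b c" using a ct by auto
    then show "cmp (transport h E) n (cmp (transport h E) n x y) z = cmp (transport h E) n x (cmp (transport h E) n y z)"
      using abc E.assoc'[of n a b c] by (simp add: transport_simps E.cmp_closed)
  next
    fix m n x y z w
    assume a: "m \<noteq> n \<and> composable (transport h E) n x y \<and> composable (transport h E) n z w \<and>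
        composable (transport h E) m (cmp (transport h E) n x y) (cmp (transport h E) n z w) \<and>
        composable (transport h E) m x z \<and> composable (transport h E) m y w \<and>
        composable (transport h E) n (cmp (transport h E) m x z) (cmp (transport h E) m y w)"
    then obtain a b c d where abc: "x = h a" "y = h b" "z = h c" "w = h d"
        "a \<in> mor E" "b \<in> mor E" "c \<in> mor E" "d \<in> mor E"
      by (metis composable_transportE h_eq)
    then have c: "composable E n a b" "composable E n c d" "composable E m a c" "composable E m b d"
      using a ct by auto
    then have d: "composable E m (cmp E n a b) (cmp E n c d)" "composable E n (cmp E m a c) (cmp E m b d)"
      using a abc ct E.cmp_closed by (auto simp: transport_simps)
    show "cmp (transport h E) m (cmp (transport h E) n x y) (cmp (transport h E) n z w) =
        cmp (transport h E) n (cmp (transport h E) m x z) (cmp (transport h E) m y w)"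
      using abc c E.interchange[OF _ c(1,2) d(1) c(3,4) d(2)] a by (simp add: transport_simps E.cmp_closed)
  next
    fix x assume "x \<in> mor (transport h E)"
    then obtain a where a: "x = h a" "a \<in> mor E" by (auto simp: transport_simps)
    then have "dd (transport h E) Neg (mdim E a) x = x \<and> dd (transport h E) Pos (mdim E a) x = x"
      by (simp add: transport_simps)
    then show "\<exists>n. dd (transport h E) Neg n x = x \<and> dd (transport h E) Pos n x = x" by blast
  qed
qed

lemma mdim_transport:
  assumes E: "omega_category E" and x: "x \<in> mor E" shows "mdim (transport h E) (h x) = mdim E x"
proof -
  interpret E: omega_cat E by unfold_locales fact
  have "dd (transport h E) \<alpha> n (h x) = h x \<longleftrightarrow> dd E \<alpha> n x = x" for \<alpha> n
    unfolding transport_simps(2)[OF x] by (rule h_eq) (use x in auto)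
  then show ?thesis by (simp only: mdim_def)
qed

lemma kan_transport:
  assumes E: "kan E" shows "kan (transport h E)"
proof -
  have ncE: "non_contracting E" using E by (simp add: kan_def)
  interpret E: non_contracting_cat E by unfold_locales fact
  have nc: "non_contracting (transport h E)"
    using omega_category_transport[OF E.omega_category] mdim_transport[OF E.omega_category] E.mdim_dd1
    by (auto simp: non_contracting_def transport_simps)
  interpret T: non_contracting_cat "transport h E" by unfold_locales fact
  show ?thesis
    unfolding T.kan_iff
  proof (intro allI ballI impI)
    fix r :: nat and x assume r: "r \<ge> 1" and x: "x \<in> mor (transport h E)" "mdim (transport h E) x \<ge> 2"
    then obtain a where a: "x = h a" "a \<in> mor E" by (auto simp: transport_simps)
    then have "mdim E a \<ge> 2" using x(2) mdim_transport[OF E.omega_category] by simp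
    then obtain a' where i: "inverse_at E r a a'"
      using E[unfolded E.kan_iff] r a(2) by blast
    then have "a' \<in> mor E" by (simp add: inverse_at_def composable_def)
    then have "inverse_at (transport h E) r x (h a')"
      using a i composable_transport[OF E.omega_category] by (simp add: inverse_at_def transport_simps)
    then show "\<exists>x'. inverse_at (transport h E) r x x'" ..
  qed
qed

lemma functor_transport:
  assumes E: "omega_category E" and f: "non_contracting_functor C E f"
  shows "non_contracting_functor C (transport h E) (\<lambda>x. h (f x))"
  using f mdim_transport[OF E]
  by (auto simp: non_contracting_functor_def omega_functor_def transport_simps composable_def)

lemma functor_untransport:
  assumes E: "omega_category E" and f: "omega_functor C (transport h E) f"
  shows "omega_functor C E (\<lambda>x. inv_into (mor E) h (f x))"
proof -
  interpret E: omega_cat E by unfold_locales fact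
  note fD = omega_functorD[OF f]
  let ?k = "inv_into (mor E) h"
  have k: "?k (f x) \<in> mor E" "h (?k (f x)) = f x" if "x \<in> mor C" for x
    using fD(1)[OF that] by (auto simp: transport_simps f_inv_into_f inv_into_into)
  show ?thesis
    unfolding omega_functor_def
  proof (intro conjI allI ballI impI)
    show "?k (f x) \<in> mor E" if "x \<in> mor C" for x using k that by blast
    show "?k (f (dd C \<alpha> n x)) = dd E \<alpha> n (?k (f x))" if "x \<in> mor C" for \<alpha> n x
      using fD(2)[OF that] transport_simps(2)[OF k(1)[OF that], of \<alpha> n] k[OF that] h
      by simp
    show "?k (f (cmp C n x y)) = cmp E n (?k (f x)) (?k (f y))" if c: "composable C n x y" for n x y
    proof -
      have m: "x \<in> mor C" "y \<in> mor C" using c by (auto simp: composable_def)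
      have "composable E n (?k (f x)) (?k (f y))"
        using fD(4)[OF c] composable_transport[OF E k(1)[OF m(1)] k(1)[OF m(2)], of n] k(2) m by simp
      then show ?thesis
        using fD(3)[OF c] transport_simps(3)[OF k(1)[OF m(1)] k(1)[OF m(2)], of n] k[OF m(1)] k[OF m(2)] h
        by (simp add: E.cmp_closed)
    qed
  qed
qed

end

text \<open>
  The universal property of the completion refers to \<open>\<omega>\<close>-categories on the type of its own cells; by
  transport it may be tested on every \<open>\<omega>\<close>-category that embeds into this type as a set.
\<close>

lemma kan_completion_extend:
  fixes C H :: "'u omegacat" and E :: "'v omegacat" and h :: "'v \<Rightarrow> 'u"
  assumes K: "kan_completion C H \<eta>" and E: "kan E" and f: "non_contracting_functor C E f"
    and h: "inj_on h (mor E)"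
  obtains g where "omega_functor H E g" "\<And>x. x \<in> mor C \<Longrightarrow> g (\<eta> x) = f x"
proof -
  have oE: "omega_category E" using E by (simp add: kan_def non_contracting_def)
  have "\<exists>!g. g \<in> extensional (mor H) \<and> non_contracting_functor H (transport h E) g \<and>
      (\<forall>x\<in>mor C. g (\<eta> x) = h (f x))"
    by (rule kan_completion_universal[OF K kan_transport[OF h E] functor_transport[OF h oE f]])
  from ex1_implies_ex[OF this]
  obtain g where g: "non_contracting_functor H (transport h E) g" "\<And>x. x \<in> mor C \<Longrightarrow> g (\<eta> x) = h (f x)"
    by blast
  have "omega_functor H E (\<lambda>x. inv_into (mor E) h (g x))"
    using g(1) by (intro functor_untransport[OF h oE]) (simp add: non_contracting_functor_def)
  moreover have "inv_into (mor E) h (g (\<eta> x)) = f x" if "x \<in> mor C" for x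
    using g(2)[OF that] f that h by (simp add: non_contracting_functor_def omega_functor_def)
  ultimately show ?thesis by (rule that)
qed

section \<open>Whiskering by edges\<close>

text \<open>
  Whiskering of \<open>x\<close> by \<open>w\<close>, where \<open>\<beta>\<close> is the end of \<open>x\<close> at which \<open>w\<close> is attached.  Treating both ends at
  once halves the work below.
\<close>

definition whisk :: "'a omegacat \<Rightarrow> sign \<Rightarrow> 'a \<Rightarrow> 'a \<Rightarrow> 'a" where
  "whisk C \<beta> w x = (case \<beta> of Pos \<Rightarrow> cmp C 0 x w | Neg \<Rightarrow> cmp C 0 w x)"

definition wcomp :: "'a omegacat \<Rightarrow> sign \<Rightarrow> 'a \<Rightarrow> 'a \<Rightarrow> bool" where
  "wcomp C \<beta> w x = (case \<beta> of Pos \<Rightarrow> composable C 0 x w | Neg \<Rightarrow> composable C 0 w x)"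

lemma whisk_simps [simp]: "whisk C Pos w x = cmp C 0 x w" "whisk C Neg w x = cmp C 0 w x"
  by (simp_all add: whisk_def)

lemma wcomp_simps [simp]: "wcomp C Pos w x = composable C 0 x w" "wcomp C Neg w x = composable C 0 w x"
  by (simp_all add: wcomp_def)

context omega_cat
begin

lemma wcomp_mor: "wcomp C \<beta> w x \<Longrightarrow> w \<in> mor C \<and> x \<in> mor C"
  by (cases \<beta>) (auto simp: composable_def)

lemma whisk_closed: "wcomp C \<beta> w x \<Longrightarrow> whisk C \<beta> w x \<in> mor C"
  by (cases \<beta>) (auto intro: cmp_closed)

lemma wcomp_cong:
  assumes "x \<in> mor C" "y \<in> mor C" "dd C \<beta> 0 x = dd C \<beta> 0 y"
  shows "wcomp C \<beta> w x \<longleftrightarrow> wcomp C \<beta> w y"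
  using assms by (cases \<beta>) (auto simp: composable_def)

lemma whisk_dd:
  assumes c: "wcomp C \<beta> w x" and w: "mdim C w \<le> 1" and m: "m \<ge> 1"
  shows "wcomp C \<beta> w (dd C \<alpha> m x)" "dd C \<alpha> m (whisk C \<beta> w x) = whisk C \<beta> w (dd C \<alpha> m x)"
proof -
  have "x \<in> mor C" "w \<in> mor C" using wcomp_mor[OF c] by auto
  then have wm: "dd C \<alpha> m w = w" using w m by simp
  show "wcomp C \<beta> w (dd C \<alpha> m x)"
    using wcomp_cong[of "dd C \<alpha> m x" x \<beta> w] c m \<open>x \<in> mor C\<close> by simp
  show "dd C \<alpha> m (whisk C \<beta> w x) = whisk C \<beta> w (dd C \<alpha> m x)"
    using c m dd_cmp(2)[of 0 _ _ m \<alpha>] wm by (cases \<beta>) auto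
qed

lemma whisk_mdim:
  assumes "wcomp C \<beta> w x" "mdim C w \<le> n" "mdim C x \<le> n" shows "mdim C (whisk C \<beta> w x) \<le> n"
  using assms mdim_cmp by (cases \<beta>) auto

lemma whisk_cmp:
  assumes xy: "composable C p x y" "p \<ge> 1" and w: "mdim C w \<le> 1" "wcomp C \<beta> w (cmp C p x y)"
  shows "wcomp C \<beta> w x" "wcomp C \<beta> w y" "composable C p (whisk C \<beta> w x) (whisk C \<beta> w y)"
    "whisk C \<beta> w (cmp C p x y) = cmp C p (whisk C \<beta> w x) (whisk C \<beta> w y)"
  using whisker_right_cmp[OF xy w(1)] whisker_left_cmp[OF xy w(1)] w(2) by (cases \<beta>; simp)+

lemma wcomp_cmp_iff:
  assumes xy: "composable C p x y" "p \<ge> 1"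
  shows "wcomp C \<beta> w (cmp C p x y) \<longleftrightarrow> wcomp C \<beta> w x" "wcomp C \<beta> w y \<longleftrightarrow> wcomp C \<beta> w x"
proof -
  have m: "x \<in> mor C" "y \<in> mor C" "cmp C p x y \<in> mor C" using composableD[OF xy(1)] cmp_closed[OF xy(1)] by auto
  show "wcomp C \<beta> w (cmp C p x y) \<longleftrightarrow> wcomp C \<beta> w x"
    using m dd_cmp_low[OF xy(1), of 0 \<beta>] xy(2) by (intro wcomp_cong) auto
  show "wcomp C \<beta> w y \<longleftrightarrow> wcomp C \<beta> w x"
    using m composable_low[OF xy(1), of 0 \<beta>] xy(2) by (intro wcomp_cong) auto
qed

lemma whisk_unit:
  assumes "x \<in> mor C" shows "wcomp C \<beta> (dd C \<beta> 0 x) x" "whisk C \<beta> (dd C \<beta> 0 x) x = x"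
  using assms by (cases \<beta>; simp add: composable_def)+

end

section \<open>Quotient groups by representatives\<close>

text \<open>
  The elements of a quotient group enter cells of an \<open>\<omega>\<close>-category, where the axioms are equations.  Each
  class is therefore replaced by a chosen representative, and operations are performed on
  representatives and normalised afterwards.
\<close>

definition qrep :: "'a::ab_group_add set \<Rightarrow> 'a \<Rightarrow> 'a" where
  "qrep R a = (SOME b. a - b \<in> R)"

locale additive_subgroup =
  fixes R :: "'a::ab_group_add set"
  assumes R0: "0 \<in> R" and Rdiff: "a \<in> R \<Longrightarrow> b \<in> R \<Longrightarrow> a - b \<in> R"
begin

lemma Rneg: "a \<in> R \<Longrightarrow> - a \<in> R"
  using Rdiff[OF R0] by simp

lemma Radd: "a \<in> R \<Longrightarrow> b \<in> R \<Longrightarrow> a + b \<in> R"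
  using Rdiff[OF _ Rneg] by fastforce

lemma Rtrans: "a - b \<in> R \<Longrightarrow> b - c \<in> R \<Longrightarrow> a - c \<in> R"
  using Radd by fastforce

lemma Rsym: "a - b \<in> R \<Longrightarrow> b - a \<in> R"
  using Rneg by fastforce

lemma qrep_rel: "a - qrep R a \<in> R"
  unfolding qrep_def by (rule someI[of _ a]) (simp add: R0)

lemma qrep_eq_iff: "qrep R a = qrep R b \<longleftrightarrow> a - b \<in> R"
proof
  assume "a - b \<in> R"
  then have "a - c \<in> R \<longleftrightarrow> b - c \<in> R" for c using Rtrans Rsym by blast
  then show "qrep R a = qrep R b" by (simp add: qrep_def)
next
  assume "qrep R a = qrep R b"
  then show "a - b \<in> R" using Rtrans[OF qrep_rel[of a], of b] Rsym[OF qrep_rel[of b]] by simp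
qed

lemma qrep_cong: "a - b \<in> R \<Longrightarrow> qrep R a = qrep R b"
  by (simp add: qrep_eq_iff)

lemma qrep_rel': "qrep R a - a \<in> R"
  using Rsym qrep_rel by blast

lemma qrep_simps [simp]:
  "qrep R (qrep R a) = qrep R a" "qrep R (qrep R a + b) = qrep R (a + b)"
  "qrep R (b + qrep R a) = qrep R (b + a)" "qrep R (- qrep R a) = qrep R (- a)"
  using qrep_rel' qrep_rel[of a] by (auto intro!: qrep_cong)

lemma qrep_add_cong: "qrep R a = qrep R a' \<Longrightarrow> qrep R b = qrep R b' \<Longrightarrow> qrep R (a + b) = qrep R (a' + b')"
  by (metis qrep_simps(2,3))

end

text \<open>
  The bridge from generated subgroups in the sense of group theory to additive subgroups of the type of
  formal sums.
\<close>

lemma generate_additive_subgroup: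
  assumes "S \<subseteq> carrier (free_Abelian_group T)"
  shows "additive_subgroup (generate (free_Abelian_group T) S)"
    "generate (free_Abelian_group T) S \<subseteq> carrier (free_Abelian_group T)"
proof -
  interpret G: group "free_Abelian_group T" by simp
  interpret H: subgroup "generate (free_Abelian_group T) S" "free_Abelian_group T"
    by (rule G.generate_is_subgroup[OF assms])
  show "generate (free_Abelian_group T) S \<subseteq> carrier (free_Abelian_group T)" by (rule H.subset)
  show "additive_subgroup (generate (free_Abelian_group T) S)"
  proof
    show "0 \<in> generate (free_Abelian_group T) S" using H.one_closed by simp
    fix a b assume ab: "a \<in> generate (free_Abelian_group T) S" "b \<in> generate (free_Abelian_group T) S"
    have "Poly_Mapping.keys b \<subseteq> T" using subsetD[OF H.subset ab(2)] by simp
    then show "a - b \<in> generate (free_Abelian_group T) S"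
      using H.m_closed[OF ab(1) H.m_inv_closed[OF ab(2)]] by simp
  qed
qed

lemma generate_additive_image:
  assumes S: "S \<subseteq> carrier (free_Abelian_group T)" and R: "additive_subgroup R"
    and F: "\<And>s. s \<in> S \<Longrightarrow> frag_extend F s \<in> R" and r: "r \<in> generate (free_Abelian_group T) S"
  shows "frag_extend F r \<in> R"
proof -
  interpret additive_subgroup R by fact
  show ?thesis
    using r
  proof induction
    case (inv h)
    have "Poly_Mapping.keys h \<subseteq> T" using subsetD[OF S inv] by simp
    then show ?case using F[OF inv] Rneg by (simp add: frag_extend_minus)
  qed (use R0 F Radd in \<open>auto simp: frag_extend_add\<close>)
qed

lemma cls_zero: "mdim C x < n \<Longrightarrow> cls C n x = 0"
  by (simp add: cls_def)

lemma keys_cls: "x \<in> mor C \<Longrightarrow> Poly_Mapping.keys (cls C n x) \<subseteq> Cell ` mor_dim n C"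
  by (auto simp: cls_def mor_dim_def keys_frag_of)

lemma (in non_contracting_cat) formal_rel_gl_carrier:
  "formal_rel_gl C n \<subseteq> carrier (free_Abelian_group (Cell ` mor_dim n C))"
proof
  fix r assume "r \<in> formal_rel_gl C n"
  then obtain p x y where r: "r = cls C n (cmp C p x y) - (cls C n x + cls C n y)" "composable C p x y"
    by (auto simp: formal_rel_gl_def split: if_splits)
  have m: "x \<in> mor C" "y \<in> mor C" "cmp C p x y \<in> mor C" using composableD[OF r(2)] cmp_closed[OF r(2)] by auto
  have "Poly_Mapping.keys (cls C n x + cls C n y) \<subseteq> Cell ` mor_dim n C"
    using keys_add[of "cls C n x" "cls C n y"] keys_cls[OF m(1)] keys_cls[OF m(2)] by blast
  then have "Poly_Mapping.keys r \<subseteq> Cell ` mor_dim n C"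
    using keys_diff[of "cls C n (cmp C p x y)" "cls C n x + cls C n y"] keys_cls[OF m(3)] r(1) by blast
  then show "r \<in> carrier (free_Abelian_group (Cell ` mor_dim n C))" by simp
qed

section \<open>Classes of cells in the linear model\<close>

definition sel :: "sign \<Rightarrow> 'a \<Rightarrow> 'a \<Rightarrow> 'a" where
  "sel \<alpha> a b = (case \<alpha> of Neg \<Rightarrow> a | Pos \<Rightarrow> b)"

lemma sel_simps [simp]: "sel Neg a b = a" "sel Pos a b = b" "sel \<alpha> a a = a"
  by (simp_all add: sel_def split: sign.split)

text \<open>
  For a fixed degree \<open>n \<ge> 2\<close>, \<open>R\<close> is the group of globular relations, so that the chains modulo \<open>R\<close> are the
  group of degree \<open>n\<close> of the globular formal complex of \<open>C\<close>.
\<close>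

locale linear_model = non_contracting_cat C for C :: "'a omegacat" +
  fixes n :: nat and R :: "(('a, 'o) gen \<Rightarrow>\<^sub>0 int) set"
  assumes n2: "2 \<le> n"
    and R_def: "R = generate (free_Abelian_group (Cell ` mor_dim n C)) (formal_rel_gl C n)"

sublocale linear_model \<subseteq> additive_subgroup R
  unfolding R_def by (rule generate_additive_subgroup(1)[OF formal_rel_gl_carrier])

context linear_model
begin

abbreviation \<rho> where "\<rho> \<equiv> qrep R"

abbreviation cl :: "'a \<Rightarrow> (('a, 'o) gen \<Rightarrow>\<^sub>0 int)" where "cl \<equiv> cls C n"

lemma tr_path_n: "tr (n - 1) (path C) = {x \<in> mor C. 1 \<le> mdim C x \<and> mdim C x \<le> n}"
  using tr_path[of "n - 1"] n2 by simp

text \<open>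
  If one factor has dimension 0 then so does the other, and all three classes vanish; otherwise this is
  a defining relation.
\<close>

lemma cl_cmp:
  assumes c: "composable C p x y" and p: "1 \<le> p" "p < n" and d: "mdim C x \<le> n" "mdim C y \<le> n"
  shows "cl (cmp C p x y) - (cl x + cl y) \<in> R"
proof (cases "mdim C x = 0")
  case True
  then have "mdim C y = 0" using composable_mdim_Suc[of "p - 1" x y] c p by simp
  moreover have "cmp C p x y = y" using cmp_id_left(2)[OF c] True by simp
  ultimately show ?thesis using True n2 R0 by (simp add: cls_zero)
next
  case False
  then have "mdim C y \<noteq> 0" using composable_mdim_Suc[of "p - 1" x y] c p by simp
  then have "x \<in> tr (n - 1) (path C)" "y \<in> tr (n - 1) (path C)"
    using False composableD[OF c] d unfolding tr_path_n by auto
  then have "cl (cmp C p x y) - (cl x + cl y) \<in> formal_rel_gl C n"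
    using c p n2 unfolding formal_rel_gl_def by fastforce
  then show ?thesis unfolding R_def by (rule generate.incl)
qed

text \<open>
  The action of an edge \<open>w\<close> on chains by whiskering.  Cells that cannot be whiskered are sent to 0, which
  makes the action additive and defined on all chains.
\<close>

definition act :: "sign \<Rightarrow> 'a \<Rightarrow> (('a, 'o) gen \<Rightarrow>\<^sub>0 int) \<Rightarrow> (('a, 'o) gen \<Rightarrow>\<^sub>0 int)" where
  "act \<beta> w = frag_extend (\<lambda>g. case g of Aug _ \<Rightarrow> 0
     | Cell x \<Rightarrow> if x \<in> mor_dim n C \<and> wcomp C \<beta> w x then cl (whisk C \<beta> w x) else 0)"

lemma act_linear [simp]:
  "act \<beta> w 0 = 0" "act \<beta> w (- a) = - act \<beta> w a" "act \<beta> w (a + b) = act \<beta> w a + act \<beta> w b"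
  "act \<beta> w (a - b) = act \<beta> w a - act \<beta> w b"
  by (simp_all add: act_def frag_extend_minus frag_extend_add frag_extend_diff)

lemma act_cl:
  assumes x: "x \<in> mor C" "mdim C x \<le> n" and w: "mdim C w \<le> 1"
  shows "act \<beta> w (cl x) = (if wcomp C \<beta> w x then cl (whisk C \<beta> w x) else 0)"
proof (cases "mdim C x = n")
  case True
  then show ?thesis using x by (simp add: act_def cls_def mor_dim_def)
next
  case False
  then have "mdim C x \<le> n - 1" "mdim C w \<le> n - 1" using x w n2 by auto
  then have "wcomp C \<beta> w x \<Longrightarrow> mdim C (whisk C \<beta> w x) < n"
    using whisk_mdim[of \<beta> w x "n - 1"] n2 by fastforce
  then show ?thesis using False x by (simp add: cls_zero)
qed

text \<open>
  Whiskering by an edge distributes over compositions of positive index, so it maps relations to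
  relations; if one term of a relation cannot be whiskered, none of them can.
\<close>

lemma act_R:
  assumes w: "mdim C w \<le> 1" and r: "r \<in> R" shows "act \<beta> w r \<in> R"
  unfolding act_def
proof (rule generate_additive_image[OF formal_rel_gl_carrier additive_subgroup_axioms _ r[unfolded R_def]])
  fix s assume "s \<in> (formal_rel_gl C n :: (('a, 'o) gen \<Rightarrow>\<^sub>0 int) set)"
  then obtain p x y where s: "s = cl (cmp C p x y) - (cl x + cl y)" "composable C p x y" "1 \<le> p" "p \<le> n - 1"
      "x \<in> tr (n - 1) (path C)" "y \<in> tr (n - 1) (path C)"
    unfolding formal_rel_gl_def by (auto split: if_splits)
  have m: "x \<in> mor C" "y \<in> mor C" "cmp C p x y \<in> mor C" "mdim C x \<le> n" "mdim C y \<le> n" "mdim C (cmp C p x y) \<le> n"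
    using cmp_closed[OF s(2)] mdim_cmp[OF s(2), of n] s(5,6) unfolding tr_path_n by auto
  have "act \<beta> w s \<in> R"
  proof (cases "wcomp C \<beta> w x")
    case True
    then have c: "wcomp C \<beta> w (cmp C p x y)" "wcomp C \<beta> w y" using wcomp_cmp_iff[OF s(2,3)] by auto
    note wc = whisk_cmp[OF s(2,3) w c(1)]
    have "cl (cmp C p (whisk C \<beta> w x) (whisk C \<beta> w y)) - (cl (whisk C \<beta> w x) + cl (whisk C \<beta> w y)) \<in> R"
      using s(3,4) n2 m w by (intro cl_cmp wc whisk_mdim) auto
    then show ?thesis using True c wc m w by (simp add: s(1) act_cl)
  next
    case False
    then have "\<not> wcomp C \<beta> w (cmp C p x y)" "\<not> wcomp C \<beta> w y" using wcomp_cmp_iff[OF s(2,3)] by auto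
    then show ?thesis using False m w R0 by (simp add: s(1) act_cl)
  qed
  then show "frag_extend (\<lambda>g. case g of Aug _ \<Rightarrow> 0
     | Cell x \<Rightarrow> if x \<in> mor_dim n C \<and> wcomp C \<beta> w x then cl (whisk C \<beta> w x) else 0) s \<in> R"
    by (simp add: act_def)
qed

lemma act_cong: "mdim C w \<le> 1 \<Longrightarrow> \<rho> a = \<rho> b \<Longrightarrow> \<rho> (act \<beta> w a) = \<rho> (act \<beta> w b)"
  using act_R[of w "a - b" \<beta>] by (simp add: qrep_eq_iff)

lemma act_rho [simp]:
  assumes "mdim C w \<le> 1"
  shows "\<rho> (act \<beta> w (\<rho> a)) = \<rho> (act \<beta> w a)" "\<rho> (act \<beta> w (\<rho> a) + b) = \<rho> (act \<beta> w a + b)"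
    "\<rho> (b + act \<beta> w (\<rho> a)) = \<rho> (b + act \<beta> w a)"
  using act_cong[OF assms, of "\<rho> a" a \<beta>] by (auto intro!: qrep_add_cong)

lemma frag_cells_induct:
  assumes "Poly_Mapping.keys a \<subseteq> Cell ` mor_dim n C" "P 0"
    and "\<And>x. x \<in> mor C \<Longrightarrow> mdim C x = n \<Longrightarrow> P (cl x)"
    and "\<And>a b. P a \<Longrightarrow> P b \<Longrightarrow> P (a - b)"
  shows "P a"
  using assms(1)
proof (induction a rule: frag_induction)
  case (one g)
  then obtain x where "g = Cell x" "x \<in> mor C" "mdim C x = n" by (auto simp: mor_dim_def)
  then show ?case using assms(3)[of x] by (simp add: cls_def)
qed (use assms in auto)

abbreviation chains where "chains \<equiv> carrier (free_Abelian_group (Cell ` mor_dim n C)) :: (('a, 'o) gen \<Rightarrow>\<^sub>0 int) set"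

lemma R_chains: "R \<subseteq> chains"
  unfolding R_def by (rule generate_additive_subgroup(2)[OF formal_rel_gl_carrier])

lemma chains_diff: "a \<in> chains \<Longrightarrow> b \<in> chains \<Longrightarrow> a - b \<in> chains"
  using keys_diff[of a b] by auto

lemma chains_add: "a \<in> chains \<Longrightarrow> b \<in> chains \<Longrightarrow> a + b \<in> chains"
  using keys_add[of a b] by auto

lemma rho_chains: "a \<in> chains \<Longrightarrow> \<rho> a \<in> chains"
  using chains_diff[of a "a - \<rho> a"] subsetD[OF R_chains qrep_rel[of a]] by simp

lemma cl_chains: "x \<in> mor C \<Longrightarrow> cl x \<in> chains"
  using keys_cls[of x C n] by simp

lemma act_chains: "act \<beta> w a \<in> chains"
proof -
  have "act \<beta> w \<in> hom (free_Abelian_group UNIV) (free_Abelian_group (Cell ` mor_dim n C))"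
    unfolding act_def
    by (rule frag_extend_hom) (use cl_chains whisk_closed in \<open>auto split: gen.splits\<close>)
  then show ?thesis by (rule hom_in_carrier) simp
qed

lemma act_act:
  assumes a: "a \<in> chains" and w: "mdim C w \<le> 1" "mdim C w' \<le> 1" "composable C 0 w w'"
  shows "act Pos w' (act Pos w a) = act Pos (cmp C 0 w w') a"
    "act Neg w (act Neg w' a) = act Neg (cmp C 0 w w') a"
proof -
  have k: "Poly_Mapping.keys a \<subseteq> Cell ` mor_dim n C" using a by simp
  have ww: "mdim C (cmp C 0 w w') \<le> 1" using mdim_cmp w by blast
  have d: "dd C Neg 0 (cmp C 0 w w') = dd C Neg 0 w" "dd C Pos 0 (cmp C 0 w w') = dd C Pos 0 w'"
    using dd_cmp_same[OF w(3)] by auto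
  note wm = composableD[OF w(3)] cmp_closed[OF w(3)]
  show "act Pos w' (act Pos w a) = act Pos (cmp C 0 w w') a"
  proof (induction rule: frag_cells_induct[OF k])
    case (2 x)
    show ?case
    proof (cases "composable C 0 x w")
      case True
      have "composable C 0 x (cmp C 0 w w')" "composable C 0 (cmp C 0 x w) w'"
          "cmp C 0 (cmp C 0 x w) w' = cmp C 0 x (cmp C 0 w w')"
        using assoc'[OF True w(3)] by auto
      moreover have "mdim C (cmp C 0 x w) \<le> n" using mdim_cmp[OF True] 2 w n2 by simp
      ultimately show ?thesis using True 2 w ww cmp_closed[OF True] by (simp add: act_cl)
    next
      case False
      then have "\<not> composable C 0 x (cmp C 0 w w')" using d wm 2 by (auto simp: composable_def)
      then show ?thesis using False 2 w ww by (simp add: act_cl)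
    qed
  qed auto
  show "act Neg w (act Neg w' a) = act Neg (cmp C 0 w w') a"
  proof (induction rule: frag_cells_induct[OF k])
    case (2 x)
    show ?case
    proof (cases "composable C 0 w' x")
      case True
      have "composable C 0 (cmp C 0 w w') x" "composable C 0 w (cmp C 0 w' x)"
          "cmp C 0 w (cmp C 0 w' x) = cmp C 0 (cmp C 0 w w') x"
        using assoc'[OF w(3) True] by auto
      moreover have "mdim C (cmp C 0 w' x) \<le> n" using mdim_cmp[OF True] 2 w n2 by simp
      ultimately show ?thesis using True 2 w ww cmp_closed[OF True] by (simp add: act_cl)
    next
      case False
      then have "\<not> composable C 0 (cmp C 0 w w') x" using d wm 2 by (auto simp: composable_def)
      then show ?thesis using False 2 w ww by (simp add: act_cl)
    qed
  qed auto
qed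

lemma act_commute:
  assumes a: "a \<in> chains" and w: "mdim C v \<le> 1" "mdim C w \<le> 1"
  shows "act Neg v (act Pos w a) = act Pos w (act Neg v a)"
proof -
  have k: "Poly_Mapping.keys a \<subseteq> Cell ` mor_dim n C" using a by simp
  show ?thesis
  proof (induction rule: frag_cells_induct[OF k])
    case (2 x)
    have p: "composable C 0 v (cmp C 0 x w) \<longleftrightarrow> composable C 0 v x" if "composable C 0 x w"
      using dd_cmp_same(1)[OF that] cmp_closed[OF that] 2 by (auto simp: composable_def)
    have q: "composable C 0 (cmp C 0 v x) w \<longleftrightarrow> composable C 0 x w" if "composable C 0 v x"
      using dd_cmp_same(2)[OF that] cmp_closed[OF that] 2 by (auto simp: composable_def)
    have n1: "mdim C v \<le> n" "mdim C w \<le> n" using w n2 by auto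
    consider "composable C 0 v x" "composable C 0 x w" | "\<not> composable C 0 v x" "composable C 0 x w"
      | "composable C 0 v x" "\<not> composable C 0 x w" | "\<not> composable C 0 v x" "\<not> composable C 0 x w"
      by blast
    then show ?case
      using p q 2 w n1 mdim_cmp[of 0 v x n] mdim_cmp[of 0 x w n] cmp_closed[of 0 v x] cmp_closed[of 0 x w]
        assoc'(3)[of 0 v x w]
      by cases (simp_all add: act_cl)
  qed auto
qed

text \<open>
  Horizontal composites have no relation of their own in the globular complex; sliding turns them into
  sums of whiskered cells.
\<close>

lemma cl_cmp0:
  assumes c: "composable C 0 x y" and d: "mdim C x \<le> n" "mdim C y \<le> n"
  shows "\<rho> (cl (cmp C 0 x y)) = \<rho> (act Pos (dd C Neg 1 y) (cl x) + act Neg (dd C Pos 1 x) (cl y))"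
    "\<rho> (cl (cmp C 0 x y)) = \<rho> (act Neg (dd C Neg 1 x) (cl y) + act Pos (dd C Pos 1 y) (cl x))"
proof -
  note s = cmp0_slide[OF c] and m = composableD[OF c]
  have e: "mdim C (dd C \<alpha> 1 x) \<le> 1" "mdim C (dd C \<alpha> 1 y) \<le> 1" for \<alpha>
    using mdim_dd m by auto
  then have e': "mdim C (dd C \<alpha> 1 x) \<le> n" "mdim C (dd C \<alpha> 1 y) \<le> n" for \<alpha>
    using n2 by (meson le_trans one_le_numeral)+
  have "cl (cmp C 0 x y) - (cl (cmp C 0 x (dd C Neg 1 y)) + cl (cmp C 0 (dd C Pos 1 x) y)) \<in> R"
    unfolding s(4) using n2 d e' by (intro cl_cmp s(3) mdim_cmp[OF s(1)] mdim_cmp[OF s(2)]) auto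
  then show "\<rho> (cl (cmp C 0 x y)) = \<rho> (act Pos (dd C Neg 1 y) (cl x) + act Neg (dd C Pos 1 x) (cl y))"
    using s(1,2) m d e by (simp add: act_cl qrep_eq_iff)
  have "cl (cmp C 0 x y) - (cl (cmp C 0 (dd C Neg 1 x) y) + cl (cmp C 0 x (dd C Pos 1 y))) \<in> R"
    unfolding s(8) using n2 d e' by (intro cl_cmp s(7) mdim_cmp[OF s(5)] mdim_cmp[OF s(6)]) auto
  then show "\<rho> (cl (cmp C 0 x y)) = \<rho> (act Neg (dd C Neg 1 x) (cl y) + act Pos (dd C Pos 1 y) (cl x))"
    using s(5,6) m d e by (simp add: act_cl qrep_eq_iff)
qed

text \<open>
  The triples \<open>(u, v, a)\<close> consist of parallel edges and of a class that a cell from \<open>u\<close> to \<open>v\<close> may have in degree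
  \<open>n\<close>.  Taking all such triples would in general violate the interchange law, so only those are admitted
  that arise from cells of \<open>C\<close> by the operations of a groupoid.  For \<open>n > 2\<close> there are compositions of index
  strictly between 1 and \<open>n\<close>, which add the classes of cells with the same pair of edges; for \<open>n = 2\<close> there
  are none, and this addition is incompatible with the interchange law.
\<close>

inductive_set S :: "('a \<times> 'a \<times> (('a, 'o) gen \<Rightarrow>\<^sub>0 int)) set" where
  base: "x \<in> mor C \<Longrightarrow> mdim C x \<le> n \<Longrightarrow> (dd C Neg 1 x, dd C Pos 1 x, \<rho> (cl x)) \<in> S"
| inv: "(u, v, a) \<in> S \<Longrightarrow> (v, u, \<rho> (- a)) \<in> S"
| comp: "(u, v, a) \<in> S \<Longrightarrow> (v, w, b) \<in> S \<Longrightarrow> (u, w, \<rho> (a + b)) \<in> S"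
| add: "2 < n \<Longrightarrow> (u, v, a) \<in> S \<Longrightarrow> (u, v, b) \<in> S \<Longrightarrow> (u, v, \<rho> (a + b)) \<in> S"
| neg: "2 < n \<Longrightarrow> (u, v, a) \<in> S \<Longrightarrow> (u, v, \<rho> (- a)) \<in> S"

lemma S_basic:
  "(u, v, a) \<in> S \<Longrightarrow> u \<in> mor C \<and> v \<in> mor C \<and> mdim C u \<le> 1 \<and> mdim C v \<le> 1 \<and>
     (\<forall>\<alpha>. dd C \<alpha> 0 u = dd C \<alpha> 0 v) \<and> a \<in> chains \<and> \<rho> a = a"
proof (induction rule: S.induct)
  case (base x)
  then show ?case using mdim_dd[of x] rho_chains[OF cl_chains] by simp
next
  case (inv u v a)
  have "- a \<in> chains" using inv.IH by simp
  then show ?case using inv.IH rho_chains[of "- a"] by simp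
next
  case (comp u v a w b)
  then show ?case using rho_chains[OF chains_add[of a b]] by simp
next
  case (add u v a b)
  then show ?case using rho_chains[OF chains_add[of a b]] by simp
next
  case (neg u v a)
  have "- a \<in> chains" using neg.IH by simp
  then show ?case using neg.IH rho_chains[of "- a"] by simp
qed

text \<open>
  A class attached to \<open>(u, v)\<close> is supported on cells with the same end points as \<open>u\<close>, on which identities
  of objects act trivially.
\<close>

lemma S_unit: "(u, v, a) \<in> S \<Longrightarrow> \<rho> (act \<beta> (dd C \<beta> 0 u) a) = a"
proof (induction rule: S.induct)
  case (base x)
  have o: "mdim C (dd C \<beta> 0 x) \<le> 1" using mdim_dd[of x \<beta> 0] base by simp
  then have "act \<beta> (dd C \<beta> 0 x) (cl x) = cl x"
    using act_cl[OF base o] whisk_unit[OF base(1)] by simp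
  then show ?case using base o by simp
next
  case (inv u v a)
  have "dd C \<beta> 0 v = dd C \<beta> 0 u" "mdim C (dd C \<beta> 0 u) \<le> 1"
    using S_basic[OF inv.hyps] mdim_dd[of u \<beta> 0] by auto
  then show ?case using inv.IH by simp (metis qrep_simps(4))
next
  case (comp u v a w b)
  have "dd C \<beta> 0 v = dd C \<beta> 0 u" "mdim C (dd C \<beta> 0 u) \<le> 1"
    using S_basic[OF comp.hyps(1)] mdim_dd[of u \<beta> 0] by auto
  then show ?case using comp.IH by simp (metis qrep_simps(2,3))
next
  case (add u v a b)
  have "mdim C (dd C \<beta> 0 u) \<le> 1" using S_basic[OF add.hyps(2)] mdim_dd[of u \<beta> 0] by auto
  then show ?case using add.IH by simp (metis qrep_simps(2,3))
next
  case (neg u v a)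
  have "mdim C (dd C \<beta> 0 u) \<le> 1" using S_basic[OF neg.hyps(2)] mdim_dd[of u \<beta> 0] by auto
  then show ?case using neg.IH by simp (metis qrep_simps(4))
qed

text \<open>
  This is where \<open>C\<close> being non-contracting enters: a cell whose source edge is an identity of an object is
  that identity.
\<close>

lemma S_degenerate: "(u, v, a) \<in> S \<Longrightarrow> mdim C u = 0 \<or> mdim C v = 0 \<Longrightarrow> u = v \<and> a = \<rho> 0"
proof (induction rule: S.induct)
  case (base x)
  then have "mdim C x = 0" using dd1_dim_0 by blast
  then show ?case using base n2 by (simp add: cls_zero)
next
  case (inv u v a)
  then have "u = v" "a = \<rho> 0" by auto
  then show ?case by simp
next
  case (comp u v a w b)
  then have "u = v" "v = w" "a = \<rho> 0" "b = \<rho> 0" by auto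
  then show ?case by simp
next
  case (add u v a b)
  then have "u = v" "a = \<rho> 0" "b = \<rho> 0" by auto
  then show ?case by simp
next
  case (neg u v a)
  then have "u = v" "a = \<rho> 0" by auto
  then show ?case by simp
qed

lemma S_edge: "u \<in> mor C \<Longrightarrow> mdim C u \<le> 1 \<Longrightarrow> (u, u, \<rho> 0) \<in> S"
  using S.base[of u] n2 by (simp add: cls_zero)

lemma S_zero: "2 < n \<Longrightarrow> (u, v, a) \<in> S \<Longrightarrow> (u, v, \<rho> 0) \<in> S"
  using S.add[OF _ _ S.neg, of u v a a] by simp

lemma S_whisk:
  assumes "(u, v, a) \<in> S" and w: "mdim C w \<le> 1" "wcomp C \<beta> w u"
  shows "(whisk C \<beta> w u, whisk C \<beta> w v, \<rho> (act \<beta> w a)) \<in> S"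
  using assms
proof (induction rule: S.induct)
  case (base x)
  then have c: "wcomp C \<beta> w x" using wcomp_cong[of "dd C Neg 1 x" x \<beta> w] by simp
  have "mdim C (whisk C \<beta> w x) \<le> n" using whisk_mdim[OF c, of n] base w n2 by simp
  then show ?case
    using S.base[OF whisk_closed[OF c]] whisk_dd(2)[OF c w(1), of 1] act_cl[OF base(1,2) w(1)] c w by simp
next
  case (inv u v a)
  have "wcomp C \<beta> w u" using wcomp_cong[of u v \<beta> w] S_basic[OF inv.hyps] inv.prems by simp
  then show ?case using S.inv[OF inv.IH] w by simp
next
  case (comp u v a w' b)
  have "wcomp C \<beta> w v" using wcomp_cong[of u v \<beta> w] S_basic[OF comp.hyps(1)] comp.prems by simp
  then show ?case using S.comp[OF comp.IH(1,2)] comp.prems w by simp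
next
  case (add u v a b)
  then show ?case using S.add[OF add.hyps(1) add.IH(1,2)] w by simp
next
  case (neg u v a)
  then show ?case using S.neg[OF neg.hyps(1) neg.IH] w by simp
qed

text \<open>
  Slide an \<open>n\<close>-cell past a two-dimensional cell from \<open>u\<close> to \<open>v\<close> in both ways: as \<open>n > 2\<close>, the two-dimensional
  cell has class 0, and what remains is the equality of the actions of \<open>u\<close> and \<open>v\<close>.
\<close>

lemma act_component:
  assumes "(u, v, a) \<in> S" "2 < n" "c \<in> chains" shows "\<rho> (act \<beta> u c) = \<rho> (act \<beta> v c)"
  using assms(1)
proof (induction rule: S.induct)
  case (base x)
  let ?x = "dd C Neg 2 x" and ?u = "dd C Neg 1 x" and ?v = "dd C Pos 1 x"
  have k: "Poly_Mapping.keys c \<subseteq> Cell ` mor_dim n C" using assms(3) by simp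
  have e: "mdim C ?u \<le> 1" "mdim C ?v \<le> 1" using mdim_dd base by auto
  show ?case
  proof (induction rule: frag_cells_induct[OF k])
    case (2 y)
    \<comment> \<open>The second source of x is a cell of dimension at most 2 with the same edges.\<close>
    have x2: "?x \<in> mor C" "mdim C ?x \<le> n" "mdim C ?x < n" "dd C \<alpha> 1 ?x = dd C \<alpha> 1 x" "dd C \<alpha> 0 ?x = dd C \<alpha> 0 x" for \<alpha>
      using base mdim_dd[of x Neg 2] assms(2) by auto
    have z: "cl ?x = 0" using x2 by (simp add: cls_zero)
    show ?case
    proof (cases \<beta>)
      case Neg
      show ?thesis
      proof (cases "composable C 0 ?x y")
        case True
        then show ?thesis using cl_cmp0[OF True] 2 x2 z by (simp add: Neg)
      next
        case False
        then have "\<not> composable C 0 ?u y" "\<not> composable C 0 ?v y" using base 2 by (auto simp: composable_def)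
        then show ?thesis using 2 e by (simp add: Neg act_cl)
      qed
    next
      case Pos
      show ?thesis
      proof (cases "composable C 0 y ?x")
        case True
        then show ?thesis using cl_cmp0[OF True] 2 x2 z by (simp add: Pos)
      next
        case False
        then have "\<not> composable C 0 y ?u" "\<not> composable C 0 y ?v" using base 2 by (auto simp: composable_def)
        then show ?thesis using 2 e by (simp add: Pos act_cl)
      qed
    qed
  next
    case (3 a b)
    then show ?case
      using Rdiff[of "act \<beta> ?u a - act \<beta> ?v a" "act \<beta> ?u b - act \<beta> ?v b"] by (simp add: qrep_eq_iff algebra_simps)
  qed simp
qed auto

text \<open>
  The two ways of composing horizontally agree.  For \<open>n > 2\<close> this holds term by term by the previous lemma.
  For \<open>n = 2\<close> it holds for cells of \<open>C\<close> by sliding, and the equation is preserved by inverses and by vertical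
  composition in either argument.
\<close>

lemma S_interchange:
  assumes X: "(u, v, a) \<in> S" and Y: "(u', v', a') \<in> S" and c: "dd C Pos 0 u = dd C Neg 0 u'"
  shows "\<rho> (act Pos u' a + act Neg v a') = \<rho> (act Neg u a' + act Pos v' a)"
proof (cases "2 < n")
  case True
  have "\<rho> (act Pos u' a) = \<rho> (act Pos v' a)" "\<rho> (act Neg v a') = \<rho> (act Neg u a')"
    using act_component[OF X True] act_component[OF Y True] S_basic[OF X] S_basic[OF Y] by auto
  then have "\<rho> (act Pos u' a + act Neg v a') = \<rho> (act Pos v' a + act Neg u a')" by (rule qrep_add_cong)
  then show ?thesis by (simp add: add.commute)
next
  case False
  note \<rho>I = qrep_eq_iff[THEN iffD1] and \<rho>J = qrep_eq_iff[THEN iffD2]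
  show ?thesis
    using X Y c
  proof (induction arbitrary: u' v' a' rule: S.induct)
    case (base x)
    let ?u = "dd C Neg 1 x" and ?v = "dd C Pos 1 x"
    have e: "mdim C ?u \<le> 1" "mdim C ?v \<le> 1" using mdim_dd base by auto
    show ?case
      using base(3,4)
    proof (induction rule: S.induct)
      case y: (base y)
      have "composable C 0 x y" using y base by (simp add: composable_def)
      moreover have "mdim C (dd C \<alpha> 1 y) \<le> 1" for \<alpha> using mdim_dd y by auto
      ultimately show ?case using cl_cmp0[of x y] base y e by simp
    next
      case (inv u' v' a')
      have b: "dd C Neg 0 u' = dd C Neg 0 v'" "mdim C u' \<le> 1" "mdim C v' \<le> 1" using S_basic[OF inv.hyps] by auto
      then have "\<rho> (act Pos u' (\<rho> (cl x)) + act Neg ?v a') = \<rho> (act Neg ?u a' + act Pos v' (\<rho> (cl x)))"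
        using inv by simp
      then have "act Pos u' (cl x) + act Neg ?v a' - (act Neg ?u a' + act Pos v' (cl x)) \<in> R"
        using b by (intro \<rho>I) simp
      then have "act Pos v' (cl x) + act Neg ?v (- a') - (act Neg ?u (- a') + act Pos u' (cl x)) \<in> R"
        using Rneg by (fastforce simp: algebra_simps)
      then have "\<rho> (act Pos v' (cl x) + act Neg ?v (- a')) = \<rho> (act Neg ?u (- a') + act Pos u' (cl x))"
        by (rule \<rho>J)
      then show ?case using b e by (simp del: act_linear)
    next
      case (comp u' v' a' w' b')
      have b: "dd C Neg 0 u' = dd C Neg 0 v'" "mdim C u' \<le> 1" "mdim C v' \<le> 1" "mdim C w' \<le> 1"
        using S_basic[OF comp.hyps(1)] S_basic[OF comp.hyps(2)] by auto
      have "\<rho> (act Pos u' (\<rho> (cl x)) + act Neg ?v a') = \<rho> (act Neg ?u a' + act Pos v' (\<rho> (cl x)))"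
        "\<rho> (act Pos v' (\<rho> (cl x)) + act Neg ?v b') = \<rho> (act Neg ?u b' + act Pos w' (\<rho> (cl x)))"
        using comp b by simp_all
      then have "act Pos u' (cl x) + act Neg ?v a' - (act Neg ?u a' + act Pos v' (cl x)) \<in> R"
        "act Pos v' (cl x) + act Neg ?v b' - (act Neg ?u b' + act Pos w' (cl x)) \<in> R"
        using b by (auto intro: \<rho>I)
      then have "act Pos u' (cl x) + act Neg ?v (a' + b') - (act Neg ?u (a' + b') + act Pos w' (cl x)) \<in> R"
        using Radd by (fastforce simp: algebra_simps)
      then have "\<rho> (act Pos u' (cl x) + act Neg ?v (a' + b')) = \<rho> (act Neg ?u (a' + b') + act Pos w' (cl x))"
        by (rule \<rho>J)
      then show ?case using b e by (simp del: act_linear)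
    qed (use False in auto)
  next
    case (inv u v a)
    have b: "dd C Pos 0 u = dd C Pos 0 v" "mdim C u' \<le> 1" "mdim C v' \<le> 1"
      using S_basic[OF inv.hyps] S_basic[OF inv.prems(1)] by auto
    have "\<rho> (act Pos u' a + act Neg v a') = \<rho> (act Neg u a' + act Pos v' a)"
      using inv.IH[OF inv.prems(1)] inv.prems b by simp
    then have "act Pos u' a + act Neg v a' - (act Neg u a' + act Pos v' a) \<in> R" by (rule \<rho>I)
    then have "act Pos u' (- a) + act Neg u a' - (act Neg v a' + act Pos v' (- a)) \<in> R"
      using Rneg by (fastforce simp: algebra_simps)
    then have "\<rho> (act Pos u' (- a) + act Neg u a') = \<rho> (act Neg v a' + act Pos v' (- a))" by (rule \<rho>J)
    then show ?case using b by (simp del: act_linear)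
  next
    case (comp u v a w d)
    have b: "dd C Pos 0 u = dd C Pos 0 v" "mdim C u' \<le> 1" "mdim C v' \<le> 1"
      using S_basic[OF comp.hyps(1)] S_basic[OF comp.prems(1)] by auto
    have "\<rho> (act Pos u' a + act Neg v a') = \<rho> (act Neg u a' + act Pos v' a)"
      "\<rho> (act Pos u' d + act Neg w a') = \<rho> (act Neg v a' + act Pos v' d)"
      using comp.IH[OF comp.prems(1)] comp.prems b by simp_all
    then have "act Pos u' a + act Neg v a' - (act Neg u a' + act Pos v' a) \<in> R"
      "act Pos u' d + act Neg w a' - (act Neg v a' + act Pos v' d) \<in> R" by (auto intro: \<rho>I)
    then have "act Pos u' (a + d) + act Neg w a' - (act Neg u a' + act Pos v' (a + d)) \<in> R"
      using Radd by (fastforce simp: algebra_simps)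
    then have "\<rho> (act Pos u' (a + d) + act Neg w a') = \<rho> (act Neg u a' + act Pos v' (a + d))" by (rule \<rho>J)
    then show ?case using b by (simp del: act_linear)
  qed (use False in auto)
qed

lemma S_horizontal:
  assumes X: "(u, v, a) \<in> S" and Y: "(u', v', a') \<in> S" and c: "composable C 0 u u'"
  shows "(cmp C 0 u u', cmp C 0 v v', \<rho> (act Pos u' a + act Neg v a')) \<in> S"
proof -
  note bX = S_basic[OF X] and bY = S_basic[OF Y]
  have "composable C 0 v u'" using c bX by (simp add: composable_def)
  then have "(cmp C 0 u u', cmp C 0 v u', \<rho> (act Pos u' a)) \<in> S"
    "(cmp C 0 v u', cmp C 0 v v', \<rho> (act Neg v a')) \<in> S"
    using S_whisk[OF X, of u' Pos] S_whisk[OF Y, of v Neg] bX bY c by simp_all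
  from S.comp[OF this] show ?thesis by simp
qed

section \<open>The linear model as an \<open>\<omega>\<close>-category\<close>

text \<open>
  A cell consists of parallel edges \<open>u\<close>, \<open>v\<close> and of two classes \<open>a\<close>, \<open>b\<close> of degree \<open>n\<close>, those of its source and
  target of index \<open>n\<close>.  Below \<open>n\<close> compositions of positive index add classes; at level \<open>n\<close> there is exactly one
  cell from \<open>a\<close> to \<open>b\<close>.  Without this last level, every cell of dimension \<open>n + 1\<close> of \<open>C\<close> would force the classes
  of its source and target to agree, and the model could not detect all of the formal complex.
\<close>

definition model :: "('a \<times> 'a \<times> (('a, 'o) gen \<Rightarrow>\<^sub>0 int) \<times> (('a, 'o) gen \<Rightarrow>\<^sub>0 int)) omegacat" where
  "model =
     \<lparr> mor = {(u, v, a, b). (u, v, a) \<in> S \<and> (u, v, b) \<in> S},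
       dd = (\<lambda>\<alpha> k (u, v, a, b).
          if k = 0 then (dd C \<alpha> 0 u, dd C \<alpha> 0 u, \<rho> 0, \<rho> 0)
          else if k = 1 then (sel \<alpha> u v, sel \<alpha> u v, \<rho> 0, \<rho> 0)
          else if k < n then (u, v, \<rho> 0, \<rho> 0)
          else if k = n then (u, v, sel \<alpha> a b, sel \<alpha> a b)
          else (u, v, a, b)),
       cmp = (\<lambda>k (u, v, a, b) (u', v', a', b').
          if k = 0 then (cmp C 0 u u', cmp C 0 v v', \<rho> (act Pos u' a + act Neg v a'), \<rho> (act Pos u' b + act Neg v b'))
          else if k < n then (u, v', \<rho> (a + a'), \<rho> (b + b'))
          else (u, v', a, b')) \<rparr>"

lemma mor_model [simp]: "(u, v, a, b) \<in> mor model \<longleftrightarrow> (u, v, a) \<in> S \<and> (u, v, b) \<in> S"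
  by (simp add: model_def)

lemma dd_model:
  "dd model \<alpha> 0 (u, v, a, b) = (dd C \<alpha> 0 u, dd C \<alpha> 0 u, \<rho> 0, \<rho> 0)"
  "dd model \<alpha> (Suc 0) (u, v, a, b) = (sel \<alpha> u v, sel \<alpha> u v, \<rho> 0, \<rho> 0)"
  "Suc 0 < k \<Longrightarrow> k < n \<Longrightarrow> dd model \<alpha> k (u, v, a, b) = (u, v, \<rho> 0, \<rho> 0)"
  "dd model \<alpha> n (u, v, a, b) = (u, v, sel \<alpha> a b, sel \<alpha> a b)"
  "n < k \<Longrightarrow> dd model \<alpha> k (u, v, a, b) = (u, v, a, b)"
  using n2 by (auto simp: model_def)

lemma cmp_model:
  "cmp model 0 (u, v, a, b) (u', v', a', b') =
     (cmp C 0 u u', cmp C 0 v v', \<rho> (act Pos u' a + act Neg v a'), \<rho> (act Pos u' b + act Neg v b'))"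
  "0 < k \<Longrightarrow> k < n \<Longrightarrow> cmp model k (u, v, a, b) (u', v', a', b') = (u, v', \<rho> (a + a'), \<rho> (b + b'))"
  "n \<le> k \<Longrightarrow> cmp model k (u, v, a, b) (u', v', a', b') = (u, v', a, b')"
  using n2 by (auto simp: model_def)

lemma level_cases:
  obtains "k = 0" | "k = Suc 0" | "Suc 0 < k" "k < n" | "k = n" | "n < k"
  using n2 by linarith

lemma composable_model:
  assumes "(u, v, a, b) \<in> mor model" "(u', v', a', b') \<in> mor model"
  shows "composable model 0 (u, v, a, b) (u', v', a', b') \<longleftrightarrow> composable C 0 u u'"
    "composable model (Suc 0) (u, v, a, b) (u', v', a', b') \<longleftrightarrow> v = u'"
    "Suc 0 < k \<Longrightarrow> k < n \<Longrightarrow> composable model k (u, v, a, b) (u', v', a', b') \<longleftrightarrow> u = u' \<and> v = v'"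
    "composable model n (u, v, a, b) (u', v', a', b') \<longleftrightarrow> u = u' \<and> v = v' \<and> b = a'"
    "n < k \<Longrightarrow> composable model k (u, v, a, b) (u', v', a', b') \<longleftrightarrow> u = u' \<and> v = v' \<and> a = a' \<and> b = b'"
  using assms S_basic[of u v a] S_basic[of u' v' a'] by (auto simp: composable_def dd_model)

lemma composable_model_0:
  assumes "(u, v, a, b) \<in> mor model" "(u', v', a', b') \<in> mor model" "composable C 0 u u'"
  shows "x \<in> {u, v} \<Longrightarrow> y \<in> {u', v'} \<Longrightarrow> composable C 0 x y"
  using assms S_basic[of u v a] S_basic[of u' v' a'] by (auto simp: composable_def)

lemma S_unit0: "(u, v, a) \<in> S \<Longrightarrow> \<rho> (act \<beta> (dd C \<beta> 0 u) a) = a" "(u, v, a) \<in> S \<Longrightarrow> \<rho> (act \<beta> (dd C \<beta> 0 v) a) = a"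
  using S_unit[of u v a \<beta>] S_basic[of u v a] by auto

lemma dd_model_closed: "x \<in> mor model \<Longrightarrow> dd model \<alpha> k x \<in> mor model"
proof -
  assume x: "x \<in> mor model"
  obtain u v a b where e: "x = (u, v, a, b)" "(u, v, a) \<in> S" "(u, v, b) \<in> S" using x by (cases x) auto
  note B = S_basic[OF e(2)]
  have "(dd C \<alpha> 0 u, dd C \<alpha> 0 u, \<rho> 0) \<in> S" using B mdim_dd[of u \<alpha> 0] by (intro S_edge) auto
  moreover have "(sel \<alpha> u v, sel \<alpha> u v, \<rho> 0) \<in> S" using B by (cases \<alpha>) (auto intro: S_edge)
  moreover have "Suc 0 < k \<Longrightarrow> k < n \<Longrightarrow> (u, v, \<rho> 0) \<in> S" using S_zero[OF _ e(2)] by simp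
  moreover have "(u, v, sel \<alpha> a b) \<in> S" using e by (cases \<alpha>) auto
  ultimately show ?thesis using e by (cases rule: level_cases[of k]) (simp_all add: dd_model)
qed

lemma cmp_model_closed: assumes c: "composable model k x y" shows "cmp model k x y \<in> mor model"
proof -
  obtain u v a b u' v' a' b' where e: "x = (u, v, a, b)" "y = (u', v', a', b')"
    by (metis prod_cases4)
  have m: "(u, v, a) \<in> S" "(u, v, b) \<in> S" "(u', v', a') \<in> S" "(u', v', b') \<in> S"
    using c unfolding e by (auto simp: composable_def)
  note cm = composable_model[of u v a b u' v' a' b']
  show ?thesis
  proof (cases rule: level_cases[of k])
    case 1
    then show ?thesis using c m cm S_horizontal unfolding e by (simp add: cmp_model)
  next
    case 2
    then show ?thesis using c m cm n2 S.comp unfolding e by (simp add: cmp_model)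
  next
    case 3
    then show ?thesis using c m cm S.add unfolding e by (simp add: cmp_model)
  next
    case 4
    then show ?thesis using c m cm unfolding e by (simp add: cmp_model)
  next
    case 5
    then show ?thesis using c m cm unfolding e by (simp add: cmp_model)
  qed
qed

lemma dd_dd_model:
  assumes "x \<in> mor model"
  shows "dd model \<beta> m (dd model \<alpha> k x) = (if m < k then dd model \<beta> m x else dd model \<alpha> k x)"
proof -
  obtain u v a b where e: "x = (u, v, a, b)" "(u, v, a) \<in> S" using assms by (cases x) auto
  have s: "dd C \<beta> 0 (sel \<alpha> u v) = dd C \<beta> 0 u" using S_basic[OF e(2)] by (cases \<alpha>) auto
  show ?thesis
    unfolding e(1)
    by (cases rule: level_cases[of k]; cases rule: level_cases[of m])
      (use n2 S_basic[OF e(2)] s in \<open>simp_all add: dd_model\<close>)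
qed

lemma cmp_units_model:
  assumes "x \<in> mor model"
  shows "cmp model k (dd model Neg k x) x = x" "cmp model k x (dd model Pos k x) = x"
proof -
  obtain u v a b where e: "x = (u, v, a, b)" "(u, v, a) \<in> S" "(u, v, b) \<in> S" using assms by (cases x) auto
  note B = S_basic[OF e(2)] S_basic[OF e(3)]
  have m: "u \<in> mor C" "v \<in> mor C" "\<rho> a = a" "\<rho> b = b" using B by blast+
  have d: "dd C \<alpha> 0 v = dd C \<alpha> 0 u" for \<alpha> using B by simp
  have o: "mdim C (dd C \<alpha> 0 u) \<le> 1" for \<alpha> using mdim_dd[of u \<alpha> 0] m by simp
  have w: "mdim C u \<le> 1" "mdim C v \<le> 1" using B by auto
  have c: "cmp C 0 (dd C Neg 0 u) v = v" "cmp C 0 v (dd C Pos 0 u) = v"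
    using cmp_units[of v 0] m(2) unfolding d by auto
  have r: "\<rho> (act Neg (dd C Neg 0 u) a) = a" "\<rho> (act Neg (dd C Neg 0 u) b) = b"
    "\<rho> (act Pos (dd C Pos 0 u) a) = a" "\<rho> (act Pos (dd C Pos 0 u) b) = b"
    using S_unit[OF e(2)] S_unit[OF e(3)] by simp_all
  show "cmp model k (dd model Neg k x) x = x"
    unfolding e(1) by (cases rule: level_cases[of k]) (use w n2 in \<open>simp_all add: dd_model cmp_model m c r\<close>)
  show "cmp model k x (dd model Pos k x) = x"
    unfolding e(1) by (cases rule: level_cases[of k]) (use w n2 o[of Pos] in \<open>simp_all add: dd_model cmp_model m c r d\<close>)
qed

lemma dd_cmp_same_model:
  assumes c: "composable model k x y"
  shows "dd model Neg k (cmp model k x y) = dd model Neg k x" "dd model Pos k (cmp model k x y) = dd model Pos k y"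
proof -
  obtain u v a b u' v' a' b' where e: "x = (u, v, a, b)" "y = (u', v', a', b')"
    by (metis prod_cases4)
  have m: "(u, v, a) \<in> S" "(u, v, b) \<in> S" "(u', v', a') \<in> S" "(u', v', b') \<in> S"
    using c unfolding e by (auto simp: composable_def)
  note cm = composable_model[of u v a b u' v' a' b', simplified, OF conjI[OF m(1,2)] conjI[OF m(3,4)]]
  show "dd model Neg k (cmp model k x y) = dd model Neg k x" "dd model Pos k (cmp model k x y) = dd model Pos k y"
    using c dd_cmp_same[of 0 u u'] unfolding e
    by (cases rule: level_cases[of k]; use n2 in \<open>simp add: dd_model cmp_model cm\<close>)+
qed

lemma dd_cmp_model:
  assumes c: "composable model k x y" and mk: "m \<noteq> k"
  shows "composable model k (dd model \<alpha> m x) (dd model \<alpha> m y)"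
    "dd model \<alpha> m (cmp model k x y) = cmp model k (dd model \<alpha> m x) (dd model \<alpha> m y)"
proof -
  obtain u v a b u' v' a' b' where e: "x = (u, v, a, b)" "y = (u', v', a', b')"
    by (metis prod_cases4)
  have m: "(u, v, a) \<in> S" "(u, v, b) \<in> S" "(u', v', a') \<in> S" "(u', v', b') \<in> S"
    using c unfolding e by (auto simp: composable_def)
  have mm: "x \<in> mor model" "y \<in> mor model" "dd model \<alpha> m x \<in> mor model" "dd model \<alpha> m y \<in> mor model"
    using dd_model_closed c by (auto simp: composable_def)
  note B = S_basic[OF m(1)] S_basic[OF m(3)]
  note cm = composable_model[of u v a b u' v' a' b', simplified, OF conjI[OF m(1,2)] conjI[OF m(3,4)]]
  show "composable model k (dd model \<alpha> m x) (dd model \<alpha> m y)"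
  proof -
    have "dd model Pos k (dd model \<alpha> m x) = dd model Neg k (dd model \<alpha> m y)"
    proof (cases "k < m")
      case True
      then show ?thesis using c mm(1,2) by (simp add: dd_dd_model composable_def)
    next
      case False
      then have "dd model \<alpha> m (dd model Pos k x) = dd model \<alpha> m (dd model Neg k y)"
        using c by (simp add: composable_def)
      then show ?thesis using False mk mm(1,2) by (simp add: dd_dd_model)
    qed
    then show ?thesis using mm by (simp add: composable_def)
  qed
  have s0: "sel \<alpha> (cmp C 0 u u') (cmp C 0 v v') = cmp C 0 (sel \<alpha> u v) (sel \<alpha> u' v')" by (cases \<alpha>) simp_all
  have s1: "sel \<alpha> (\<rho> (act Pos u' a + act Neg v a')) (\<rho> (act Pos u' b + act Neg v b')) =
      \<rho> (act Pos u' (sel \<alpha> a b) + act Neg v (sel \<alpha> a' b'))"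
    "sel \<alpha> (\<rho> (a + a')) (\<rho> (b + b')) = \<rho> (sel \<alpha> a b + sel \<alpha> a' b')" by (cases \<alpha>; simp)+
  have e1: "mdim C (sel \<beta> u v) \<le> 1" "mdim C (sel \<beta> u' v') \<le> 1" for \<beta> using B by (cases \<beta>; simp)+
  have e2: "mdim C u' \<le> 1" "mdim C v \<le> 1" using B by auto
  have o1: "v = u' \<Longrightarrow> dd C \<alpha> 0 u = dd C \<alpha> 0 u'" using B by auto
  have o2: "dd C \<alpha> 0 (cmp C 0 u u') = sel \<alpha> (dd C \<alpha> 0 u) (dd C \<alpha> 0 u')" if "composable C 0 u u'"
    using dd_cmp_same[OF that] by (cases \<alpha>) simp_all
  have o3: "dd C \<alpha> 0 v' = dd C \<alpha> 0 u'" using B by auto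
  show "dd model \<alpha> m (cmp model k x y) = cmp model k (dd model \<alpha> m x) (dd model \<alpha> m y)"
    using c mk unfolding e
    by (cases rule: level_cases[of k]; cases rule: level_cases[of m])
      (use n2 e1 e2 o1 in \<open>simp_all add: dd_model cmp_model cm s0 s1 o2 o3\<close>)
qed

end

context linear_model
begin

lemma assoc_model:
  assumes xy: "composable model k x y" and yz: "composable model k y z"
  shows "cmp model k (cmp model k x y) z = cmp model k x (cmp model k y z)"
proof -
  obtain u v a b u' v' a' b' u'' v'' a'' b'' where
    e: "x = (u, v, a, b)" "y = (u', v', a', b')" "z = (u'', v'', a'', b'')"
    by (metis prod_cases4)
  have m: "(u, v, a) \<in> S" "(u, v, b) \<in> S" "(u', v', a') \<in> S" "(u', v', b') \<in> S"
      "(u'', v'', a'') \<in> S" "(u'', v'', b'') \<in> S"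
    using xy yz unfolding e by (auto simp: composable_def)
  note cm = composable_model[of u v a b u' v' a' b', simplified, OF conjI[OF m(1,2)] conjI[OF m(3,4)]]
    composable_model[of u' v' a' b' u'' v'' a'' b'', simplified, OF conjI[OF m(3,4)] conjI[OF m(5,6)]]
  consider "k = 0" | "0 < k" "k < n" | "n \<le> k" by linarith
  then show ?thesis
  proof cases
    case 1
    have c: "composable C 0 u u'" "composable C 0 u' u''" using xy yz 1 cm unfolding e by auto
    then have c': "composable C 0 v v'" "composable C 0 v' v''"
      using composable_model_0[of u v a b u' v' a' b' v v'] composable_model_0[of u' v' a' b' u'' v'' a'' b'' v' v''] m
      by auto
    have s: "act Pos u'' (act Pos u' a) = act Pos (cmp C 0 u' u'') a" "act Pos u'' (act Neg v a') = act Neg v (act Pos u'' a')"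
      "act Neg v (act Neg v' a'') = act Neg (cmp C 0 v v') a''"
      if "(u, v, a) \<in> S" "(u', v', a') \<in> S" "(u'', v'', a'') \<in> S" for a a' a''
      using S_basic[OF that(1)] S_basic[OF that(2)] S_basic[OF that(3)] c c' act_act act_commute by auto
    have w: "mdim C u'' \<le> 1" "mdim C v \<le> 1" using S_basic[OF m(1)] S_basic[OF m(5)] by auto
    show ?thesis
      using w assoc'(3)[OF c] assoc'(3)[OF c'] s[OF m(1,3,5)] s[OF m(2,4,6)] unfolding e 1
      by (simp add: cmp_model add.assoc)
  qed (simp_all add: e cmp_model add.assoc)
qed

text \<open>
  Only the composition of index 1 is interesting here: the inner terms of the two sides differ by the
  order of horizontal composition of the middle cells.
\<close>

lemma interchange_model_0:
  assumes k: "k \<noteq> 0" and c: "composable model k x y" "composable model k z w" "composable model 0 x z" "composable model 0 y w"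
  shows "cmp model 0 (cmp model k x y) (cmp model k z w) = cmp model k (cmp model 0 x z) (cmp model 0 y w)"
proof -
  obtain u1 v1 a1 b1 u2 v2 a2 b2 u3 v3 a3 b3 u4 v4 a4 b4 where
    e: "x = (u1, v1, a1, b1)" "y = (u2, v2, a2, b2)" "z = (u3, v3, a3, b3)" "w = (u4, v4, a4, b4)"
    by (metis prod_cases4)
  have m: "(u1, v1, a1) \<in> S" "(u1, v1, b1) \<in> S" "(u2, v2, a2) \<in> S" "(u2, v2, b2) \<in> S"
      "(u3, v3, a3) \<in> S" "(u3, v3, b3) \<in> S" "(u4, v4, a4) \<in> S" "(u4, v4, b4) \<in> S"
    using c unfolding e by (auto simp: composable_def)
  note cm = composable_model[of u1 v1 a1 b1 u2 v2 a2 b2, simplified, OF conjI[OF m(1,2)] conjI[OF m(3,4)]]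
    composable_model[of u3 v3 a3 b3 u4 v4 a4 b4, simplified, OF conjI[OF m(5,6)] conjI[OF m(7,8)]]
    composable_model[of u1 v1 a1 b1 u3 v3 a3 b3, simplified, OF conjI[OF m(1,2)] conjI[OF m(5,6)]]
    composable_model[of u2 v2 a2 b2 u4 v4 a4 b4, simplified, OF conjI[OF m(3,4)] conjI[OF m(7,8)]]
  have ed: "mdim C u1 \<le> 1" "mdim C v1 \<le> 1" "mdim C u2 \<le> 1" "mdim C v2 \<le> 1" "mdim C u3 \<le> 1" "mdim C v3 \<le> 1"
    "mdim C u4 \<le> 1" "mdim C v4 \<le> 1"
    using S_basic[OF m(1)] S_basic[OF m(3)] S_basic[OF m(5)] S_basic[OF m(7)] by auto
  have c0: "composable C 0 u1 u3" "composable C 0 u2 u4" using c(3,4) cm unfolding e by auto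
  show ?thesis
  proof (cases rule: level_cases[of k])
    case 2
    have eq: "v1 = u2" "v3 = u4" using c(1,2) cm 2 unfolding e by auto
    have "composable C 0 u2 u3"
      using c0 S_basic[OF m(1)] eq by (auto simp: composable_def)
    then have d: "dd C Pos 0 u2 = dd C Neg 0 u3" by (simp add: composable_def)
    have *: "\<rho> (act Pos u3 (a1 + a2) + act Neg v2 (a3 + a4)) =
        \<rho> (act Pos u3 a1 + act Neg v1 a3 + (act Pos u4 a2 + act Neg v2 a4))"
      if "(u2, v2, a2) \<in> S" "(u3, v3, a3) \<in> S" for a1 a2 a3 a4
    proof -
      have "\<rho> (act Pos u3 a2 + act Neg v2 a3) = \<rho> (act Neg u2 a3 + act Pos v3 a2)"
        by (rule S_interchange[OF that d])
      then have "\<rho> ((act Pos u3 a1 + act Neg v2 a4) + (act Pos u3 a2 + act Neg v2 a3)) =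
          \<rho> ((act Pos u3 a1 + act Neg v2 a4) + (act Neg u2 a3 + act Pos v3 a2))"
        by (rule qrep_add_cong[OF refl])
      then show ?thesis by (simp add: eq algebra_simps)
    qed
    show ?thesis
      using *[OF m(3,5), of a1 a4] *[OF m(4,6), of b1 b4] 2 n2 ed
      by (simp add: e cmp_model del: act_linear)
  next
    case 3
    have eq: "u1 = u2" "v1 = v2" "u3 = u4" "v3 = v4" using c(1,2) cm 3 unfolding e by auto
    show ?thesis using 3 ed by (simp add: e cmp_model eq) (simp add: ac_simps)
  next
    case 4
    have eq: "u1 = u2" "v1 = v2" "u3 = u4" "v3 = v4" using c(1,2) cm 4 unfolding e by auto
    show ?thesis using 4 ed n2 by (simp add: e cmp_model eq)
  next
    case 5
    have eq: "u1 = u2" "v1 = v2" "u3 = u4" "v3 = v4" using c(1,2) cm 5 unfolding e by auto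
    show ?thesis using 5 ed n2 by (simp add: e cmp_model eq)
  qed (use k in simp)
qed

lemma interchange_model:
  assumes mk: "m \<noteq> k" and c: "composable model k x y" "composable model k z w"
    "composable model m x z" "composable model m y w"
  shows "cmp model m (cmp model k x y) (cmp model k z w) = cmp model k (cmp model m x z) (cmp model m y w)"
proof -
  obtain u1 v1 a1 b1 u2 v2 a2 b2 u3 v3 a3 b3 u4 v4 a4 b4 where
    e: "x = (u1, v1, a1, b1)" "y = (u2, v2, a2, b2)" "z = (u3, v3, a3, b3)" "w = (u4, v4, a4, b4)"
    by (metis prod_cases4)
  consider "m = 0" | "k = 0" | "0 < m" "m < n" "0 < k" "k < n" | "0 < m" "m < n" "n \<le> k" | "n \<le> m" "0 < k" "k < n"
    | "n \<le> m" "n \<le> k" by linarith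
  then show ?thesis
  proof cases
    case 1
    show ?thesis unfolding 1 by (rule interchange_model_0[OF _ c(1,2)]) (use c(3,4) mk 1 in simp_all)
  next
    case 2
    show ?thesis unfolding 2
      by (rule interchange_model_0[symmetric, OF _ c(3,4)]) (use c(1,2) mk 2 in simp_all)
  next
    case 3
    then show ?thesis by (simp add: e cmp_model) (simp add: ac_simps)
  next
    case 4
    then show ?thesis using n2 by (simp add: e cmp_model)
  next
    case 5
    then show ?thesis using n2 by (simp add: e cmp_model)
  next
    case 6
    then show ?thesis by (simp add: e cmp_model)
  qed
qed

lemma omega_category_model: "omega_category model"
  unfolding omega_category_def
proof (intro conjI allI ballI impI)
  fix x assume x: "x \<in> mor model"
  then show "\<exists>n. dd model Neg n x = x \<and> dd model Pos n x = x"
    by (cases x) (auto simp: dd_model intro!: exI[of _ "Suc n"])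
next
  fix m k x y z w
  assume "m \<noteq> k \<and> composable model k x y \<and> composable model k z w \<and>
        composable model m (cmp model k x y) (cmp model k z w) \<and>
        composable model m x z \<and> composable model m y w \<and>
        composable model k (cmp model m x z) (cmp model m y w)"
  then show "cmp model m (cmp model k x y) (cmp model k z w) = cmp model k (cmp model m x z) (cmp model m y w)"
    by (intro interchange_model) blast+
next
  fix k x y z
  assume "composable model k x y \<and> composable model k (cmp model k x y) z \<and>
        composable model k y z \<and> composable model k x (cmp model k y z)"
  then show "cmp model k (cmp model k x y) z = cmp model k x (cmp model k y z)"
    by (intro assoc_model) blast+
qed (rule dd_model_closed cmp_model_closed dd_dd_model cmp_units_model dd_cmp_same_model dd_cmp_model; assumption)+

sublocale M: omega_cat model
  by unfold_locales (rule omega_category_model)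

text \<open>
  By \<open>S_degenerate\<close>, a cell over an identity of an object is itself that identity.
\<close>

lemma mdim_model:
  assumes "(u, v, a, b) \<in> mor model"
  shows "mdim model (u, v, a, b) = 0 \<longleftrightarrow> mdim C u = 0" "mdim model (u, u, \<rho> 0, \<rho> 0) \<le> 1"
proof -
  have S: "(u, v, a) \<in> S" "(u, v, b) \<in> S" using assms by auto
  note B = S_basic[OF S(1)]
  have "mdim model (u, v, a, b) = 0 \<longleftrightarrow> dd model Neg 0 (u, v, a, b) = (u, v, a, b)"
    by (rule M.mdim_0_iff[OF assms])
  also have "\<dots> \<longleftrightarrow> mdim C u = 0"
    using S_degenerate[OF S(1)] S_degenerate[OF S(2)] mdim_0_iff[of u Neg] B by (auto simp: dd_model)
  finally show "mdim model (u, v, a, b) = 0 \<longleftrightarrow> mdim C u = 0" .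
  have "(u, u, \<rho> 0, \<rho> 0) \<in> mor model" using B S_edge by simp
  then show "mdim model (u, u, \<rho> 0, \<rho> 0) \<le> 1"
    by (subst M.mdim_le_iff[of _ _ Neg]) (simp_all add: dd_model)
qed

lemma non_contracting_model: "non_contracting model"
proof -
  have "mdim model (dd model \<alpha> 1 x) = 1" if x: "x \<in> mor model" "1 \<le> mdim model x" for \<alpha> x
  proof -
    obtain u v a b where e: "x = (u, v, a, b)" "(u, v, a) \<in> S" "(u, v, b) \<in> S" using x(1) by (cases x) auto
    let ?w = "sel \<alpha> u v"
    note B = S_basic[OF e(2)]
    have w: "(?w, ?w, \<rho> 0) \<in> S" using B by (cases \<alpha>) (auto intro: S_edge)
    have "mdim C u \<noteq> 0" using mdim_model(1)[of u v a b] x e by auto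
    then have "mdim C ?w \<noteq> 0" using S_degenerate[OF e(2)] by (cases \<alpha>) auto
    then have "mdim model (?w, ?w, \<rho> 0, \<rho> 0) \<noteq> 0" using mdim_model(1)[of ?w ?w "\<rho> 0" "\<rho> 0"] w by simp
    moreover have "mdim model (?w, ?w, \<rho> 0, \<rho> 0) \<le> 1" using mdim_model(2)[of ?w ?w "\<rho> 0" "\<rho> 0"] w by simp
    ultimately show ?thesis using e by (simp add: dd_model)
  qed
  then show ?thesis using omega_category_model by (simp add: non_contracting_def)
qed

text \<open>
  Inverses are explicit at each level: opposite classes with the edges exchanged for index 1, opposite
  classes between 1 and \<open>n\<close>, exchanged classes at \<open>n\<close>, and the cell itself above \<open>n\<close>.
\<close>

lemma kan_model: "kan model"
proof -
  interpret N: non_contracting_cat model by unfold_locales (rule non_contracting_model)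
  show ?thesis
    unfolding N.kan_iff
  proof (intro allI ballI impI)
    fix r :: nat and x assume r: "r \<ge> 1" and x: "x \<in> mor model"
    obtain u v a b where e: "x = (u, v, a, b)" "(u, v, a) \<in> S" "(u, v, b) \<in> S" using x by (cases x) auto
    note cm = composable_model[of u v a b]
    show "\<exists>x'. inverse_at model r x x'"
    proof (cases rule: level_cases[of r])
      case 2
      have "inverse_at model r x (v, u, \<rho> (- a), \<rho> (- b))"
        using S.inv[OF e(2)] S.inv[OF e(3)] e n2 2
        by (simp add: inverse_at_def composable_def dd_model cmp_model)
      then show ?thesis ..
    next
      case 3
      have "inverse_at model r x (u, v, \<rho> (- a), \<rho> (- b))"
        using S.neg[OF _ e(2)] S.neg[OF _ e(3)] e 3
        by (simp add: inverse_at_def composable_def dd_model cmp_model)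
      then show ?thesis ..
    next
      case 4
      have "inverse_at model r x (u, v, b, a)"
        using e 4 by (simp add: inverse_at_def composable_def dd_model cmp_model)
      then show ?thesis ..
    next
      case 5
      have "inverse_at model r x x"
        using e 5 by (simp add: inverse_at_def composable_def dd_model cmp_model)
      then show ?thesis ..
    qed (use r in simp)
  qed
qed

text \<open>
  The comparison of \<open>C\<close> with the model; it is a functor since the relations of the formal complex hold in
  the model.
\<close>

definition classify :: "'a \<Rightarrow> 'a \<times> 'a \<times> (('a, 'o) gen \<Rightarrow>\<^sub>0 int) \<times> (('a, 'o) gen \<Rightarrow>\<^sub>0 int)" where
  "classify x = (dd C Neg 1 x, dd C Pos 1 x, \<rho> (cl (dd C Neg n x)), \<rho> (cl (dd C Pos n x)))"

lemma classify_mor: "x \<in> mor C \<Longrightarrow> classify x \<in> mor model"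
  using S.base[of "dd C Neg n x"] S.base[of "dd C Pos n x"] mdim_dd[of x _ n] n2
  by (simp add: classify_def)

lemma cl_dd_low: "x \<in> mor C \<Longrightarrow> k < n \<Longrightarrow> cl (dd C \<alpha> k x) = 0"
  using mdim_dd[of x \<alpha> k] by (intro cls_zero) simp

lemma classify_dd:
  assumes x: "x \<in> mor C" shows "classify (dd C \<alpha> k x) = dd model \<alpha> k (classify x)"
proof (cases rule: level_cases[of k])
  case 1
  then show ?thesis using x n2 by (simp add: classify_def dd_model cl_dd_low)
next
  case 2
  then show ?thesis using x n2 by (cases \<alpha>) (simp_all add: classify_def dd_model cl_dd_low)
next
  case 3
  then show ?thesis using x n2 by (simp add: classify_def dd_model cl_dd_low)
next
  case 4
  then show ?thesis using x n2 by (cases \<alpha>) (simp_all add: classify_def dd_model)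
next
  case 5
  then show ?thesis using x n2 by (simp add: classify_def dd_model)
qed

lemma classify_cmp:
  assumes c: "composable C k x y" shows "classify (cmp C k x y) = cmp model k (classify x) (classify y)"
proof -
  note m = composableD[OF c]
  have dn: "mdim C (dd C \<alpha> n x) \<le> n" "mdim C (dd C \<alpha> n y) \<le> n" for \<alpha> using mdim_dd m by auto
  have e: "mdim C (dd C \<alpha> 1 x) \<le> 1" "mdim C (dd C \<alpha> 1 y) \<le> 1" for \<alpha> using mdim_dd m by auto
  have sum: "\<rho> (cl (dd C \<alpha> n (cmp C k x y))) = \<rho> (cl (dd C \<alpha> n x) + cl (dd C \<alpha> n y))" if "0 < k" "k < n" for \<alpha>
  proof -
    have "composable C k (dd C \<alpha> n x) (dd C \<alpha> n y)" "dd C \<alpha> n (cmp C k x y) = cmp C k (dd C \<alpha> n x) (dd C \<alpha> n y)"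
      using dd_cmp[OF c, of n \<alpha>] that by auto
    then show ?thesis using cl_cmp that dn by (intro qrep_cong) simp
  qed
  show ?thesis
  proof (cases rule: level_cases[of k])
    case 1
    have h: "\<rho> (cl (dd C \<alpha> n (cmp C 0 x y))) =
        \<rho> (act Pos (dd C Neg 1 y) (cl (dd C \<alpha> n x)) + act Neg (dd C Pos 1 x) (cl (dd C \<alpha> n y)))" for \<alpha>
    proof -
      have "composable C 0 (dd C \<alpha> n x) (dd C \<alpha> n y)" "dd C \<alpha> n (cmp C 0 x y) = cmp C 0 (dd C \<alpha> n x) (dd C \<alpha> n y)"
        using dd_cmp[OF c, of n \<alpha>] n2 1 by auto
      then show ?thesis using cl_cmp0(1)[of "dd C \<alpha> n x" "dd C \<alpha> n y"] dn m n2 by simp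
    qed
    have "dd C \<alpha> 1 (cmp C 0 x y) = cmp C 0 (dd C \<alpha> 1 x) (dd C \<alpha> 1 y)" for \<alpha>
      using dd_cmp(2)[OF c, of 1 \<alpha>] 1 by simp
    then show ?thesis using h e unfolding classify_def 1 by (simp add: cmp_model)
  next
    case 2
    then show ?thesis using sum n2 dd_cmp_same[of 1 x y] c unfolding classify_def by (simp add: cmp_model)
  next
    case 3
    have "dd C \<alpha> 1 (cmp C k x y) = dd C \<alpha> 1 x" "dd C \<alpha> 1 x = dd C \<alpha> 1 y" for \<alpha>
      using dd_cmp_low[OF c, of 1] composable_low[OF c, of 1] 3 by auto
    then show ?thesis using sum 3 n2 unfolding classify_def by (simp add: cmp_model)
  next
    case 4
    have "dd C \<alpha> 1 (cmp C k x y) = dd C \<alpha> 1 x" "dd C \<alpha> 1 x = dd C \<alpha> 1 y" for \<alpha>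
      using dd_cmp_low[OF c, of 1] composable_low[OF c, of 1] 4 n2 by auto
    then show ?thesis using 4 n2 dd_cmp_same[of n x y] c unfolding classify_def by (simp add: cmp_model)
  next
    case 5
    have "dd C \<alpha> 1 (cmp C k x y) = dd C \<alpha> 1 x" "dd C \<alpha> 1 x = dd C \<alpha> 1 y"
      "dd C \<alpha> n (cmp C k x y) = dd C \<alpha> n x" "dd C \<alpha> n x = dd C \<alpha> n y" for \<alpha>
      using dd_cmp_low[OF c, of 1] composable_low[OF c, of 1] dd_cmp_low[OF c, of n] composable_low[OF c, of n] 5 n2 by auto
    then show ?thesis using 5 n2 unfolding classify_def by (simp add: cmp_model)
  qed
qed

lemma classify_functor: "non_contracting_functor C model classify"
proof -
  have "mdim model (classify x) = 1" if x: "x \<in> mor C" "mdim C x = 1" for x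
  proof -
    have e: "classify x = (x, x, \<rho> 0, \<rho> 0)" using x n2 by (simp add: classify_def cls_zero)
    then have "(x, x, \<rho> 0, \<rho> 0) \<in> mor model" using classify_mor[OF x(1)] by simp
    then show ?thesis using mdim_model[of x x "\<rho> 0" "\<rho> 0"] x unfolding e by linarith
  qed
  then show ?thesis
    unfolding non_contracting_functor_def omega_functor_def
    using classify_mor classify_dd classify_cmp by blast
qed

text \<open>
  A free abelian group on a set of the size of an infinite type has the size of this type.
\<close>

lemma model_lepoll:
  assumes inf: "infinite (UNIV :: 'a set)"
  obtains h :: "_ \<Rightarrow> 'a" where "inj_on h (mor model)"
proof -
  \<comment> \<open>Chains on all of the type are counted, because the set of cells of dimension n may be finite.\<close>
  let ?F = "carrier (free_Abelian_group (range Cell :: ('a, 'o) gen set))"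
  have ran: "(range Cell :: ('a, 'o) gen set) \<approx> (UNIV :: 'a set)"
    by (rule inj_on_image_eqpoll_self) (simp add: inj_on_def)
  have "?F \<approx> (range Cell :: ('a, 'o) gen set)"
    by (rule eqpoll_free_Abelian_group_infinite) (use inf ran eqpoll_finite_iff in blast)
  then have F: "?F \<lesssim> (UNIV :: 'a set)" using ran eqpoll_trans eqpoll_imp_lepoll by blast
  have T: "A \<times> B \<lesssim> (UNIV :: 'a set)" if "A \<lesssim> (UNIV :: 'a set)" "B \<lesssim> (UNIV :: 'a set)" for A :: "'x set" and B :: "'y set"
  proof -
    have "(UNIV :: 'a set) \<times> (UNIV :: 'a set) \<lesssim> (UNIV :: 'a set)"
      using card_of_Times_same_infinite[OF inf] by (intro eqpoll_imp_lepoll) (simp only: eqpoll_iff_card_of_ordIso)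
    with times_lepoll_mono[OF that] show ?thesis by (rule lepoll_trans)
  qed
  have "chains \<subseteq> ?F"
  proof
    fix x assume "x \<in> chains"
    then have "Poly_Mapping.keys x \<subseteq> Cell ` mor_dim n C" by simp
    also have "\<dots> \<subseteq> range Cell" by (rule image_mono[OF subset_UNIV])
    finally show "x \<in> ?F" by simp
  qed
  then have "mor model \<subseteq> UNIV \<times> UNIV \<times> ?F \<times> ?F"
    using S_basic unfolding model_def by (auto simp del: carrier_free_Abelian_group_iff dest!: S_basic)
  then have "mor model \<lesssim> (UNIV :: 'a set)"
    using T[OF lepoll_refl T[OF lepoll_refl T[OF F F]]] subset_imp_lepoll lepoll_trans by blast
  then show ?thesis using that by (auto simp: lepoll_def)
qed

end

section \<open>The unit of the completion on formal chains\<close>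

locale kan_unit =
  fixes C H :: "'u omegacat" and \<eta> :: "'u \<Rightarrow> 'u"
  assumes completion: "kan_completion C H \<eta>" and infinite: "infinite (UNIV :: 'u set)"

sublocale kan_unit \<subseteq> nc_functor C H \<eta>
  using completion by unfold_locales (auto simp: kan_completion_def kan_def)

context kan_unit
begin

lemma H_induct [consumes 1, case_names unit cmp inverse]:
  assumes z: "z \<in> mor H" and "\<And>x. x \<in> mor C \<Longrightarrow> P (\<eta> x)"
    "\<And>p x y. composable H p x y \<Longrightarrow> P x \<Longrightarrow> P y \<Longrightarrow> P (cmp H p x y)"
    "\<And>r x x'. r \<ge> 1 \<Longrightarrow> inverse_at H r x x' \<Longrightarrow> P x \<Longrightarrow> P x'"
  shows "P z"
  using z unfolding kan_completion_generated[OF completion]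
  by (induction rule: groupoid_span.induct) (use assms in auto)

lemma model_functor:
  assumes "linear_model C n R"
  obtains g where "omega_functor H (linear_model.model C n R) g"
    "\<And>x. x \<in> mor C \<Longrightarrow> g (\<eta> x) = linear_model.classify C n R x"
proof -
  interpret L: linear_model C n R by fact
  obtain h :: "_ \<Rightarrow> 'u" where "inj_on h (mor L.model)" using L.model_lepoll[OF infinite] .
  then show ?thesis
    by (rule kan_completion_extend[OF completion L.kan_model L.classify_functor]) (rule that)
qed

text \<open>
  A cell of dimension at most one is its own source edge in the linear model, so the functor from the
  completion to the model of degree 2 separates such cells.
\<close>

lemma unit_inj:
  assumes x: "x \<in> mor C" "mdim C x \<le> 1" and y: "y \<in> mor C" "mdim C y \<le> 1" and "\<eta> x = \<eta> y"
  shows "x = y"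
proof -
  define R :: "(('u, unit) gen \<Rightarrow>\<^sub>0 int) set" where
    "R = generate (free_Abelian_group (Cell ` mor_dim 2 C)) (formal_rel_gl C 2)"
  interpret L: linear_model C 2 R by unfold_locales (simp_all add: R_def)
  obtain g where g: "\<And>x. x \<in> mor C \<Longrightarrow> g (\<eta> x) = L.classify x"
    using model_functor[OF L.linear_model_axioms] by metis
  have "L.classify x = L.classify y" using g[OF x(1)] g[OF y(1)] assms(5) by simp
  then show ?thesis using x y by (simp add: L.classify_def)
qed

lemma unit_composable_0:
  assumes x: "x \<in> mor C" and y: "y \<in> mor C"
  shows "composable H 0 (\<eta> x) (\<eta> y) \<longleftrightarrow> composable C 0 x y"
proof
  assume "composable H 0 (\<eta> x) (\<eta> y)"
  then have e: "\<eta> (dd C Pos 0 x) = \<eta> (dd C Neg 0 y)" using x y by (simp add: composable_def f_dd)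
  have "mdim C (dd C Pos 0 x) \<le> 1" "mdim C (dd C Neg 0 y) \<le> 1"
    using C.mdim_dd[OF x, of Pos 0] C.mdim_dd[OF y, of Neg 0] by simp_all
  then have "dd C Pos 0 x = dd C Neg 0 y"
    using x y by (intro unit_inj[OF _ _ _ _ e]) simp_all
  then show "composable C 0 x y" using x y by (simp add: composable_def)
qed (rule f_composable)

lemma unit_wcomp:
  assumes "w \<in> mor C" "x \<in> mor C" shows "wcomp H \<beta> (\<eta> w) (\<eta> x) \<longleftrightarrow> wcomp C \<beta> w x"
  using unit_composable_0[OF assms] unit_composable_0[OF assms(2,1)] by (cases \<beta>) auto

lemma unit_whisk: "wcomp C \<beta> w x \<Longrightarrow> \<eta> (whisk C \<beta> w x) = whisk H \<beta> (\<eta> w) (\<eta> x)"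
  by (cases \<beta>) (auto simp: f_cmp)

text \<open>
  Sources and targets of index 1 of a composite or an inverse are composites of those of its
  constituents, and only compositions of index 0 produce new edges.
\<close>

lemma unit_surj:
  assumes z: "z \<in> mor H" "mdim H z \<le> 1" obtains x where "x \<in> mor C" "mdim C x \<le> 1" "z = \<eta> x"
proof -
  have "\<forall>\<alpha>. \<exists>x\<in>mor C. mdim C x \<le> 1 \<and> dd H \<alpha> 1 z = \<eta> x"
    using z(1)
  proof (induction rule: H_induct)
    case (unit x)
    then show ?case using C.mdim_dd[of x _ 1] f_dd by (metis C.dd_closed)
  next
    case (cmp p x y)
    show ?case
    proof
      fix \<alpha>
      obtain a where a: "a \<in> mor C" "mdim C a \<le> 1" "dd H \<alpha> 1 x = \<eta> a" using cmp.IH(1) by blast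
      obtain b where b: "b \<in> mor C" "mdim C b \<le> 1" "dd H \<alpha> 1 y = \<eta> b" using cmp.IH(2) by blast
      consider "p = 0" | "p = 1" | "p > 1" by linarith
      then show "\<exists>c\<in>mor C. mdim C c \<le> 1 \<and> dd H \<alpha> 1 (cmp H p x y) = \<eta> c"
      proof cases
        case 1
        then have c: "composable H 0 (\<eta> a) (\<eta> b)" "dd H \<alpha> 1 (cmp H p x y) = cmp H 0 (\<eta> a) (\<eta> b)"
          using D.dd_cmp[OF cmp.hyps, of 1 \<alpha>] a b by auto
        then have c': "composable C 0 a b" using unit_composable_0 a b by blast
        show ?thesis
          using c c' C.cmp_closed[OF c'] C.mdim_cmp[OF c' a(2) b(2)] f_cmp[OF c'] by metis
      next
        case 2
        then show ?thesis using D.dd_cmp_same[OF cmp.hyps] a b by (cases \<alpha>) auto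
      next
        case 3
        then show ?thesis using D.dd_cmp_low[OF cmp.hyps, of 1 \<alpha>] a by auto
      qed
    qed
  next
    case (inverse r x x')
    show ?case
    proof (cases "r = 1")
      case True
      show ?thesis
      proof
        fix \<alpha> show "\<exists>c\<in>mor C. mdim C c \<le> 1 \<and> dd H \<alpha> 1 x' = \<eta> c"
          using D.inverse_at_dd(2,3)[OF inverse.hyps(2)] inverse.IH True by (cases \<alpha>) auto
      qed
    next
      case False
      then have "dd H \<alpha> 1 x' = dd H \<alpha> 1 x" for \<alpha>
        using D.inverse_at_dd(1)[OF inverse.hyps(2), of 1 \<alpha>] inverse.hyps(1) by simp
      then show ?thesis using inverse.IH by simp
    qed
  qed
  then obtain x where "x \<in> mor C" "mdim C x \<le> 1" "dd H Neg 1 z = \<eta> x" by blast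
  then show ?thesis using that z by simp
qed

lemma unit_mdim:
  assumes "x \<in> mor C" "mdim C x \<le> 1" shows "mdim H (\<eta> x) = mdim C x"
proof (cases "mdim C x = 0")
  case True
  then show ?thesis using f_mdim_0 assms by simp
next
  case False
  then show ?thesis using assms f_nc by (simp add: non_contracting_functor_def)
qed

lemma unit_bij:
  assumes "k \<le> 1" shows "bij_betw \<eta> (mor_dim k C) (mor_dim k H)"
  unfolding bij_betw_def
proof
  show "inj_on \<eta> (mor_dim k C)"
    using unit_inj assms by (intro inj_onI) (auto simp: mor_dim_def)
  show "\<eta> ` mor_dim k C = mor_dim k H"
  proof
    show "\<eta> ` mor_dim k C \<subseteq> mor_dim k H" using unit_mdim f_mor assms by (auto simp: mor_dim_def)
    show "mor_dim k H \<subseteq> \<eta> ` mor_dim k C"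
    proof
      fix z assume z: "z \<in> mor_dim k H"
      then obtain x where x: "x \<in> mor C" "mdim C x \<le> 1" "z = \<eta> x"
        using assms unit_surj[of z] by (auto simp: mor_dim_def)
      then show "z \<in> \<eta> ` mor_dim k C" using z unit_mdim[of x] by (auto simp: mor_dim_def)
    qed
  qed
qed

text \<open>
  The unit on formal chains of degree \<open>n\<close>.  A cell whose image has smaller dimension goes to 0.
\<close>

definition lin :: "('o \<Rightarrow> 'o) \<Rightarrow> nat \<Rightarrow> (('u, 'o) gen \<Rightarrow>\<^sub>0 int) \<Rightarrow> (('u, 'o) gen \<Rightarrow>\<^sub>0 int)" where
  "lin a n = frag_extend (\<lambda>g. case g of Aug y \<Rightarrow> frag_of (Aug (a y)) | Cell x \<Rightarrow> cls H n (\<eta> x))"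

lemma lin_linear [simp]:
  "lin a n 0 = 0" "lin a n (- x) = - lin a n x" "lin a n (x + y) = lin a n x + lin a n y"
  "lin a n (x - y) = lin a n x - lin a n y"
  by (simp_all add: lin_def frag_extend_minus frag_extend_add frag_extend_diff)

lemma lin_Aug [simp]: "lin a n (frag_of (Aug y)) = frag_of (Aug (a y))"
  by (simp add: lin_def)

lemma unit_mdim_le: "x \<in> mor C \<Longrightarrow> mdim C x \<le> n \<Longrightarrow> mdim H (\<eta> x) \<le> n"
  by (rule omega_functor_mdim[OF C.omega_category D.omega_category f])

lemma lin_cls: "x \<in> mor C \<Longrightarrow> mdim C x \<le> n \<Longrightarrow> lin a n (cls C n x) = cls H n (\<eta> x)"
proof -
  assume x: "x \<in> mor C" "mdim C x \<le> n"
  show ?thesis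
  proof (cases "mdim C x = n")
    case True
    then show ?thesis by (simp add: lin_def cls_def[of C])
  next
    case False
    then have "mdim C x \<le> n - 1" "n > 0" using x by auto
    then have "mdim H (\<eta> x) < n" using unit_mdim_le[of x "n - 1"] x by linarith
    then show ?thesis using False x by (simp add: cls_zero)
  qed
qed

lemma tr_path_unit: "x \<in> tr k (path C) \<Longrightarrow> \<eta> x \<in> tr k (path H)"
  by (rule tr_functor[OF C.omega_category_path D.omega_category_path f_path])

text \<open>
  In degree at least two every class of the completion comes from \<open>C\<close>: the class of a vertical composite is a
  sum, that of a horizontal composite a sum up to the action of edges, all of which come from \<open>C\<close>,
  and the class of an inverse is the opposite class.  The statement is about $d_n^\alpha z$ for all
  cells \<open>z\<close>, since factors of a cell of dimension \<open>n\<close> may have larger dimension.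
\<close>

lemma unit_cls_surj:
  fixes R :: "(('u, 'o) gen \<Rightarrow>\<^sub>0 int) set" and a :: "'o \<Rightarrow> 'o"
  assumes n: "2 \<le> n" and R: "R = generate (free_Abelian_group (Cell ` mor_dim n H)) (formal_rel_gl H n)"
    and z: "z \<in> mor H"
  shows "\<exists>c\<in>carrier (free_Abelian_group (Cell ` mor_dim n C)). cls H n (dd H \<alpha> n z) - lin a n c \<in> R"
proof -
  define RC :: "(('u, 'o) gen \<Rightarrow>\<^sub>0 int) set" where
    "RC = generate (free_Abelian_group (Cell ` mor_dim n C)) (formal_rel_gl C n)"
  interpret LH: linear_model H n R by unfold_locales (use n R in auto)
  interpret LC: linear_model C n RC by unfold_locales (use n RC_def in auto)
  define im where "im r \<longleftrightarrow> (\<exists>c\<in>LC.chains. r - lin a n c \<in> R)" for r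
  have im_cong: "im s" if "im r" "LH.\<rho> r = LH.\<rho> s" for r s
  proof -
    have "s - r \<in> R" using that(2) LH.qrep_eq_iff by metis
    then show ?thesis using that(1) LH.Rtrans unfolding im_def by blast
  qed
  have im_add: "im (r + s)" if r: "im r" and s: "im s" for r s
  proof -
    obtain c d where cd: "c \<in> LC.chains" "d \<in> LC.chains" "r - lin a n c \<in> R" "s - lin a n d \<in> R"
      using r s by (auto simp: im_def)
    then have "(r + s) - lin a n (c + d) \<in> R" using LH.Radd[OF cd(3,4)] by (simp add: algebra_simps)
    then show ?thesis using LC.chains_add[OF cd(1,2)] unfolding im_def by blast
  qed
  have im_neg: "im (- r)" if r: "im r" for r
  proof -
    obtain c where c: "c \<in> LC.chains" "r - lin a n c \<in> R" using r by (auto simp: im_def)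
    then have "- r - lin a n (- c) \<in> R" using LH.Rneg[OF c(2)] by (simp add: algebra_simps)
    moreover have "- c \<in> LC.chains" using c(1) by simp
    ultimately show ?thesis unfolding im_def by blast
  qed
  have act_lin: "LH.act \<beta> (\<eta> w) (lin a n c) = lin a n (LC.act \<beta> w c)"
    if c: "c \<in> LC.chains" and w: "w \<in> mor C" "mdim C w \<le> 1" for \<beta> w c
  proof -
    have k: "Poly_Mapping.keys c \<subseteq> Cell ` mor_dim n C" using c by simp
    have w': "mdim H (\<eta> w) \<le> 1" using unit_mdim w by simp
    show ?thesis
    proof (induction rule: LC.frag_cells_induct[OF k])
      case (2 x)
      have "mdim C (whisk C \<beta> w x) \<le> n" if "wcomp C \<beta> w x"
        using C.whisk_mdim[OF that, of n] 2 w n by simp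
      then show ?case
        using 2 w w' unit_wcomp[OF w(1) 2(1)] unit_whisk[of \<beta> w x] C.whisk_closed[of \<beta> w x]
          unit_mdim_le[of x n] f_mor
        by (simp add: lin_cls LC.act_cl LH.act_cl)
    qed auto
  qed
  have im_act: "im (LH.act \<beta> w r)" if r: "im r" and w: "w \<in> mor H" "mdim H w \<le> 1" for \<beta> w r
  proof -
    obtain c where c: "c \<in> LC.chains" "r - lin a n c \<in> R" using r by (auto simp: im_def)
    obtain v where v: "v \<in> mor C" "mdim C v \<le> 1" "w = \<eta> v" using unit_surj[OF w] .
    have "LH.act \<beta> w r - lin a n (LC.act \<beta> v c) \<in> R"
      using LH.act_R[OF w(2) c(2), of \<beta>] act_lin[OF c(1) v(1,2)] v(3) by simp
    then show ?thesis using LC.act_chains unfolding im_def by blast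
  qed
  have im_0: "im 0" unfolding im_def using LH.R0 by (intro bexI[of _ 0]) auto
  have "\<forall>\<alpha>. im (LH.cl (dd H \<alpha> n z))"
    using z
  proof (induction rule: H_induct)
    case (unit x)
    have "LH.cl (dd H \<alpha> n (\<eta> x)) - lin a n (LC.cl (dd C \<alpha> n x)) \<in> R" for \<alpha>
      using unit C.mdim_dd[of x \<alpha> n] LH.R0 by (simp add: lin_cls f_dd)
    then show ?case using LC.cl_chains[OF C.dd_closed[OF unit]] unfolding im_def by blast
  next
    case (cmp p x y)
    show ?case
    proof
      fix \<alpha>
      note m = D.composableD[OF cmp.hyps]
      have ix: "im (LH.cl (dd H \<alpha> n x))" and iy: "im (LH.cl (dd H \<alpha> n y))" using cmp.IH by auto
      have dn: "mdim H (dd H \<alpha> n x) \<le> n" "mdim H (dd H \<alpha> n y) \<le> n" using D.mdim_dd m by auto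
      consider "p = 0" | "0 < p" "p < n" | "p = n" | "n < p" by linarith
      then show "im (LH.cl (dd H \<alpha> n (cmp H p x y)))"
      proof cases
        case 1
        have c: "composable H 0 (dd H \<alpha> n x) (dd H \<alpha> n y)" "dd H \<alpha> n (cmp H p x y) = cmp H 0 (dd H \<alpha> n x) (dd H \<alpha> n y)"
          using D.dd_cmp[OF cmp.hyps, of n \<alpha>] n 1 by auto
        have e: "mdim H (dd H Neg 1 (dd H \<alpha> n y)) \<le> 1" "mdim H (dd H Pos 1 (dd H \<alpha> n x)) \<le> 1"
          using D.mdim_dd m by auto
        have "im (LH.act Pos (dd H Neg 1 (dd H \<alpha> n y)) (LH.cl (dd H \<alpha> n x)) +
            LH.act Neg (dd H Pos 1 (dd H \<alpha> n x)) (LH.cl (dd H \<alpha> n y)))"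
          using e m by (intro im_add im_act ix iy) auto
        then show ?thesis using im_cong LH.cl_cmp0(1)[OF c(1) dn] unfolding c(2) by metis
      next
        case 2
        have c: "composable H p (dd H \<alpha> n x) (dd H \<alpha> n y)" "dd H \<alpha> n (cmp H p x y) = cmp H p (dd H \<alpha> n x) (dd H \<alpha> n y)"
          using D.dd_cmp[OF cmp.hyps, of n \<alpha>] 2 by auto
        have "LH.\<rho> (LH.cl (dd H \<alpha> n x) + LH.cl (dd H \<alpha> n y)) = LH.\<rho> (LH.cl (dd H \<alpha> n (cmp H p x y)))"
          using LH.cl_cmp[OF c(1)] dn 2 unfolding c(2) by (intro LH.qrep_cong[symmetric]) simp
        then show ?thesis using im_cong im_add[OF ix iy] by blast
      next
        case 3
        then show ?thesis using D.dd_cmp_same[OF cmp.hyps] ix iy by (cases \<alpha>) auto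
      next
        case 4
        then show ?thesis using D.dd_cmp_low[OF cmp.hyps, of n \<alpha>] ix by simp
      qed
    qed
  next
    case (inverse r x x')
    show ?case
    proof
      fix \<alpha>
      have ix: "im (LH.cl (dd H \<beta> n x))" for \<beta> using inverse.IH by auto
      consider "n < r" | "n = r" | "r < n" by linarith
      then show "im (LH.cl (dd H \<alpha> n x'))"
      proof cases
        case 1
        then show ?thesis using D.inverse_at_dd(1)[OF inverse.hyps(2) 1] ix by simp
      next
        case 2
        then show ?thesis using D.inverse_at_dd(2,3)[OF inverse.hyps(2)] ix by (cases \<alpha>) auto
      next
        case 3
        let ?y = "dd H \<alpha> n x" and ?y' = "dd H \<alpha> n x'"
        have i: "inverse_at H r ?y ?y'" using D.inverse_at_dd(4)[OF inverse.hyps(2) 3] .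
        then have c: "composable H r ?y ?y'" "cmp H r ?y ?y' = dd H Neg r ?y" by (auto simp: inverse_at_def)
        have m: "x \<in> mor H" "x' \<in> mor H" using inverse.hyps(2) by (auto simp: inverse_at_def composable_def)
        have "mdim H ?y \<le> n" "mdim H ?y' \<le> n" using D.mdim_dd m by auto
        then have "LH.cl (dd H Neg r ?y) - (LH.cl ?y + LH.cl ?y') \<in> R"
          using LH.cl_cmp[OF c(1) inverse.hyps(1) 3] c(2) by simp
        moreover have "LH.cl (dd H Neg r ?y) = 0" using LH.cl_dd_low[of ?y r Neg] m 3 by simp
        then have "LH.cl (dd H Neg r ?y) - (LH.cl ?y + LH.cl ?y') = - LH.cl ?y - LH.cl ?y'"
          by (simp add: algebra_simps)
        ultimately have "- LH.cl ?y - LH.cl ?y' \<in> R" by simp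
        then have "LH.\<rho> (- LH.cl ?y) = LH.\<rho> (LH.cl ?y')" by (rule LH.qrep_cong)
        then show ?thesis using im_cong im_neg[OF ix] by blast
      qed
    qed
  qed
  then show ?thesis by (simp add: im_def)
qed

text \<open>
  The functor from the completion to the linear model, in components: \<open>A\<close> is a left inverse of the unit on
  classes, additive for vertical composition, and \<open>U\<close>, \<open>V\<close> are the source and target edges.
\<close>

lemma unit_retraction:
  fixes R :: "(('u, 'o) gen \<Rightarrow>\<^sub>0 int) set"
  assumes L: "linear_model C n R"
  obtains A U V where
    "\<And>z. z \<in> mor H \<Longrightarrow> (U z, V z, A z) \<in> linear_model.S C n R"
    "\<And>z. z \<in> mor H \<Longrightarrow> mdim H z < n \<Longrightarrow> A z \<in> R"
    "\<And>x. x \<in> mor C \<Longrightarrow> mdim C x \<le> n \<Longrightarrow> A (\<eta> x) - cls C n x \<in> R"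
    "\<And>p x y. composable H p x y \<Longrightarrow> 0 < p \<Longrightarrow> p < n \<Longrightarrow> A (cmp H p x y) - (A x + A y) \<in> R"
    "\<And>x y. composable H 0 x y \<Longrightarrow>
      A (cmp H 0 x y) - (linear_model.act C n Pos (U y) (A x) + linear_model.act C n Neg (V x) (A y)) \<in> R"
    "\<And>x y. composable H 0 x y \<Longrightarrow> composable C 0 (U x) (U y)"
    "\<And>z. z \<in> mor H \<Longrightarrow> mdim H z \<ge> 1 \<Longrightarrow> mdim C (U z) = 1 \<and> mdim C (V z) = 1"
proof -
  interpret L: linear_model C n R by fact
  obtain g where g: "omega_functor H L.model g" "\<And>x. x \<in> mor C \<Longrightarrow> g (\<eta> x) = L.classify x"
    using model_functor[OF L] by metis
  define U V A B where "U z = fst (g z)" and "V z = fst (snd (g z))" and "A z = fst (snd (snd (g z)))"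
    and "B z = snd (snd (snd (g z)))" for z
  have gz: "g z = (U z, V z, A z, B z)" for z by (simp add: U_def V_def A_def B_def)
  note gD = omega_functorD[OF g(1), unfolded gz]
  have S: "(U z, V z, A z) \<in> L.S" "(U z, V z, B z) \<in> L.S" if "z \<in> mor H" for z
    using gD(1)[OF that] by auto
  have rel0: "r \<in> R" if "r = L.\<rho> 0" for r using that L.qrep_rel'[of 0] by simp
  show ?thesis
  proof (rule that)
    show "(U z, V z, A z) \<in> L.S" if "z \<in> mor H" for z using S that by blast
    show "A z \<in> R" if z: "z \<in> mor H" "mdim H z < n" for z
    proof (rule rel0)
      \<comment> \<open>The level below n is level 1 if n = 2 and an intermediate one otherwise; in both cases its class is 0.\<close>
      have "dd H Neg (n - 1) z = z" using z by simp
      then have "(U z, V z, A z, B z) = dd L.model Neg (n - 1) (U z, V z, A z, B z)"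
        using gD(2)[OF z(1), of Neg "n - 1"] by simp
      moreover have "n - 1 = Suc 0 \<or> Suc 0 < n - 1 \<and> n - 1 < n" using L.n2 by linarith
      ultimately show "A z = L.\<rho> 0" by (elim disjE conjE) (simp_all add: L.dd_model)
    qed
    show "A (\<eta> x) - cls C n x \<in> R" if x: "x \<in> mor C" "mdim C x \<le> n" for x
      using g(2)[OF x(1)] x L.qrep_rel' unfolding gz by (simp add: L.classify_def)
    show "A (cmp H p x y) - (A x + A y) \<in> R" if c: "composable H p x y" "0 < p" "p < n" for p x y
      using gD(3)[OF c(1)] c L.qrep_rel' by (simp add: L.cmp_model)
    show "A (cmp H 0 x y) - (L.act Pos (U y) (A x) + L.act Neg (V x) (A y)) \<in> R" if c: "composable H 0 x y" for x y
      using gD(3)[OF c(1)] c L.qrep_rel' by (simp add: L.cmp_model)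
    show "composable C 0 (U x) (U y)" if c: "composable H 0 x y" for x y
      using gD(4)[OF c] L.composable_model(1)[of "U x" "V x" "A x" "B x" "U y" "V y" "A y" "B y"]
        gD(1) D.composableD[OF c] by simp
    show "mdim C (U z) = 1 \<and> mdim C (V z) = 1" if z: "z \<in> mor H" "mdim H z \<ge> 1" for z
    proof -
      have "mdim C (sel \<alpha> (U z) (V z)) = 1" for \<alpha>
      proof -
        have e: "dd H \<alpha> 1 z \<in> mor H" "mdim H (dd H \<alpha> 1 z) = 1" using z D.mdim_dd1 by auto
        then obtain w where w: "w \<in> mor C" "mdim C w \<le> 1" "dd H \<alpha> 1 z = \<eta> w" using unit_surj[of "dd H \<alpha> 1 z"] by auto
        then have "mdim C w = 1" using unit_mdim[OF w(1,2)] e(2) by simp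
        moreover have "w = sel \<alpha> (U z) (V z)"
          using gD(2)[OF z(1), of \<alpha> 1] g(2)[OF w(1)] w unfolding gz
          by (simp add: L.dd_model L.classify_def)
        ultimately show ?thesis by simp
      qed
      from this[of Neg] this[of Pos] show ?thesis by simp
    qed
  qed
qed

end

section \<open>Retractions of the unit modulo the formal relations\<close>

lemma (in non_contracting_cat) cls_diff_carrier:
  assumes "x \<in> mor C" "y \<in> mor C"
  shows "cls C n x - cls C n y \<in> carrier (free_Abelian_group (Cell ` mor_dim n C))"
  using keys_diff[of "cls C n x" "cls C n y"] keys_cls[OF assms(1), of n] keys_cls[OF assms(2), of n] by auto

lemma (in non_contracting_cat) formal_rel_sc_carrier:
  "formal_rel_sc \<alpha> C (Suc k) \<subseteq> carrier (free_Abelian_group (Cell ` mor_dim (Suc k) C))"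
proof
  fix r assume r: "r \<in> formal_rel_sc \<alpha> C (Suc k)"
  show "r \<in> carrier (free_Abelian_group (Cell ` mor_dim (Suc k) C))"
  proof (cases "k = 0")
    case True
    then obtain x y where "r = frag_of (Cell (cmp C 0 x y)) - frag_of (Cell (case \<alpha> of Neg \<Rightarrow> x | Pos \<Rightarrow> y))"
        "x \<in> mor_dim 1 C" "y \<in> mor_dim 1 C" "cmp C 0 x y \<in> mor_dim 1 C"
      using r by (auto simp: formal_rel_sc_def)
    then show ?thesis
      using cls_diff_carrier[of "cmp C 0 x y" "case \<alpha> of Neg \<Rightarrow> x | Pos \<Rightarrow> y" 1] True
      by (cases \<alpha>) (simp_all add: mor_dim_def cls_def)
  next
    case False
    then consider "r \<in> formal_rel_gl C (Suc k)" |
      x y where "r = cls C (Suc k) (cmp C 0 x y) - cls C (Suc k) (case \<alpha> of Neg \<Rightarrow> x | Pos \<Rightarrow> y)" "composable C 0 x y"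
      using r by (auto simp: formal_rel_sc_def)
    then show ?thesis
    proof cases
      case 1
      then show ?thesis using formal_rel_gl_carrier by blast
    next
      case 2
      then show ?thesis
        using cls_diff_carrier[of "cmp C 0 x y" "case \<alpha> of Neg \<Rightarrow> x | Pos \<Rightarrow> y" "Suc k"]
          composableD[OF 2(2)] cmp_closed[OF 2(2)] by (cases \<alpha>) simp_all
    qed
  qed
qed

context linear_model
begin

text \<open>
  The branching and merging relations keep one factor of a horizontal composite.  Modulo them, an edge on
  the side that is dropped acts like an identity, whereas an edge on the side that is kept acts as
  zero, since it has class 0 itself.
\<close>

lemma act_sc:
  fixes \<alpha> :: sign
  defines "Q \<equiv> generate (free_Abelian_group (Cell ` mor_dim n C)) (formal_rel_sc \<alpha> C n)"
  assumes v: "v \<in> mor C" "mdim C v = 1" and c: "c \<in> chains"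
  shows "act \<alpha> v c \<in> Q"
    "act (case \<alpha> of Neg \<Rightarrow> Pos | Pos \<Rightarrow> Neg) v c - act (case \<alpha> of Neg \<Rightarrow> Pos | Pos \<Rightarrow> Neg) (dd C \<alpha> 0 v) c \<in> Q"
proof -
  obtain k where nk: "n = Suc k" using n2 by (cases n) auto
  interpret Q: additive_subgroup Q
    unfolding Q_def nk by (rule generate_additive_subgroup(1)[OF formal_rel_sc_carrier])
  have k: "Poly_Mapping.keys c \<subseteq> Cell ` mor_dim n C" using c by simp
  have vt: "v \<in> tr (n - 1) (path C)" unfolding tr_path_n using v n2 by simp
  have clv: "cl v = 0" using v n2 by (simp add: cls_zero)
  have o: "mdim C (dd C \<alpha> 0 v) \<le> 1" using mdim_dd[of v \<alpha> 0] v by simp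
  have rel: "cl (cmp C 0 x y) - cl (case \<alpha> of Neg \<Rightarrow> x | Pos \<Rightarrow> y) \<in> Q"
    if "x \<in> tr (n - 1) (path C)" "y \<in> tr (n - 1) (path C)" "composable C 0 x y" for x y
  proof -
    have "cl (cmp C 0 x y) - cl (case \<alpha> of Neg \<Rightarrow> x | Pos \<Rightarrow> y) \<in> formal_rel_sc \<alpha> C n"
      using that n2 unfolding formal_rel_sc_def by auto
    then show ?thesis unfolding Q_def by (rule generate.incl)
  qed
  show "act \<alpha> v c \<in> Q"
  proof (induction rule: frag_cells_induct[OF k])
    case (2 x)
    have xt: "x \<in> tr (n - 1) (path C)" unfolding tr_path_n using 2 n2 by simp
    show ?case
      using rel[OF vt xt] rel[OF xt vt] Q.R0 2 v clv by (cases \<alpha>) (auto simp: act_cl)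
  next
    case (3 a b)
    then show ?case using Q.Rdiff by simp
  qed (simp add: Q.R0)
  show "act (case \<alpha> of Neg \<Rightarrow> Pos | Pos \<Rightarrow> Neg) v c - act (case \<alpha> of Neg \<Rightarrow> Pos | Pos \<Rightarrow> Neg) (dd C \<alpha> 0 v) c \<in> Q"
  proof (induction rule: frag_cells_induct[OF k])
    case (2 x)
    have xt: "x \<in> tr (n - 1) (path C)" unfolding tr_path_n using 2 n2 by simp
    show ?case
    proof (cases \<alpha>)
      case Neg
      show ?thesis
      proof (cases "composable C 0 x v")
        case True
        then have "composable C 0 x (dd C Neg 0 v)" "dd C Neg 0 v = dd C Pos 0 x" using v by (auto simp: composable_def)
        then show ?thesis using True rel[OF xt vt True] 2 v o by (simp add: Neg act_cl)
      next
        case False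
        then have "\<not> composable C 0 x (dd C Neg 0 v)" using v by (auto simp: composable_def)
        then show ?thesis using False 2 v o Q.R0 by (simp add: Neg act_cl)
      qed
    next
      case Pos
      show ?thesis
      proof (cases "composable C 0 v x")
        case True
        then have "composable C 0 (dd C Pos 0 v) x" "dd C Pos 0 v = dd C Neg 0 x" using v by (auto simp: composable_def)
        then show ?thesis using True rel[OF vt xt True] 2 v o by (simp add: Pos act_cl)
      next
        case False
        then have "\<not> composable C 0 (dd C Pos 0 v) x" using v by (auto simp: composable_def)
        then show ?thesis using False 2 v o Q.R0 by (simp add: Pos act_cl)
      qed
    qed
  next
    case (3 a b)
    then show ?case using Q.Rdiff[OF 3] by (simp add: algebra_simps)
  qed (simp add: Q.R0)
qed

end

text \<open>
  \<open>None\<close> stands for the globular theory, \<open>Some \<alpha>\<close> for the branching and the merging one.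
\<close>

definition formal_rel :: "sign option \<Rightarrow> 'u omegacat \<Rightarrow> nat \<Rightarrow> (('u, 'o) gen \<Rightarrow>\<^sub>0 int) set" where
  "formal_rel \<kappa> C n = (case \<kappa> of None \<Rightarrow> formal_rel_gl C n | Some \<alpha> \<Rightarrow> formal_rel_sc \<alpha> C n)"

lemma formal_rel_simps: "formal_rel None C = formal_rel_gl C" "formal_rel (Some \<alpha>) C = formal_rel_sc \<alpha> C"
  by (simp_all add: formal_rel_def fun_eq_iff)

definition formal_sub :: "sign option \<Rightarrow> 'u omegacat \<Rightarrow> 'o set \<Rightarrow> nat \<Rightarrow> (('u, 'o) gen \<Rightarrow>\<^sub>0 int) set" where
  "formal_sub \<kappa> C Ob n = generate (free_Abelian_group (formal_gens C Ob n)) (formal_rel \<kappa> C n)"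

lemma generate_zero: "0 \<in> generate (free_Abelian_group T) S"
  using generate.one[of "free_Abelian_group T" S] by simp

context non_contracting_cat
begin

lemma formal_rel_carrier: "formal_rel \<kappa> C n \<subseteq> carrier (free_Abelian_group (formal_gens C Ob n))"
proof (cases n)
  case 0
  then show ?thesis by (cases \<kappa>) (simp_all add: formal_rel_def formal_rel_gl_def formal_rel_sc_def)
next
  case (Suc k)
  then show ?thesis
    using formal_rel_gl_carrier[of n] formal_rel_sc_carrier[of _ k]
    by (cases \<kappa>) (simp_all add: formal_rel_def)
qed

lemma formal_sub_subgroup:
  "subgroup (formal_sub \<kappa> C Ob n) (free_Abelian_group (formal_gens C Ob n))"
  "additive_subgroup (formal_sub \<kappa> C Ob n)"
  unfolding formal_sub_def
  by (rule group.generate_is_subgroup[OF _ formal_rel_carrier], simp)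
    (rule generate_additive_subgroup(1)[OF formal_rel_carrier])

end

context kan_unit
begin

lemma lin_formal_rel_gl:
  assumes r: "r \<in> formal_rel_gl C n" shows "lin a n r \<in> formal_rel_gl H n"
proof -
  obtain p x y where x: "2 \<le> n" "r = cls C n (cmp C p x y) - (cls C n x + cls C n y)" "1 \<le> p" "p \<le> n - 1"
      "x \<in> tr (n - 1) (path C)" "y \<in> tr (n - 1) (path C)" "composable C p x y"
    using r unfolding formal_rel_gl_def by (auto split: if_splits)
  have d: "x \<in> mor C" "y \<in> mor C" "mdim C x \<le> n" "mdim C y \<le> n"
    using x(1,5,6) C.tr_path[of "n - 1"] by auto
  have "lin a n r = cls H n (cmp H p (\<eta> x) (\<eta> y)) - (cls H n (\<eta> x) + cls H n (\<eta> y))"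
    using d C.mdim_cmp[OF x(7) d(3,4)] C.cmp_closed[OF x(7)] f_cmp[OF x(7)] by (simp add: x(2) lin_cls)
  then show ?thesis
    using x(1,3,4) tr_path_unit[OF x(5)] tr_path_unit[OF x(6)] f_composable[OF x(7)]
    unfolding formal_rel_gl_def by (simp only: if_False not_le[symmetric] simp_thms) blast
qed

lemma lin_formal_rel_sc:
  assumes r: "r \<in> formal_rel_sc \<alpha> C n" shows "lin a n r \<in> formal_rel_sc \<alpha> H n"
proof -
  consider "n = 0" | "n = 1" | "2 \<le> n" by linarith
  then show ?thesis
  proof cases
    case 1
    then show ?thesis using r by (simp add: formal_rel_sc_def)
  next
    case 2
    then obtain x y where x: "r = frag_of (Cell (cmp C 0 x y)) - frag_of (Cell (case \<alpha> of Neg \<Rightarrow> x | Pos \<Rightarrow> y))"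
       "composable C 0 x y" "x \<in> mor_dim 1 C" "y \<in> mor_dim 1 C" "cmp C 0 x y \<in> mor_dim 1 C"
      using r by (auto simp: formal_rel_sc_def)
    have e: "lin a n (frag_of (Cell z)) = frag_of (Cell (\<eta> z))" if "z \<in> mor_dim 1 C" for z
      using that unit_mdim[of z] 2 by (simp add: lin_def cls_def mor_dim_def)
    have m: "\<eta> x \<in> mor_dim 1 H" "\<eta> y \<in> mor_dim 1 H" "cmp H 0 (\<eta> x) (\<eta> y) \<in> mor_dim 1 H"
      using bij_betwE[OF unit_bij[of 1]] x f_cmp[OF x(2)] by auto
    have "lin a n r = frag_of (Cell (cmp H 0 (\<eta> x) (\<eta> y))) - frag_of (Cell (case \<alpha> of Neg \<Rightarrow> \<eta> x | Pos \<Rightarrow> \<eta> y))"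
      using x e f_cmp[OF x(2)] by (cases \<alpha>) simp_all
    then show ?thesis using m f_composable[OF x(2)] 2 unfolding formal_rel_sc_def by auto
  next
    case 3
    then consider "r \<in> formal_rel_gl C n" |
      x y where "r = cls C n (cmp C 0 x y) - cls C n (case \<alpha> of Neg \<Rightarrow> x | Pos \<Rightarrow> y)" "composable C 0 x y"
        "x \<in> tr (n - 1) (path C)" "y \<in> tr (n - 1) (path C)"
      using r by (auto simp: formal_rel_sc_def)
    then show ?thesis
    proof cases
      case 1
      then show ?thesis using lin_formal_rel_gl[OF 1, of a] 3 by (simp add: formal_rel_sc_def)
    next
      case (2 x y)
      have d: "x \<in> mor C" "y \<in> mor C" "mdim C x \<le> n" "mdim C y \<le> n"
        using 2(3,4) 3 C.tr_path[of "n - 1"] by auto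
      have "lin a n r = cls H n (cmp H 0 (\<eta> x) (\<eta> y)) - cls H n (case \<alpha> of Neg \<Rightarrow> \<eta> x | Pos \<Rightarrow> \<eta> y)"
        using d C.mdim_cmp[OF 2(2) d(3,4)] C.cmp_closed[OF 2(2)] f_cmp[OF 2(2)]
        by (cases \<alpha>) (simp_all add: 2(1) lin_cls)
      then show ?thesis
        using 3 tr_path_unit[OF 2(3)] tr_path_unit[OF 2(4)] f_composable[OF 2(2)]
        unfolding formal_rel_sc_def by auto
    qed
  qed
qed

text \<open>
  The component \<open>A\<close> of the model functor, extended additively.  For the branching and merging relations, write the
  class of a horizontal composite by edge actions and apply \<open>act_sc\<close>.
\<close>

lemma retraction_high:
  fixes Q :: "(('u, 'o) gen \<Rightarrow>\<^sub>0 int) set" and a :: "'o \<Rightarrow> 'o"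
  assumes n: "2 \<le> n" and Q: "additive_subgroup Q" "generate (free_Abelian_group (Cell ` mor_dim n C)) (formal_rel_gl C n) \<subseteq> Q"
  obtains F where "\<And>r. r \<in> formal_rel_gl H n \<Longrightarrow> frag_extend F r \<in> Q"
    "\<And>x. x \<in> mor_dim n C \<Longrightarrow> frag_of (Cell x) - frag_extend F (lin a n (frag_of (Cell x))) \<in> Q"
    "\<And>\<alpha> r. Q = generate (free_Abelian_group (Cell ` mor_dim n C)) (formal_rel_sc \<alpha> C n) \<Longrightarrow>
       r \<in> formal_rel_sc \<alpha> H n \<Longrightarrow> frag_extend F r \<in> Q"
proof -
  define R :: "(('u, 'o) gen \<Rightarrow>\<^sub>0 int) set" where
    "R = generate (free_Abelian_group (Cell ` mor_dim n C)) (formal_rel_gl C n)"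
  interpret L: linear_model C n R by unfold_locales (use n R_def in auto)
  interpret Q: additive_subgroup Q by fact
  have RQ: "r \<in> Q" if "r \<in> R" for r using that Q(2) R_def by blast
  obtain A U V where
    S: "\<And>z. z \<in> mor H \<Longrightarrow> (U z, V z, A z) \<in> L.S" and
    low: "\<And>z. z \<in> mor H \<Longrightarrow> mdim H z < n \<Longrightarrow> A z \<in> R" and
    unit: "\<And>x. x \<in> mor C \<Longrightarrow> mdim C x \<le> n \<Longrightarrow> A (\<eta> x) - cls C n x \<in> R" and
    vert: "\<And>p x y. composable H p x y \<Longrightarrow> 0 < p \<Longrightarrow> p < n \<Longrightarrow> A (cmp H p x y) - (A x + A y) \<in> R" and
    hor: "\<And>x y. composable H 0 x y \<Longrightarrow> A (cmp H 0 x y) - (L.act Pos (U y) (A x) + L.act Neg (V x) (A y)) \<in> R" and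
    comp: "\<And>x y. composable H 0 x y \<Longrightarrow> composable C 0 (U x) (U y)" and
    dim: "\<And>z. z \<in> mor H \<Longrightarrow> mdim H z \<ge> 1 \<Longrightarrow> mdim C (U z) = 1 \<and> mdim C (V z) = 1"
    by (rule unit_retraction[OF L.linear_model_axioms]) (rule that)
  define F where "F g = (case g of Aug _ \<Rightarrow> 0 | Cell z \<Rightarrow> A z)" for g :: "('u, 'o) gen"
  have F: "frag_extend F (cls H n z) - A z \<in> R" if "z \<in> mor H" "mdim H z \<le> n" for z
    using that low[of z] L.R0 L.Rneg by (auto simp: cls_def F_def)
  have F_cmp: "frag_extend F (cls H n (cmp H p x y)) - A (cmp H p x y) \<in> R"
    if "composable H p x y" "mdim H x \<le> n" "mdim H y \<le> n" for p x y
    using F[OF D.cmp_closed[OF that(1)] D.mdim_cmp[OF that]] .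
  have trH: "z \<in> mor H \<and> 1 \<le> mdim H z \<and> mdim H z \<le> n" if "z \<in> tr (n - 1) (path H)" for z
    using that n D.tr_path[of "n - 1"] by auto
  have gl: "frag_extend F r \<in> Q" if r: "r \<in> formal_rel_gl H n" for r
  proof -
    obtain p x y where x: "r = cls H n (cmp H p x y) - (cls H n x + cls H n y)" "1 \<le> p" "p \<le> n - 1"
        "x \<in> tr (n - 1) (path H)" "y \<in> tr (n - 1) (path H)" "composable H p x y"
      using r unfolding formal_rel_gl_def by (auto split: if_splits)
    have d: "x \<in> mor H" "y \<in> mor H" "mdim H x \<le> n" "mdim H y \<le> n" using trH x(4,5) by auto
    have "A (cmp H p x y) - (A x + A y) \<in> R" using vert[OF x(6)] x(2,3) n by simp
    from L.Radd[OF L.Rdiff[OF L.Rdiff[OF F_cmp[OF x(6) d(3,4)] F[OF d(1,3)]] F[OF d(2,4)]] this]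
    have "frag_extend F r \<in> R" unfolding x(1) by (simp add: frag_extend_diff frag_extend_add algebra_simps)
    then show ?thesis by (rule RQ)
  qed
  have id: "frag_of (Cell x) - frag_extend F (lin a n (frag_of (Cell x))) \<in> Q" if x: "x \<in> mor_dim n C" for x
  proof (rule RQ)
    have m: "x \<in> mor C" "mdim C x = n" using x by (auto simp: mor_dim_def)
    have "lin a n (frag_of (Cell x)) = cls H n (\<eta> x)" by (simp add: lin_def)
    moreover have "frag_extend F (cls H n (\<eta> x)) - cls C n x \<in> R"
      using L.Rtrans[OF F[OF f_mor[OF m(1)] unit_mdim_le[OF m(1)]] unit[OF m(1)]] m(2) by simp
    moreover have "cls C n x = frag_of (Cell x)" using m by (simp add: cls_def)
    ultimately show "frag_of (Cell x) - frag_extend F (lin a n (frag_of (Cell x))) \<in> R"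
      using L.Rsym by metis
  qed
  have sc: "frag_extend F r \<in> Q"
    if Qe: "Q = generate (free_Abelian_group (Cell ` mor_dim n C)) (formal_rel_sc \<alpha> C n)" and r: "r \<in> formal_rel_sc \<alpha> H n" for \<alpha> r
  proof (cases "r \<in> formal_rel_gl H n")
    case False
    then obtain x y where x: "r = cls H n (cmp H 0 x y) - cls H n (case \<alpha> of Neg \<Rightarrow> x | Pos \<Rightarrow> y)" "composable H 0 x y"
        "x \<in> tr (n - 1) (path H)" "y \<in> tr (n - 1) (path H)"
      using r n unfolding formal_rel_sc_def by (auto split: if_splits)
    note tx = trH[OF x(3)] and ty = trH[OF x(4)]
    have Sx: "(U x, V x, A x) \<in> L.S" and Sy: "(U y, V y, A y) \<in> L.S" using S tx ty by auto
    note Bx = L.S_basic[OF Sx] and By = L.S_basic[OF Sy]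
    have e: "mdim C (U y) = 1" "mdim C (V x) = 1" using dim tx ty by auto
    have ox: "L.act Pos (dd C Pos 0 (V x)) (A x) - A x \<in> R"
      using L.qrep_eq_iff[THEN iffD1, of "L.act Pos (dd C Pos 0 (V x)) (A x)" "A x"] L.S_unit0(2)[OF Sx, of Pos] Bx by simp
    have oy: "L.act Neg (dd C Neg 0 (U y)) (A y) - A y \<in> R"
      using L.qrep_eq_iff[THEN iffD1, of "L.act Neg (dd C Neg 0 (U y)) (A y)" "A y"] L.S_unit0(1)[OF Sy, of Neg] By by simp
    have o: "dd C Neg 0 (U y) = dd C Pos 0 (V x)" using comp[OF x(2)] Bx by (simp add: composable_def)
    have main: "A (cmp H 0 x y) - A (case \<alpha> of Neg \<Rightarrow> x | Pos \<Rightarrow> y) \<in> Q"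
    proof (cases \<alpha>)
      case Neg
      have "L.act Neg (V x) (A y) \<in> Q"
        using L.act_sc(1)[of "V x" "A y" Neg] Bx By e unfolding Qe Neg by simp
      moreover have "L.act Pos (U y) (A x) - L.act Pos (dd C Neg 0 (U y)) (A x) \<in> Q"
        using L.act_sc(2)[of "U y" "A x" Neg] Bx By e unfolding Qe Neg by simp
      ultimately have "(L.act Neg (V x) (A y) + (L.act Pos (U y) (A x) - L.act Pos (dd C Neg 0 (U y)) (A x)))
          + (L.act Pos (dd C Pos 0 (V x)) (A x) - A x) + (A (cmp H 0 x y) - (L.act Pos (U y) (A x) + L.act Neg (V x) (A y))) \<in> Q"
        using RQ[OF ox] RQ[OF hor[OF x(2)]] by (intro Q.Radd)
      then show ?thesis unfolding o Neg by (simp add: algebra_simps)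
    next
      case Pos
      have "L.act Pos (U y) (A x) \<in> Q"
        using L.act_sc(1)[of "U y" "A x" Pos] Bx By e unfolding Qe Pos by simp
      moreover have "L.act Neg (V x) (A y) - L.act Neg (dd C Pos 0 (V x)) (A y) \<in> Q"
        using L.act_sc(2)[of "V x" "A y" Pos] Bx By e unfolding Qe Pos by simp
      ultimately have "(L.act Pos (U y) (A x) + (L.act Neg (V x) (A y) - L.act Neg (dd C Pos 0 (V x)) (A y)))
          + (L.act Neg (dd C Neg 0 (U y)) (A y) - A y) + (A (cmp H 0 x y) - (L.act Pos (U y) (A x) + L.act Neg (V x) (A y))) \<in> Q"
        using RQ[OF oy] RQ[OF hor[OF x(2)]] by (intro Q.Radd)
      then show ?thesis unfolding o Pos by (simp add: algebra_simps)
    qed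
    let ?k = "case \<alpha> of Neg \<Rightarrow> x | Pos \<Rightarrow> y"
    have k: "?k \<in> mor H" "mdim H ?k \<le> n" using tx ty by (cases \<alpha>; simp)+
    have "(frag_extend F (cls H n (cmp H 0 x y)) - A (cmp H 0 x y)) - (frag_extend F (cls H n ?k) - A ?k) + (A (cmp H 0 x y) - A ?k) \<in> Q"
      using tx ty by (intro Q.Radd[OF Q.Rdiff[OF RQ[OF F_cmp[OF x(2)]] RQ[OF F[OF k]]] main]) simp_all
    then show ?thesis unfolding x(1) by (simp add: frag_extend_diff algebra_simps)
  qed (rule gl)
  show ?thesis using that gl id sc by blast
qed

lemma lin_surj_high:
  fixes a :: "'o \<Rightarrow> 'o"
  assumes n: "2 \<le> n" and z: "z \<in> mor_dim n H"
  shows "\<exists>c\<in>carrier (free_Abelian_group (Cell ` mor_dim n C)).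
     frag_of (Cell z) - lin a n c \<in> generate (free_Abelian_group (Cell ` mor_dim n H)) (formal_rel_gl H n)"
  using unit_cls_surj[OF n refl, where z = z and a = a and \<alpha> = Neg] z by (simp add: mor_dim_def cls_def)

lemma lin_low:
  "x \<in> mor_dim 1 C \<Longrightarrow> lin a (Suc 0) (frag_of (Cell x)) = frag_of (Cell (\<eta> x))"
  using unit_mdim[of x] by (simp add: lin_def cls_def mor_dim_def)

text \<open>
  In degrees 0 and 1 the unit is bijective on generators.
\<close>

definition low_inverse :: "('o \<Rightarrow> 'o) \<Rightarrow> 'o set \<Rightarrow> ('u, 'o) gen \<Rightarrow> (('u, 'o) gen \<Rightarrow>\<^sub>0 int)" where
  "low_inverse a Ob g = frag_of (case g of Aug y \<Rightarrow> Aug (inv_into Ob a y) | Cell z \<Rightarrow> Cell (inv_into (mor_dim 1 C) \<eta> z))"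

lemma low_inverse:
  assumes a: "bij_betw a Ob Ob'" and n: "n \<le> 1"
  shows "g \<in> formal_gens C Ob n \<Longrightarrow> frag_extend (low_inverse a Ob) (lin a n (frag_of g)) = frag_of g"
    "g \<in> formal_gens H Ob' n \<Longrightarrow> \<exists>c\<in>carrier (free_Abelian_group (formal_gens C Ob n)). frag_of g = lin a n c"
proof -
  have u: "inj_on \<eta> (mor_dim 1 C)" "\<eta> ` mor_dim 1 C = mor_dim 1 H" using unit_bij[of 1] by (auto simp: bij_betw_def)
  have i: "inj_on a Ob" "a ` Ob = Ob'" using a by (auto simp: bij_betw_def)
  show "frag_extend (low_inverse a Ob) (lin a n (frag_of g)) = frag_of g" if g: "g \<in> formal_gens C Ob n"
  proof (cases n)
    case 0
    then show ?thesis using g i by (auto simp: low_inverse_def)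
  next
    case (Suc k)
    then have "n = Suc 0" using n by simp
    then show ?thesis using g u by (auto simp: low_inverse_def lin_low)
  qed
  show "\<exists>c\<in>carrier (free_Abelian_group (formal_gens C Ob n)). frag_of g = lin a n c" if g: "g \<in> formal_gens H Ob' n"
  proof (cases n)
    case 0
    then obtain y where "g = Aug (a y)" "y \<in> Ob" using g i by auto
    then show ?thesis using 0 by (intro bexI[of _ "frag_of (Aug y)"]) (auto simp: keys_frag_of)
  next
    case (Suc k)
    then have n1: "n = Suc 0" using n by simp
    then obtain x where "g = Cell (\<eta> x)" "x \<in> mor_dim 1 C" using g u by auto
    then show ?thesis using n1 by (intro bexI[of _ "frag_of (Cell x)"]) (auto simp: keys_frag_of lin_low)
  qed
qed

text \<open>
  The unit reflects horizontal composability of edges, so relations between edges of the completion are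
  relations between edges of \<open>C\<close>.
\<close>

lemma low_inverse_sc:
  assumes r: "r \<in> formal_rel_sc \<alpha> H 1" shows "frag_extend (low_inverse a Ob) r \<in> formal_rel_sc \<alpha> C 1"
proof -
  obtain x y where x: "r = frag_of (Cell (cmp H 0 x y)) - frag_of (Cell (case \<alpha> of Neg \<Rightarrow> x | Pos \<Rightarrow> y))"
       "composable H 0 x y" "x \<in> mor_dim 1 H" "y \<in> mor_dim 1 H" "cmp H 0 x y \<in> mor_dim 1 H"
    using r by (auto simp: formal_rel_sc_def)
  have u: "inj_on \<eta> (mor_dim 1 C)" "\<eta> ` mor_dim 1 C = mor_dim 1 H" using unit_bij[of 1] by (auto simp: bij_betw_def)
  obtain x0 y0 where xy: "x0 \<in> mor_dim 1 C" "x = \<eta> x0" "y0 \<in> mor_dim 1 C" "y = \<eta> y0" using x(3,4) u(2) by blast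
  have m: "x0 \<in> mor C" "y0 \<in> mor C" "mdim C x0 = 1" "mdim C y0 = 1" using xy by (auto simp: mor_dim_def)
  have c: "composable C 0 x0 y0" using x(2) xy unit_composable_0[OF m(1,2)] by simp
  have e: "cmp H 0 x y = \<eta> (cmp C 0 x0 y0)" using f_cmp[OF c] xy by simp
  have "mdim C (cmp C 0 x0 y0) \<le> 1" using C.mdim_cmp[OF c] m by simp
  then have k: "cmp C 0 x0 y0 \<in> mor_dim 1 C"
    using x(5) e unit_mdim[OF C.cmp_closed[OF c]] C.cmp_closed[OF c] by (simp add: mor_dim_def)
  have "frag_extend (low_inverse a Ob) r =
      frag_of (Cell (cmp C 0 x0 y0)) - frag_of (Cell (case \<alpha> of Neg \<Rightarrow> x0 | Pos \<Rightarrow> y0))"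
    using x(1) e xy k u(1) by (cases \<alpha>) (simp_all add: frag_extend_diff low_inverse_def)
  then show ?thesis using xy c k unfolding formal_rel_sc_def by auto
qed

lemma lin_formal_rel: "r \<in> formal_rel \<kappa> C n \<Longrightarrow> lin a n r \<in> formal_rel \<kappa> H n"
  by (cases \<kappa>) (simp_all add: formal_rel_def lin_formal_rel_gl lin_formal_rel_sc)

lemma low_degree_cases: "n \<le> 1 \<or> (\<exists>k. n = Suc k \<and> 2 \<le> n)"
  by (cases n) auto

lemma formal_retraction:
  assumes a: "bij_betw a Ob Ob'"
  obtains F where "\<And>r. r \<in> formal_rel \<kappa> H n \<Longrightarrow> frag_extend F r \<in> formal_sub \<kappa> C Ob n"
    "\<And>g. g \<in> formal_gens C Ob n \<Longrightarrow> frag_of g - frag_extend F (lin a n (frag_of g)) \<in> formal_sub \<kappa> C Ob n"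
proof (cases "n \<le> 1")
  case True
  show ?thesis
  proof (rule that[of "low_inverse a Ob"])
    show "frag_of g - frag_extend (low_inverse a Ob) (lin a n (frag_of g)) \<in> formal_sub \<kappa> C Ob n"
      if "g \<in> formal_gens C Ob n" for g
      using low_inverse(1)[OF a True that] by (simp add: formal_sub_def generate_zero)
    show "frag_extend (low_inverse a Ob) r \<in> formal_sub \<kappa> C Ob n" if r: "r \<in> formal_rel \<kappa> H n" for r
    proof -
      obtain \<alpha> where \<alpha>: "\<kappa> = Some \<alpha>" "n = 1"
        using r True by (cases \<kappa>; cases n) (auto simp: formal_rel_def formal_rel_gl_def formal_rel_sc_def)
      then show ?thesis
        using r low_inverse_sc[of r \<alpha> a Ob] unfolding formal_sub_def
        by (intro generate.incl) (simp add: formal_rel_def)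
    qed
  qed
next
  case False
  then obtain k where k: "n = Suc k" "2 \<le> n" using low_degree_cases[of n] by blast
  have sub: "formal_sub \<kappa> C Ob n = generate (free_Abelian_group (Cell ` mor_dim n C)) (formal_rel \<kappa> C n)"
    using k by (simp add: formal_sub_def)
  have "formal_rel_gl C n \<subseteq> formal_rel \<kappa> C n"
    using k by (cases \<kappa>) (auto simp: formal_rel_def formal_rel_sc_def)
  then have "generate (free_Abelian_group (Cell ` mor_dim n C)) (formal_rel_gl C n) \<subseteq> formal_sub \<kappa> C Ob n"
    unfolding sub by (rule group.mono_generate[rotated]) simp
  then obtain F where F: "\<And>r. r \<in> formal_rel_gl H n \<Longrightarrow> frag_extend F r \<in> formal_sub \<kappa> C Ob n"
    "\<And>x. x \<in> mor_dim n C \<Longrightarrow> frag_of (Cell x) - frag_extend F (lin a n (frag_of (Cell x))) \<in> formal_sub \<kappa> C Ob n"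
    "\<And>\<alpha> r. formal_sub \<kappa> C Ob n = generate (free_Abelian_group (Cell ` mor_dim n C)) (formal_rel_sc \<alpha> C n) \<Longrightarrow>
       r \<in> formal_rel_sc \<alpha> H n \<Longrightarrow> frag_extend F r \<in> formal_sub \<kappa> C Ob n"
    by (rule retraction_high[OF k(2) C.formal_sub_subgroup(2), where a = a]) (rule that)
  show ?thesis
  proof (rule that[of F])
    show "frag_extend F r \<in> formal_sub \<kappa> C Ob n" if "r \<in> formal_rel \<kappa> H n" for r
    proof (cases \<kappa>)
      case None
      then show ?thesis using that F(1) by (simp add: formal_rel_def)
    next
      case (Some \<alpha>)
      then show ?thesis using that F(3)[of \<alpha> r] sub by (simp add: formal_rel_def)
    qed
    show "frag_of g - frag_extend F (lin a n (frag_of g)) \<in> formal_sub \<kappa> C Ob n"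
      if "g \<in> formal_gens C Ob n" for g
      using that F(2) k by auto
  qed
qed

lemma formal_surj:
  assumes a: "bij_betw a Ob Ob'" and g: "g \<in> formal_gens H Ob' n"
  shows "\<exists>c\<in>carrier (free_Abelian_group (formal_gens C Ob n)). frag_of g - lin a n c \<in> formal_sub \<kappa> H Ob' n"
proof (cases "n \<le> 1")
  case True
  obtain c where "c \<in> carrier (free_Abelian_group (formal_gens C Ob n))" "frag_of g = lin a n c"
    using low_inverse(2)[OF a True g] by blast
  then show ?thesis by (intro bexI[of _ c]) (simp_all only: diff_self formal_sub_def generate_zero)
next
  case False
  then obtain k where k: "n = Suc k" "2 \<le> n" using low_degree_cases[of n] by blast
  then obtain z where z: "g = Cell z" "z \<in> mor_dim n H" using g by auto
  have "formal_rel_gl H n \<subseteq> formal_rel \<kappa> H n"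
    using k by (cases \<kappa>) (auto simp: formal_rel_def formal_rel_sc_def)
  then have "generate (free_Abelian_group (Cell ` mor_dim n H)) (formal_rel_gl H n) \<subseteq> formal_sub \<kappa> H Ob' n"
    unfolding formal_sub_def k(1) formal_gens.simps by (rule group.mono_generate[rotated]) simp
  then show ?thesis using lin_surj_high[OF k(2) z(2), of a] z k by auto
qed

end

section \<open>Comparison of the nerve complexes\<close>

lemma formal_free_simps:
  "grp (formal_free C Ob a) n = free_Abelian_group (formal_gens C Ob n)"
  "bdy (formal_free C Ob a) n = frag_extend (formal_bdy C a n)"
  by (simp_all add: formal_free_def)

lemma cls_carrier: "x \<in> mor C \<Longrightarrow> cls C (Suc n) x \<in> carrier (free_Abelian_group (formal_gens C Ob (Suc n)))"
  using keys_cls[of x C "Suc n"] by simp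

lemma formal_bdy_hom:
  assumes C: "omega_category C" and a: "\<And>x. x \<in> mor_dim 1 C \<Longrightarrow> a x \<in> Ob"
  shows "bdy (formal_free C Ob a) n \<in> hom (grp (formal_free C Ob a) (Suc n)) (grp (formal_free C Ob a) n)"
  unfolding formal_free_simps
proof (rule frag_extend_hom)
  interpret C: omega_cat C by unfold_locales fact
  fix g assume g: "g \<in> formal_gens C Ob (Suc n)"
  then obtain x where x: "g = Cell x" "x \<in> mor C" "mdim C x = Suc n" by (auto simp: mor_dim_def)
  show "formal_bdy C a n g \<in> carrier (free_Abelian_group (formal_gens C Ob n))"
  proof (cases n)
    case 0
    then show ?thesis using x a[of x] by (simp add: mor_dim_def keys_frag_of)
  next
    case (Suc k)
    let ?s = "cls C (Suc k) (dd C Neg (Suc k) x)" and ?t = "cls C (Suc k) (dd C Pos (Suc k) x)"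
    have "Poly_Mapping.keys ?s \<subseteq> Cell ` mor_dim (Suc k) C" "Poly_Mapping.keys ?t \<subseteq> Cell ` mor_dim (Suc k) C"
      using x by (auto intro!: keys_cls)
    then have "Poly_Mapping.keys (?s - ?t) \<subseteq> Cell ` mor_dim (Suc k) C"
      using keys_diff[of ?s ?t] by blast
    then show ?thesis using x Suc by simp
  qed
qed

text \<open>
  The three theories at once: \<open>N\<close>, \<open>N'\<close> are the nerves of \<open>C\<close> and of its completion, \<open>b\<close>, \<open>b'\<close> their folding
  operators, and \<open>aC\<close>, \<open>aH\<close> the differentials from degree 1 to degree 0 of the formal complexes.
\<close>

locale nerve_comparison = kan_unit C H \<eta> + nerve_map C N H N' m a
  for C H :: "'u omegacat" and \<eta> and N N' :: "('s, 'o, 'u) nerve" and m :: "nat \<Rightarrow> 's \<Rightarrow> 's" and a :: "'o \<Rightarrow> 'o" +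
  fixes b b' :: "nat \<Rightarrow> 'u \<Rightarrow> 's" and aC aH :: "'u \<Rightarrow> 'o" and \<kappa> :: "sign option"
  assumes aug_bij: "bij_betw a (aug_simplices N) (aug_simplices N')"
    and aC: "x \<in> mor_dim 1 C \<Longrightarrow> aC x \<in> aug_simplices N" and aH: "z \<in> mor_dim 1 H \<Longrightarrow> aH z \<in> aug_simplices N'"
    and a_natural: "x \<in> mor_dim 1 C \<Longrightarrow> aH (\<eta> x) = a (aC x)"
    and fold_C: "x \<in> tr k (path C) \<Longrightarrow> b (Suc k) x \<in> simplices N k"
    and fold_H: "z \<in> tr k (path H) \<Longrightarrow> b' (Suc k) z \<in> simplices N' k"
      "z \<in> tr k (path H) \<Longrightarrow> ev N' k (b' (Suc k) z) = z"
    and fold_natural: "x \<in> tr k (path C) \<Longrightarrow> b' (Suc k) (\<eta> x) = m k (b (Suc k) x)"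
begin

abbreviation "X \<equiv> formal_free C (aug_simplices N) aC"
abbreviation "Y \<equiv> formal_free H (aug_simplices N') aH"
abbreviation "BX \<equiv> formal_sub \<kappa> C (aug_simplices N)"
abbreviation "BY \<equiv> formal_sub \<kappa> H (aug_simplices N')"

lemmas BX = C.formal_sub_subgroup[of \<kappa> "aug_simplices N", folded formal_free_simps(1)[of C _ aC]]
  and BY = D.formal_sub_subgroup[of \<kappa> "aug_simplices N'", folded formal_free_simps(1)[of H _ aH]]

lemma lin_hom: "lin a n \<in> hom (grp X n) (grp Y n)"
  unfolding formal_free_simps lin_def
proof (rule frag_extend_hom)
  fix g assume g: "g \<in> formal_gens C (aug_simplices N) n"
  show "(case g of Aug y \<Rightarrow> frag_of (Aug (a y)) | Cell x \<Rightarrow> cls H n (\<eta> x))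
      \<in> carrier (free_Abelian_group (formal_gens H (aug_simplices N') n))"
  proof (cases n)
    case 0
    then show ?thesis using g aug by (auto simp: keys_frag_of)
  next
    case (Suc k)
    then obtain x where "g = Cell x" "x \<in> mor C" using g by (auto simp: mor_dim_def)
    then show ?thesis using cls_carrier[OF f_mor] Suc by simp
  qed
qed

text \<open>
  If the image of a cell of dimension \<open>n + 1\<close> has smaller dimension, it is its own source and target, so that
  its boundary vanishes as it should.
\<close>

lemma lin_chain_map: "chain_map X Y (lin a)"
  unfolding chain_map_def
proof (intro conjI allI ballI)
  fix n show "lin a n \<in> hom (grp X n) (grp Y n)" by (rule lin_hom)
  fix x assume "x \<in> carrier (grp X (Suc n))"
  then have x: "x \<in> carrier (free_Abelian_group (formal_gens C (aug_simplices N) (Suc n)))"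
    by (simp only: formal_free_simps)
  show "lin a n (bdy X n x) = bdy Y n (lin a (Suc n) x)"
    unfolding formal_free_simps lin_def
  proof (rule frag_extend_comp_eq[OF x])
    fix g assume "g \<in> formal_gens C (aug_simplices N) (Suc n)"
    then obtain x where x: "g = Cell x" "x \<in> mor C" "mdim C x = Suc n" by (auto simp: mor_dim_def)
    have "lin a n (formal_bdy C aC n (Cell x)) = frag_extend (formal_bdy H aH n) (cls H (Suc n) (\<eta> x))"
    proof (cases n)
      case 0
      have "mdim H (\<eta> x) = 1" using unit_mdim[of x] x 0 by simp
      then show ?thesis using 0 a_natural[of x] x by (simp add: cls_def mor_dim_def)
    next
      case (Suc k)
      have "lin a n (formal_bdy C aC n (Cell x)) =
          cls H (Suc k) (dd H Neg (Suc k) (\<eta> x)) - cls H (Suc k) (dd H Pos (Suc k) (\<eta> x))"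
        using Suc x C.mdim_dd[of x _ "Suc k"] by (simp add: lin_cls f_dd)
      also have "\<dots> = frag_extend (formal_bdy H aH n) (cls H (Suc n) (\<eta> x))"
      proof (cases "mdim H (\<eta> x) = Suc n")
        case True
        then show ?thesis using Suc by (simp add: cls_def[of H "Suc (Suc k)"])
      next
        case False
        then have "mdim H (\<eta> x) \<le> Suc k" using unit_mdim_le[of x "Suc n"] x Suc by simp
        then show ?thesis using False f_mor[OF x(2)] Suc by (simp add: cls_def[of H "Suc (Suc k)"])
      qed
      finally show ?thesis .
    qed
    then show "frag_extend (\<lambda>g. case g of Aug y \<Rightarrow> frag_of (Aug (a y)) | Cell x \<Rightarrow> cls H n (\<eta> x)) (formal_bdy C aC n g) =
      frag_extend (formal_bdy H aH n) (case g of Aug y \<Rightarrow> frag_of (Aug (a y)) | Cell x \<Rightarrow> cls H (Suc n) (\<eta> x))"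
      unfolding x(1) by (simp add: lin_def)
  qed
qed

lemma lin_BX: "lin a n ` BX n \<subseteq> BY n"
proof clarify
  fix r assume r: "r \<in> BX n"
  show "lin a n r \<in> BY n"
    unfolding lin_def
    by (rule generate_additive_image[OF C.formal_rel_carrier BY(2) _ r[unfolded formal_sub_def]],
        fold lin_def, unfold formal_sub_def, rule generate.incl, rule lin_formal_rel)
qed

text \<open>
  The retraction maps relations of the completion to relations of \<open>C\<close> and is a left inverse of the unit up
  to relations.
\<close>

lemma lin_inj: "x \<in> carrier (grp X n) \<Longrightarrow> lin a n x \<in> BY n \<Longrightarrow> x \<in> BX n"
proof -
  assume x: "x \<in> carrier (grp X n)" and l: "lin a n x \<in> BY n"
  interpret B: additive_subgroup "BX n" by (rule BX)
  obtain F where F: "\<And>r. r \<in> formal_rel \<kappa> H n \<Longrightarrow> frag_extend F r \<in> BX n"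
    "\<And>g. g \<in> formal_gens C (aug_simplices N) n \<Longrightarrow> frag_of g - frag_extend F (lin a n (frag_of g)) \<in> BX n"
    by (rule formal_retraction[OF aug_bij]) (rule that)
  have k: "Poly_Mapping.keys x \<subseteq> formal_gens C (aug_simplices N) n" using x by (simp add: formal_free_simps)
  have "x - frag_extend F (lin a n x) \<in> BX n"
    using k
  proof (induction x rule: frag_induction)
    case (diff u v)
    have "(u - frag_extend F (lin a n u)) - (v - frag_extend F (lin a n v)) \<in> BX n"
      by (rule B.Rdiff[OF diff])
    then show ?case by (simp add: frag_extend_diff algebra_simps)
  qed (use F B.R0 in auto)
  moreover have "frag_extend F (lin a n x) \<in> BX n"
    by (rule generate_additive_image[OF D.formal_rel_carrier BX(2) F(1) l[unfolded formal_sub_def]])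
  ultimately show "x \<in> BX n" using B.Radd by fastforce
qed

lemma lin_onto: "y \<in> carrier (grp Y n) \<Longrightarrow> \<exists>x\<in>carrier (grp X n). y - lin a n x \<in> BY n"
proof -
  assume y: "y \<in> carrier (grp Y n)"
  interpret B: additive_subgroup "BY n" by (rule BY)
  have k: "Poly_Mapping.keys y \<subseteq> formal_gens H (aug_simplices N') n" using y by (simp add: formal_free_simps)
  then show ?thesis
  proof (induction y rule: frag_induction)
    case zero
    show ?case using B.R0 by (intro bexI[of _ 0]) (auto simp: formal_free_simps)
  next
    case (one g)
    then show ?case using formal_surj[OF aug_bij] unfolding formal_free_simps by blast
  next
    case (diff u v)
    obtain c where c: "c \<in> carrier (grp X n)" "u - lin a n c \<in> BY n" using diff(1) by blast
    obtain d where d: "d \<in> carrier (grp X n)" "v - lin a n d \<in> BY n" using diff(2) by blast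
    have "(u - v) - lin a n (c - d) \<in> BY n"
      using B.Rdiff[OF c(2) d(2)] by (simp add: algebra_simps)
    moreover have "c - d \<in> carrier (grp X n)"
      using c(1) d(1) keys_diff[of c d] by (auto simp: formal_free_simps)
    ultimately show ?case by blast
  qed
qed

text \<open>
  The formal complexes are isomorphic by \<open>lin_inj\<close> and \<open>lin_onto\<close>.  Through the foldings this gives an
  isomorphism in homology of reduced complexes, and through the reductions one of nerve complexes.
  The folding square commutes only modulo thin simplices: a cell whose image drops dimension is zero
  in the formal complex, and its folding is thin.
\<close>

lemma quasi_iso_chain:
  assumes redN: "quasi_iso (nerve_complex N) (reduced_complex C N) (reduction C N)"
    and redN': "quasi_iso (nerve_complex N') (reduced_complex H N') (reduction H N')"
    and foldC: "quasi_iso (formal_complex C (aug_simplices N) aC (formal_rel \<kappa> C)) (reduced_complex C N) (fold_map C N b)"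
    and foldH: "quasi_iso (formal_complex H (aug_simplices N') aH (formal_rel \<kappa> H)) (reduced_complex H N') (fold_map H N' b')"
  shows "quasi_iso (nerve_complex N) (nerve_complex N') chain"
proof (rule quasi_iso_of_reduced[OF redN redN'])
  let ?cr = "\<lambda>n. coset_map (grp (nerve_complex N') n) (reduced_rel H N' n) (chain n)"
  let ?cf = "\<lambda>n. coset_map (grp Y n) (BY n) (lin a n)"
  have fc: "formal_complex C (aug_simplices N) aC (formal_rel \<kappa> C) = quotient_complex X BX"
    "formal_complex H (aug_simplices N') aH (formal_rel \<kappa> H) = quotient_complex Y BY"
    unfolding formal_complex_def formal_sub_def formal_free_simps by (rule refl)+
  note foldC = foldC[unfolded fc] and foldH = foldH[unfolded fc]
  have cc: "chain_complex (quotient_complex X BX)" "chain_complex (quotient_complex Y BY)"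
    "chain_complex (reduced_complex C N)" "chain_complex (reduced_complex H N')"
    using foldC foldH by (auto simp: quasi_iso_def)
  have comm: "comm_group (grp X n)" "comm_group (grp Y n)" "group (grp X n)" "group (grp Y n)" for n
    unfolding formal_free_simps by (simp_all add: abelian_free_Abelian_group)
  interpret Q: quotient_map X BX Y BY "lin a"
    by (intro quotient_map.intro comm BX(1) BY(1) formal_bdy_hom C.omega_category D.omega_category aC aH
        cc lin_chain_map lin_BX)
  have cf: "quasi_iso (quotient_complex X BX) (quotient_complex Y BY) ?cf"
  proof (rule Q.quasi_iso_quotient[OF lin_inj])
    fix n y assume "y \<in> carrier (grp Y n)"
    then obtain x where x: "x \<in> carrier (grp X n)" "y - lin a n x \<in> BY n" using lin_onto by blast
    moreover have "y = (y - lin a n x) \<otimes>\<^bsub>grp Y n\<^esub> lin a n x" by (simp add: formal_free_simps)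
    ultimately show "\<exists>x\<in>carrier (grp X n). \<exists>b\<in>BY n. y = b \<otimes>\<^bsub>grp Y n\<^esub> lin a n x" by blast
  qed
  have fold_gen_C: "fold_gen b n \<in> hom (grp X n) (grp (nerve_complex N) n)" for n
    unfolding formal_free_simps nerve_complex_simps fold_gen_def
  proof (rule frag_extend_hom)
    fix g assume "g \<in> formal_gens C (aug_simplices N) n"
    then show "frag_of (case g of Aug a \<Rightarrow> Aug a | Cell x \<Rightarrow> Cell (b n x)) \<in> carrier (free_Abelian_group (nerve_gens N n))"
      using fold_C by (cases n) (auto simp: keys_frag_of C.tr_path mor_dim_def)
  qed
  have fold_gen_H: "fold_gen b' n \<in> hom (grp Y n) (grp (nerve_complex N') n)" for n
    unfolding formal_free_simps nerve_complex_simps fold_gen_def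
  proof (rule frag_extend_hom)
    fix g assume "g \<in> formal_gens H (aug_simplices N') n"
    then show "frag_of (case g of Aug a \<Rightarrow> Aug a | Cell x \<Rightarrow> Cell (b' n x)) \<in> carrier (free_Abelian_group (nerve_gens N' n))"
      using fold_H by (cases n) (auto simp: keys_frag_of D.tr_path mor_dim_def)
  qed
  have ng: "group (grp (nerve_complex N) n)" "group (grp (nerve_complex N') n)" for n
    using chain_complexD(2)[OF N] chain_complexD(2)[OF N'] by auto
  have fold_C_rel: "fold_gen b n ` BX n \<subseteq> reduced_rel C N n" for n
    using foldC chain_mapD(1)[of _ _ "fold_map C N b" n]
    by (intro coset_map_hom_imp_subset[OF comm(3) ng(1) BX(1) reduced_rel_subgroup[OF N] fold_gen_C])
      (auto simp: quasi_iso_def reduced_complex_def quotient_complex_def fold_map_def chain_map_def)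
  have fold_H_rel: "fold_gen b' n ` BY n \<subseteq> reduced_rel H N' n" for n
    using foldH chain_mapD(1)[of _ _ "fold_map H N' b'" n]
    by (intro coset_map_hom_imp_subset[OF comm(4) ng(2) BY(1) reduced_rel_subgroup[OF N'] fold_gen_H])
      (auto simp: quasi_iso_def reduced_complex_def quotient_complex_def fold_map_def chain_map_def)
  have square: "fold_gen b' n (lin a n x) - chain n (fold_gen b n x) \<in> reduced_rel H N' n"
    if x: "x \<in> carrier (grp X n)" for n x
  proof -
    have sub: "additive_subgroup (reduced_rel H N' n)"
    proof
      interpret S: subgroup "reduced_rel H N' n" "grp (nerve_complex N') n" by (rule reduced_rel_subgroup[OF N'])
      show "0 \<in> reduced_rel H N' n" using S.one_closed by (simp add: nerve_complex_simps)
      fix r s assume rs: "r \<in> reduced_rel H N' n" "s \<in> reduced_rel H N' n"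
      then have "Poly_Mapping.keys s \<subseteq> nerve_gens N' n" using S.mem_carrier[of s] by (simp add: nerve_complex_simps)
      then show "r - s \<in> reduced_rel H N' n"
        using S.m_closed[OF rs(1) S.m_inv_closed[OF rs(2)]] by (simp add: nerve_complex_simps)
    qed
    then interpret RR: additive_subgroup "reduced_rel H N' n" .
    have k: "Poly_Mapping.keys x \<subseteq> formal_gens C (aug_simplices N) n" using x by (simp add: formal_free_simps)
    then show ?thesis
    proof (induction x rule: frag_induction)
      case zero
      then show ?case using RR.R0 by (simp add: fold_gen_def chain_def)
    next
      case (one g)
      show ?case
      proof (cases n)
        case 0
        then show ?thesis using one RR.R0 by (auto simp: fold_gen_def chain_def)
      next
        case (Suc k)
        then obtain x where g: "g = Cell x" "x \<in> mor C" "mdim C x = Suc k" using one by (auto simp: mor_dim_def)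
        then have xt: "x \<in> tr k (path C)" unfolding C.tr_path by simp
        have c: "chain n (fold_gen b n (frag_of g)) = frag_of (Cell (b' n (\<eta> x)))"
          using fold_natural[OF xt] g Suc by (simp add: fold_gen_def chain_def)
        have l: "lin a n (frag_of g) = cls H n (\<eta> x)" using g by (simp add: lin_def)
        show ?thesis
        proof (cases "mdim H (\<eta> x) = n")
          case True
          then show ?thesis unfolding c l using RR.R0 by (simp add: cls_def fold_gen_def)
        next
          case False
          then have d: "mdim H (\<eta> x) \<le> k" "1 \<le> mdim H (\<eta> x)"
            using unit_mdim_le[of x "Suc k"] g Suc non_contracting_functor_mdim[OF nc f_nc g(2)] by auto
          then obtain j where j: "k = Suc j" by (cases k) auto
          have z: "\<eta> x \<in> tr k (path H)" "\<eta> x \<in> tr j (path H)"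
            using d f_mor[OF g(2)] j unfolding D.tr_path by auto
          \<comment> \<open>The image lies in dimension at most n - 1, which is what thinness of its folding means.\<close>
          have "Cell (b' n (\<eta> x)) \<in> thin_gens H N' n"
            using fold_H[OF z(1)] z(2) by (simp add: Suc j)
          then have t: "frag_of (Cell (b' n (\<eta> x))) \<in> thin H N' n"
            unfolding thin_def by (simp only: frag_of_in_free_Abelian_group)
          have zero: "0 \<in> thin H N' (Suc n)" by (simp add: thin_def)
          have "frag_of (Cell (b' n (\<eta> x))) + bdy (nerve_complex N') n 0 \<in> reduced_rel H N' n"
            unfolding reduced_rel_def set_mult_def
            by (rule UN_I[OF t], rule UN_I[OF imageI[OF zero]]) (simp add: nerve_complex_simps)
          then have "frag_of (Cell (b' n (\<eta> x))) \<in> reduced_rel H N' n" by (simp add: nerve_complex_simps)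
          then show ?thesis unfolding c l using False RR.Rneg by (simp add: cls_def fold_gen_def)
        qed
      qed
    next
      case (diff u v)
      then show ?case using RR.Rdiff[OF diff] by (simp add: fold_gen_def chain_def frag_extend_diff algebra_simps)
    qed
  qed
  show "quasi_iso (reduced_complex C N) (reduced_complex H N') ?cr"
  proof (rule quasi_iso_cancel_right[OF _ foldC chain_map_reduced[OF cc(3,4)]])
    show "quasi_iso (quotient_complex X BX) (reduced_complex H N') (\<lambda>n x. ?cr n (fold_map C N b n x))"
    proof (rule quasi_iso_cong[OF quasi_iso_compose[OF cf foldH]])
      fix n c assume "c \<in> carrier (grp (quotient_complex X BX) n)"
      then obtain x where x: "x \<in> carrier (grp X n)" "c = BX n #>\<^bsub>grp X n\<^esub> x"
        by (auto simp: quotient_complex_def FactGroup_def RCOSETS_def)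
      have "?cr n (fold_map C N b n c) = reduced_rel H N' n #>\<^bsub>grp (nerve_complex N') n\<^esub> chain n (fold_gen b n x)"
        unfolding fold_map_def x(2)
        using coset_map_rcos[OF comm(3) ng(1) BX(1) reduced_rel_subgroup[OF N] fold_gen_C fold_C_rel x(1)]
          coset_map_rcos[OF ng(1) ng(2) reduced_rel_subgroup[OF N] reduced_rel_subgroup[OF N'] chain_mapD(1)[OF chain_map]
            chain_reduced_rel hom_in_carrier[OF fold_gen_C x(1)]] by simp
      moreover have "fold_map H N' b' n (?cf n c) = reduced_rel H N' n #>\<^bsub>grp (nerve_complex N') n\<^esub> fold_gen b' n (lin a n x)"
        unfolding fold_map_def x(2)
        using coset_map_rcos[OF comm(3) comm(4) BX(1) BY(1) lin_hom lin_BX x(1)]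
          coset_map_rcos[OF comm(4) ng(2) BY(1) reduced_rel_subgroup[OF N'] fold_gen_H fold_H_rel hom_in_carrier[OF lin_hom x(1)]]
        by simp
      moreover have "reduced_rel H N' n #>\<^bsub>grp (nerve_complex N') n\<^esub> fold_gen b' n (lin a n x) =
          reduced_rel H N' n #>\<^bsub>grp (nerve_complex N') n\<^esub> chain n (fold_gen b n x)"
      proof (subst rcos_eq_iff[OF ng(2) reduced_rel_subgroup[OF N']])
        show "fold_gen b' n (lin a n x) \<in> carrier (grp (nerve_complex N') n)"
          using hom_in_carrier[OF fold_gen_H hom_in_carrier[OF lin_hom x(1)]] .
        show "chain n (fold_gen b n x) \<in> carrier (grp (nerve_complex N') n)"
          using chain_mapD(2)[OF chain_map hom_in_carrier[OF fold_gen_C x(1)]] .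
        show "\<exists>r\<in>reduced_rel H N' n. fold_gen b' n (lin a n x) = r \<otimes>\<^bsub>grp (nerve_complex N') n\<^esub> chain n (fold_gen b n x)"
          using square[OF x(1)] by (intro bexI[of _ "fold_gen b' n (lin a n x) - chain n (fold_gen b n x)"])
            (simp_all add: nerve_complex_simps)
      qed
      ultimately show "?cr n (fold_map C N b n c) = fold_map H N' b' n (?cf n c)" by simp
    qed
  qed
qed

end

context kan_unit
begin

lemma comparison_gl:
  assumes \<Delta>: "is_simplices \<Delta>" and box: "folding_operators (gl_nerve \<Delta>) (gl_nerve_map \<Delta>) box"
    and redC: "quasi_iso (C_gl \<Delta> C) (CR_gl \<Delta> C) (red_gl \<Delta> C)" and redH: "quasi_iso (C_gl \<Delta> H) (CR_gl \<Delta> H) (red_gl \<Delta> H)"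
    and foldC: "quasi_iso (CF_gl C) (CR_gl \<Delta> C) (fold_gl \<Delta> box C)"
    and foldH: "quasi_iso (CF_gl H) (CR_gl \<Delta> H) (fold_gl \<Delta> box H)"
  shows "quasi_iso (C_gl \<Delta> C) (C_gl \<Delta> H) (C_gl_map \<Delta> \<eta>)"
proof -
  let ?N = "gl_nerve \<Delta> C" and ?N' = "gl_nerve \<Delta> H" and ?m = "gl_nerve_map \<Delta> \<eta>" and ?a = "map_prod \<eta> \<eta>"
  let ?aC = "\<lambda>x. (dd C Neg 0 x, dd C Pos 0 x)" and ?aH = "\<lambda>x. (dd H Neg 0 x, dd H Pos 0 x)"
  interpret M: nerve_map C ?N H ?N' ?m ?a
    using redC redH by (intro nerve_map_gl[OF \<Delta>]) (auto simp: quasi_iso_def)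
  have Ob: "aug_simplices ?N = mor_dim 0 C \<times> mor_dim 0 C" "aug_simplices ?N' = mor_dim 0 H \<times> mor_dim 0 H"
    by (simp_all add: gl_nerve_def)
  interpret K: nerve_comparison C H \<eta> ?N ?N' ?m ?a "box C" "box H" ?aC ?aH None
  proof unfold_locales
    show "bij_betw ?a (aug_simplices ?N) (aug_simplices ?N')"
      unfolding Ob using unit_bij[of 0] by (intro bij_betw_map_prod) auto
    show "?aC x \<in> aug_simplices ?N" if "x \<in> mor_dim 1 C" for x
      using that C.mdim_dd[of x _ 0] unfolding Ob by (simp add: mor_dim_def)
    show "?aH x \<in> aug_simplices ?N'" if "x \<in> mor_dim 1 H" for x
      using that D.mdim_dd[of x _ 0] unfolding Ob by (simp add: mor_dim_def)
    show "?aH (\<eta> x) = ?a (?aC x)" if "x \<in> mor_dim 1 C" for x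
      using that by (simp add: mor_dim_def f_dd)
    fix k
    show "box C (Suc k) x \<in> simplices ?N k" if "x \<in> tr k (path C)" for x
      using box nc(1) that unfolding folding_operators_def by simp
    show "box H (Suc k) x \<in> simplices ?N' k" "ev ?N' k (box H (Suc k) x) = x" if "x \<in> tr k (path H)" for x
      using box nc(2) that unfolding folding_operators_def by simp_all
    show "box H (Suc k) (\<eta> x) = ?m k (box C (Suc k) x)" if "x \<in> tr k (path C)" for x
      using box nc f_nc that unfolding folding_operators_def by simp
  qed
  have "C_gl_map \<Delta> \<eta> = M.chain"
  proof (intro ext)
    fix n x
    have "(case g of Aug (a, b) \<Rightarrow> Aug (\<eta> a, \<eta> b) | Cell x \<Rightarrow> Cell (?m (n - 1) x)) = gen_map (?m (n - 1)) ?a g"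
      for g :: "(nat list set \<Rightarrow> 'u, 'u \<times> 'u) gen"
      by (cases g) (auto split: prod.split)
    then show "C_gl_map \<Delta> \<eta> n x = M.chain n x" by (simp add: C_gl_map_def M.chain_def)
  qed
  then show ?thesis
    using K.quasi_iso_chain redC redH foldC foldH
    by (simp add: C_gl_def CR_gl_def red_gl_def CF_gl_def fold_gl_def Ob formal_rel_simps)
qed

lemma comparison_sc:
  assumes I: "is_cubes I" and box: "folding_operators (sc_nerve I \<alpha>) (sc_nerve_map I) box"
    and redC: "quasi_iso (C_sc I \<alpha> C) (CR_sc I \<alpha> C) (red_sc I \<alpha> C)" and redH: "quasi_iso (C_sc I \<alpha> H) (CR_sc I \<alpha> H) (red_sc I \<alpha> H)"
    and foldC: "quasi_iso (CF_sc \<alpha> C) (CR_sc I \<alpha> C) (fold_sc I \<alpha> box C)"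
    and foldH: "quasi_iso (CF_sc \<alpha> H) (CR_sc I \<alpha> H) (fold_sc I \<alpha> box H)"
  shows "quasi_iso (C_sc I \<alpha> C) (C_sc I \<alpha> H) (C_sc_map I \<eta>)"
proof -
  let ?N = "sc_nerve I \<alpha> C" and ?N' = "sc_nerve I \<alpha> H" and ?m = "sc_nerve_map I \<eta>" and ?a = \<eta>
  let ?aC = "dd C \<alpha> 0" and ?aH = "dd H \<alpha> 0"
  interpret M: nerve_map C ?N H ?N' ?m ?a
    using redC redH by (intro nerve_map_sc[OF I]) (auto simp: quasi_iso_def)
  have Ob: "aug_simplices ?N = mor_dim 0 C" "aug_simplices ?N' = mor_dim 0 H"
    by (simp_all add: sc_nerve_def)
  interpret K: nerve_comparison C H \<eta> ?N ?N' ?m ?a "box C" "box H" ?aC ?aH "Some \<alpha>"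
  proof unfold_locales
    show "bij_betw ?a (aug_simplices ?N) (aug_simplices ?N')"
      unfolding Ob using unit_bij[of 0] by simp
    show "?aC x \<in> aug_simplices ?N" if "x \<in> mor_dim 1 C" for x
      using that C.mdim_dd[of x _ 0] unfolding Ob by (simp add: mor_dim_def)
    show "?aH x \<in> aug_simplices ?N'" if "x \<in> mor_dim 1 H" for x
      using that D.mdim_dd[of x _ 0] unfolding Ob by (simp add: mor_dim_def)
    show "?aH (\<eta> x) = ?a (?aC x)" if "x \<in> mor_dim 1 C" for x
      using that by (simp add: mor_dim_def f_dd)
    fix k
    show "box C (Suc k) x \<in> simplices ?N k" if "x \<in> tr k (path C)" for x
      using box nc(1) that unfolding folding_operators_def by simp
    show "box H (Suc k) x \<in> simplices ?N' k" "ev ?N' k (box H (Suc k) x) = x" if "x \<in> tr k (path H)" for x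
      using box nc(2) that unfolding folding_operators_def by simp_all
    show "box H (Suc k) (\<eta> x) = ?m k (box C (Suc k) x)" if "x \<in> tr k (path C)" for x
      using box nc f_nc that unfolding folding_operators_def by simp
  qed
  have "C_sc_map I \<eta> = M.chain"
  proof (intro ext)
    fix n x
    have "(case g of Aug a \<Rightarrow> Aug (\<eta> a) | Cell x \<Rightarrow> Cell (?m (n - 1) x)) = gen_map (?m (n - 1)) ?a g"
      for g :: "(int list set \<Rightarrow> 'u, 'u) gen"
      by (cases g) auto
    then show "C_sc_map I \<eta> n x = M.chain n x" by (simp add: C_sc_map_def M.chain_def)
  qed
  then show ?thesis
    using K.quasi_iso_chain redC redH foldC foldH
    by (simp add: C_sc_def CR_sc_def red_sc_def CF_sc_def fold_sc_def Ob formal_rel_simps)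
qed

end

theorem theorem1p7:
  fixes I :: "nat \<Rightarrow> int list set omegacat"
    and \<Delta> :: "nat \<Rightarrow> nat list set omegacat"
    and box_gl :: "'u omegacat \<Rightarrow> nat \<Rightarrow> 'u \<Rightarrow> (nat list set \<Rightarrow> 'u)"
    and box_sc :: "sign \<Rightarrow> 'u omegacat \<Rightarrow> nat \<Rightarrow> 'u \<Rightarrow> (int list set \<Rightarrow> 'u)"
    and K :: "'u precubical"
    and F H :: "'u omegacat"
    and \<kappa> :: "nat \<Rightarrow> 'u \<Rightarrow> int list set \<Rightarrow> 'u"
    and \<eta> :: "'u \<Rightarrow> 'u"
  assumes universe: "infinite (UNIV :: 'u set)"
    and cubes: "is_cubes I"
    and simplices: "is_simplices \<Delta>"
    and folding_gl: "folding_operators (gl_nerve \<Delta>) (gl_nerve_map \<Delta>) box_gl"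
    and folding_sc: "\<And>\<alpha>. folding_operators (sc_nerve I \<alpha>) (sc_nerve_map I) (box_sc \<alpha>)"
    and conj_i: "\<And>(K :: 'u precubical) (F :: 'u omegacat) \<kappa>.
        precubical_set K \<Longrightarrow> freely_generated I K F \<kappa> \<Longrightarrow>
        quasi_iso (C_gl \<Delta> F) (CR_gl \<Delta> F) (red_gl \<Delta> F) \<and>
        (\<forall>\<alpha>. quasi_iso (C_sc I \<alpha> F) (CR_sc I \<alpha> F) (red_sc I \<alpha> F))"
    and conj_ii: "\<And>(K :: 'u precubical) (F :: 'u omegacat) \<kappa> (H :: 'u omegacat) \<eta>.
        precubical_set K \<Longrightarrow> freely_generated I K F \<kappa> \<Longrightarrow> kan_completion F H \<eta> \<Longrightarrow>
        quasi_iso (C_gl \<Delta> H) (CR_gl \<Delta> H) (red_gl \<Delta> H) \<and>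
        (\<forall>\<alpha>. quasi_iso (C_sc I \<alpha> H) (CR_sc I \<alpha> H) (red_sc I \<alpha> H))"
    and conj_iii: "\<And>C :: 'u omegacat. non_contracting C \<Longrightarrow>
        quasi_iso (CF_gl C) (CR_gl \<Delta> C) (fold_gl \<Delta> box_gl C) \<and>
        (\<forall>\<alpha>. quasi_iso (CF_sc \<alpha> C) (CR_sc I \<alpha> C) (fold_sc I \<alpha> (box_sc \<alpha>) C))"
    and K: "precubical_set K"
    and F: "freely_generated I K F \<kappa>"
    and H: "kan_completion F H \<eta>"
  shows "quasi_iso (C_gl \<Delta> F) (C_gl \<Delta> H) (C_gl_map \<Delta> \<eta>) \<and>
         (\<forall>\<alpha>. quasi_iso (C_sc I \<alpha> F) (C_sc I \<alpha> H) (C_sc_map I \<eta>))"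
proof -
  interpret kan_unit F H \<eta> by unfold_locales fact+
  note i = conj_i[OF K F] and ii = conj_ii[OF K F H] and iiiF = conj_iii[OF nc(1)] and iiiH = conj_iii[OF nc(2)]
  have "quasi_iso (C_gl \<Delta> F) (C_gl \<Delta> H) (C_gl_map \<Delta> \<eta>)"
    using i ii iiiF iiiH by (intro comparison_gl[OF simplices folding_gl]) blast+
  moreover have "quasi_iso (C_sc I \<alpha> F) (C_sc I \<alpha> H) (C_sc_map I \<eta>)" for \<alpha>
    using i ii iiiF iiiH by (intro comparison_sc[OF cubes folding_sc]) blast+
  ultimately show ?thesis by blast
qed

end
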